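(* Let $G$ be a weighted graph (the communication network) and $T\subseteq G$ a rooted spanning tree of $G$ consisting of a root $r$ and $k$ vertex-disjoint descending paths $P_1,\dots,P_k$ (a star instance). There exists a deterministic $\tilde O(1)$-round Minor-Aggregation algorithm on $G$ that computes the minimum of the 1-respecting cut values $\min_{e\in E(T)}\mathrm{Cut}_{T,G}(e)$ and the 2-respecting cut values $\min_{i<j}\min_{e\in E(P_i),f\in E(P_j)}\mathrm{Cut}_{T,G}(e,f)$.
   Context: Minor-Aggregation model. The communication network is a connected undirected graph $G=(V,E)$ with $n=|V|$ nodes; both nodes and edges are computational units with private memory. Initially nodes know only their unique $\tilde O(1)$-bit ID (and inputs) and edges know the IDs of their endpoints. Computation proceeds in synchronous rounds, each of three steps: (i) Contraction: each edge $e$ chooses $c_e\in\{\bot,\top\}$, defining the minor $G'=G/\{e:c_e=\top\}$ (self-loops removed), whose vertices (supernodes) are identified with the sets of nodes they contain. (ii) Consensus: each node $v$ chooses an $\tilde O(1)$-bit value $x_v$; for each supernode $s$ all nodes of $s$ learn $y_s=\bigoplus_{v\in s}x_v$ for a predefined aggregation operator $\bigoplus$. (iii) Aggregation: each edge $e$ of $G'$ joining supernodes $a,b$ learns $y_a,y_b$ and chooses $\tilde O(1)$-bit values $z_{e,a},z_{e,b}$; all nodes of each supernode $s$ learn the same aggregate $\bigotimes_{e \text{ incident to } s} z_{e,s}$ for a predefined aggregation operator $\bigotimes$. An aggregation operator maps two $B$-bit messages ($B=\tilde O(1)$) to one $B$-bit message, applied pairwise in arbitrary order to aggregate several messages. $\tilde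 O(\cdot)$ hides $\mathrm{poly}(\log n)$ factors. Inputs are distributedly stored: each edge knows its weight (positive integers bounded by $\mathrm{poly}(n)$) and whether it is in $T$, each tree edge knows which endpoint is closer to the root. A descending path is a path $(v_1,\dots,v_k)$ in the rooted tree with each $v_{i+1}$ a child of $v_i$. For tree edges $e,f$: $\mathrm{Cut}_{T,G}(e)$ is the total weight of edges $\{u,v\}\in E(G)$ whose unique $u$–$v$ path in $T$ contains $e$; $\mathrm{Cut}_{T,G}(e,f)$ is the total weight of edges $\{u,v\}\in E(G)$ whose unique $u$–$v$ path in $T$ contains exactly one of $e,f$. *)

theory Defs
  imports Complex_Main "HOL-Library.Landau_Symbols" "HOL-Library.Multiset"
begin

section \<open>Growth classes\<close>

definition soft_O_1 :: "(nat \<Rightarrow> nat) \<Rightarrow> bool" where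
  "soft_O_1 f \<longleftrightarrow> (\<exists>k::nat. (\<lambda>n. real (f n)) \<in> O(\<lambda>n. ln (real n) ^ k))"

definition poly_bounded :: "(nat \<Rightarrow> nat) \<Rightarrow> bool" where
  "poly_bounded f \<longleftrightarrow> (\<exists>k::nat. (\<lambda>n. real (f n)) \<in> O(\<lambda>n. real n ^ k))"


section \<open>Undirected graphs and rooted spanning trees\<close>

text \<open>Nodes are identified with their unique IDs, which are natural numbers. An edge is the
  two-element set of its endpoints.\<close>

type_synonym node = nat
type_synonym edge = "nat set"

definition adj :: "edge set \<Rightarrow> (node \<times> node) set" where
  "adj E = {(u, v). {u, v} \<in> E}"

definition ugraph :: "node set \<Rightarrow> edge set \<Rightarrow> bool" where
  "ugraph V E \<longleftrightarrow> finite V \<and> V \<noteq> {} \<and> (\<forall>e\<in>E. e \<subseteq> V \<and> card e = 2)"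

definition connected_graph :: "node set \<Rightarrow> edge set \<Rightarrow> bool" where
  "connected_graph V E \<longleftrightarrow> (\<forall>u\<in>V. \<forall>v\<in>V. (u, v) \<in> (adj E)\<^sup>*)"

definition simple_path :: "edge set \<Rightarrow> node list \<Rightarrow> bool" where
  "simple_path E p \<longleftrightarrow> p \<noteq> [] \<and> distinct p \<and> successively (\<lambda>u v. {u, v} \<in> E) p"

definition path_edges :: "node list \<Rightarrow> edge set" where
  "path_edges p = {{p ! i, p ! Suc i} | i. Suc i < length p}"

definition acyclic_graph :: "edge set \<Rightarrow> bool" where
  "acyclic_graph E \<longleftrightarrow> \<not> (\<exists>p. simple_path E p \<and> length p \<ge> 3 \<and> {last p, hd p} \<in> E)"

definition spanning_tree :: "node set \<Rightarrow> edge set \<Rightarrow> edge set \<Rightarrow> bool" where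
  "spanning_tree V E T \<longleftrightarrow> T \<subseteq> E \<and> connected_graph V T \<and> acyclic_graph T"

definition tree_path :: "edge set \<Rightarrow> node \<Rightarrow> node \<Rightarrow> node list" where
  "tree_path T u v = (THE p. simple_path T p \<and> hd p = u \<and> last p = v)"

definition depth :: "edge set \<Rightarrow> node \<Rightarrow> node \<Rightarrow> nat" where
  "depth T r v = length (tree_path T r v) - 1"

definition child_of :: "edge set \<Rightarrow> node \<Rightarrow> node \<Rightarrow> node \<Rightarrow> bool" where
  "child_of T r u v \<longleftrightarrow> {u, v} \<in> T \<and> depth T r u < depth T r v"
  \<comment> \<open>\<open>v\<close> is a child of \<open>u\<close>\<close>

definition descending_path :: "edge set \<Rightarrow> node \<Rightarrow> node list \<Rightarrow> bool" where
  "descending_path T r p \<longleftrightarrow> p \<noteq> [] \<and> successively (child_of T r) p"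


section \<open>Problem instances\<close>

record network =
  nodes :: "node set"
  edges :: "edge set"
  weight :: "edge \<Rightarrow> nat"
  tree :: "edge set"
  tree_root :: node

definition size_of :: "network \<Rightarrow> nat" where
  "size_of N = card (nodes N)"

definition valid_network :: "(nat \<Rightarrow> nat) \<Rightarrow> (nat \<Rightarrow> nat) \<Rightarrow> network \<Rightarrow> bool" where
  "valid_network id_bits max_weight N \<longleftrightarrow>
     ugraph (nodes N) (edges N) \<and> connected_graph (nodes N) (edges N) \<and>
     (\<forall>v\<in>nodes N. v < 2 ^ id_bits (size_of N)) \<and>
     (\<forall>e\<in>edges N. 0 < weight N e \<and> weight N e \<le> max_weight (size_of N)) \<and>
     spanning_tree (nodes N) (edges N) (tree N) \<and> tree_root N \<in> nodes N"

definition star_instance :: "network \<Rightarrow> node list list \<Rightarrow> bool" where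
  "star_instance N Ps \<longleftrightarrow>
     Ps \<noteq> [] \<and>
     (\<forall>P\<in>set Ps. descending_path (tree N) (tree_root N) P \<and>
        child_of (tree N) (tree_root N) (tree_root N) (hd P)) \<and>
     (\<forall>i<length Ps. \<forall>j<length Ps. i \<noteq> j \<longrightarrow> set (Ps ! i) \<inter> set (Ps ! j) = {}) \<and>
     tree_root N \<notin> (\<Union>P\<in>set Ps. set P) \<and>
     nodes N = insert (tree_root N) (\<Union>P\<in>set Ps. set P)"

definition cut1 :: "network \<Rightarrow> edge \<Rightarrow> nat" where
  "cut1 N e = (\<Sum>d | d \<in> edges N \<and>
     (\<exists>u v. d = {u, v} \<and> e \<in> path_edges (tree_path (tree N) u v)). weight N d)"

definition cut2 :: "network \<Rightarrow> edge \<Rightarrow> edge \<Rightarrow> nat" where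
  "cut2 N e f = (\<Sum>d | d \<in> edges N \<and>
     (\<exists>u v. d = {u, v} \<and> (e \<in> path_edges (tree_path (tree N) u v)) \<noteq>
                        (f \<in> path_edges (tree_path (tree N) u v))). weight N d)"

text \<open>The tree edge joining the root to the top of a path \<open>P\<close> is an edge of the tree but joins
  \<open>P\<close> to a node outside it. The parameter \<open>link\<close> says whether this edge is counted as an
  edge of \<open>P\<close> (so that the edge sets of the paths partition the tree) or not (only edges
  between consecutive nodes of \<open>P\<close>).\<close>

definition star_path_edges :: "bool \<Rightarrow> network \<Rightarrow> node list \<Rightarrow> edge set" where
  "star_path_edges link N P = path_edges (if link then tree_root N # P else P)"

definition star_min_cut :: "bool \<Rightarrow> network \<Rightarrow> node list list \<Rightarrow> nat" where
  "star_min_cut link N Ps = Min (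
     {cut1 N e | e. e \<in> tree N} \<union>
     {cut2 N e f | e f i j. i < j \<and> j < length Ps \<and>
        e \<in> star_path_edges link N (Ps ! i) \<and> f \<in> star_path_edges link N (Ps ! j)})"


section \<open>The Minor-Aggregation model\<close>

type_synonym msg = "bool list"

text \<open>The possible results of combining a nonempty multiset of messages by pairwise applications
  of \<open>f\<close> in arbitrary order. As \<open>f\<close> need not be associative or commutative, there may be
  several; an algorithm has to be correct for every one of them.\<close>

inductive aggregates :: "(msg \<Rightarrow> msg \<Rightarrow> msg) \<Rightarrow> msg multiset \<Rightarrow> msg \<Rightarrow> bool"
  for f :: "msg \<Rightarrow> msg \<Rightarrow> msg" where
  single: "aggregates f {#x#} x"
| combine: "aggregates f M x \<Longrightarrow> aggregates f N y \<Longrightarrow> aggregates f (M + N) (f x y)"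

definition aggregation_operator :: "nat \<Rightarrow> (msg \<Rightarrow> msg \<Rightarrow> msg) \<Rightarrow> bool" where
  "aggregation_operator B f \<longleftrightarrow>
     (\<forall>x y. length x \<le> B \<and> length y \<le> B \<longrightarrow> length (f x y) \<le> B)"

text \<open>What an edge knows initially: its endpoints (in increasing order), its weight, and, exactly
  for tree edges, the endpoint that is closer to the root.\<close>

record edge_input =
  lower_id :: node
  upper_id :: node
  input_weight :: nat
  input_parent :: "node option"

definition edge_input_of :: "network \<Rightarrow> edge \<Rightarrow> edge_input" where
  "edge_input_of N e =
     \<lparr> lower_id = Min e, upper_id = Max e, input_weight = weight N e,
       input_parent = (if e \<in> tree N
         then Some (THE u. \<exists>v. e = {u, v} \<and> child_of (tree N) (tree_root N) u v) else None) \<rparr>"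

text \<open>Private memory is the complete list of what has been learned, one entry per past round. A
  node learns its consensus value and the aggregate over the edges incident to its supernode
  (\<open>None\<close> if there are no such edges). An edge learns the consensus values of the supernodes
  of its lower and upper endpoint (\<open>None\<close> if it is not an edge of the minor).\<close>

type_synonym node_memory = "(msg \<times> msg option) list"
type_synonym edge_memory = "(msg \<times> msg) option list"

text \<open>The \<open>nat\<close> argument of the two operators is the round number. The pair returned by
  \<open>edge_msg\<close> is addressed to the supernodes of the lower and of the upper endpoint.\<close>

record algorithm =
  contract :: "edge_input \<Rightarrow> edge_memory \<Rightarrow> bool"
  node_msg :: "node \<Rightarrow> node_memory \<Rightarrow> msg"
  consensus_op :: "nat \<Rightarrow> msg \<Rightarrow> msg \<Rightarrow> msg"
  edge_msg :: "edge_input \<Rightarrow> edge_memory \<Rightarrow> msg \<times> msg \<Rightarrow> msg \<times> msg"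
  aggregation_op :: "nat \<Rightarrow> msg \<Rightarrow> msg \<Rightarrow> msg"
  result :: "node \<Rightarrow> node_memory \<Rightarrow> nat option"

definition contracted :: "algorithm \<Rightarrow> network \<Rightarrow> (edge \<Rightarrow> edge_memory) \<Rightarrow> edge set" where
  "contracted A N me = {e \<in> edges N. contract A (edge_input_of N e) (me e)}"

definition supernode :: "edge set \<Rightarrow> node \<Rightarrow> node set" where
  "supernode C v = {u. (v, u) \<in> (adj C)\<^sup>*}"

definition minor_edges :: "network \<Rightarrow> edge set \<Rightarrow> edge set" where
  "minor_edges N C = {e \<in> edges N. supernode C (Min e) \<noteq> supernode C (Max e)}"

definition incident_edges :: "network \<Rightarrow> edge set \<Rightarrow> node set \<Rightarrow> edge set" where
  "incident_edges N C s =
     {e \<in> minor_edges N C. supernode C (Min e) = s \<or> supernode C (Max e) = s}"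

definition edge_msgs ::
  "algorithm \<Rightarrow> network \<Rightarrow> edge set \<Rightarrow> (edge \<Rightarrow> edge_memory) \<Rightarrow> (node set \<Rightarrow> msg) \<Rightarrow> edge \<Rightarrow> msg \<times> msg"
  where
  "edge_msgs A N C me y e =
     edge_msg A (edge_input_of N e) (me e) (y (supernode C (Min e)), y (supernode C (Max e)))"

definition msg_to ::
  "algorithm \<Rightarrow> network \<Rightarrow> edge set \<Rightarrow> (edge \<Rightarrow> edge_memory) \<Rightarrow> (node set \<Rightarrow> msg) \<Rightarrow> node set \<Rightarrow> edge \<Rightarrow> msg"
  where
  "msg_to A N C me y s e =
     (if supernode C (Min e) = s then fst else snd) (edge_msgs A N C me y e)"

text \<open>Round \<open>t\<close> takes the memories \<open>mv\<close>, \<open>me\<close> to \<open>mv'\<close>, \<open>me'\<close>, where \<open>y\<close> and \<open>a\<close> are the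
  results of the consensus and the aggregation step at each supernode.\<close>

definition ma_round ::
  "algorithm \<Rightarrow> network \<Rightarrow> nat \<Rightarrow> (node \<Rightarrow> node_memory) \<Rightarrow> (edge \<Rightarrow> edge_memory) \<Rightarrow>
   (node set \<Rightarrow> msg) \<Rightarrow> (node set \<Rightarrow> msg option) \<Rightarrow>
   (node \<Rightarrow> node_memory) \<Rightarrow> (edge \<Rightarrow> edge_memory) \<Rightarrow> bool" where
  "ma_round A N t mv me y a mv' me' \<longleftrightarrow>
     (let C = contracted A N me in
       (\<forall>s \<in> supernode C ` nodes N.
          aggregates (consensus_op A t) {#node_msg A v (mv v). v \<in># mset_set s#} (y s) \<and>
          (if incident_edges N C s = {} then a s = None
           else \<exists>m. a s = Some m \<and>
             aggregates (aggregation_op A t)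
               {#msg_to A N C me y s e. e \<in># mset_set (incident_edges N C s)#} m)) \<and>
       (\<forall>v \<in> nodes N. mv' v = mv v @ [(y (supernode C v), a (supernode C v))]) \<and>
       (\<forall>e \<in> edges N. me' e = me e @
          [if e \<in> minor_edges N C
           then Some (y (supernode C (Min e)), y (supernode C (Max e))) else None]))"

definition execution ::
  "algorithm \<Rightarrow> network \<Rightarrow> (nat \<Rightarrow> node \<Rightarrow> node_memory) \<Rightarrow> (nat \<Rightarrow> edge \<Rightarrow> edge_memory) \<Rightarrow>
   (nat \<Rightarrow> node set \<Rightarrow> msg) \<Rightarrow> (nat \<Rightarrow> node set \<Rightarrow> msg option) \<Rightarrow> bool" where
  "execution A N mv me y a \<longleftrightarrow>
     (\<forall>v\<in>nodes N. mv 0 v = []) \<and> (\<forall>e\<in>edges N. me 0 e = []) \<and>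
     (\<forall>t. ma_round A N t (mv t) (me t) (y t) (a t) (mv (Suc t)) (me (Suc t)))"

definition respects_msg_size ::
  "algorithm \<Rightarrow> network \<Rightarrow> nat \<Rightarrow> (nat \<Rightarrow> node \<Rightarrow> node_memory) \<Rightarrow> (nat \<Rightarrow> edge \<Rightarrow> edge_memory) \<Rightarrow>
   (nat \<Rightarrow> node set \<Rightarrow> msg) \<Rightarrow> bool" where
  "respects_msg_size A N B mv me y \<longleftrightarrow>
     (\<forall>t. (\<forall>v\<in>nodes N. length (node_msg A v (mv t v)) \<le> B) \<and>
          (let C = contracted A N (me t) in
            \<forall>e\<in>minor_edges N C. length (fst (edge_msgs A N C (me t) (y t) e)) \<le> B \<and>
                                length (snd (edge_msgs A N C (me t) (y t) e)) \<le> B))"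

text \<open>With \<open>B\<close>-bit messages, after at most \<open>R\<close> rounds every node has output \<open>val\<close>, and no node
  ever outputs anything else. The algorithm itself is not given \<open>B\<close>, \<open>R\<close> or the number of
  nodes.\<close>

definition computes :: "algorithm \<Rightarrow> network \<Rightarrow> nat \<Rightarrow> nat \<Rightarrow> nat \<Rightarrow> bool" where
  "computes A N B R val \<longleftrightarrow>
     (\<forall>t. aggregation_operator B (consensus_op A t) \<and> aggregation_operator B (aggregation_op A t)) \<and>
     (\<forall>mv me y a. execution A N mv me y a \<longrightarrow>
        respects_msg_size A N B mv me y \<and>
        (\<forall>v\<in>nodes N. (\<forall>t. result A v (mv t v) \<in> {None, Some val}) \<and>
                     (\<forall>t\<ge>R. result A v (mv t v) = Some val)))"


section \<open>Every algorithm has an execution\<close>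

lemma aggregates_exists: "M \<noteq> {#} \<Longrightarrow> \<exists>x. aggregates f M x"
proof (induction M)
  case empty
  then show ?case by simp
next
  case (add x M)
  show ?case
  proof (cases "M = {#}")
    case True
    then show ?thesis using aggregates.single by auto
  next
    case False
    then obtain z where "aggregates f M z" using add.IH by blast
    from aggregates.combine[OF this aggregates.single[of f x]] show ?thesis by auto
  qed
qed

lemma finite_supernode:
  assumes "ugraph (nodes N) (edges N)" "C \<subseteq> edges N" "v \<in> nodes N"
  shows "finite (supernode C v)"
proof -
  have "u \<in> nodes N" if "(v, u) \<in> (adj C)\<^sup>*" for u
    using that
  proof (induction rule: rtrancl_induct)
    case base
    show ?case by (rule assms(3))
  next
    case (step u w)
    then have "{u, w} \<in> edges N" using assms(2) by (auto simp: adj_def)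
    then show ?case using assms(1) unfolding ugraph_def by blast
  qed
  then have "supernode C v \<subseteq> nodes N" by (auto simp: supernode_def)
  then show ?thesis using assms by (meson finite_subset ugraph_def)
qed

lemma ma_round_exists:
  assumes G: "ugraph (nodes N) (edges N)"
  shows "\<exists>y a mv' me'. ma_round A N t mv me y a mv' me'"
proof -
  define C where "C = contracted A N me"
  have CE: "C \<subseteq> edges N" by (auto simp: C_def contracted_def)
  have "edges N \<subseteq> Pow (nodes N)" using G unfolding ugraph_def by blast
  then have finE: "finite (edges N)" using G by (meson finite_Pow_iff finite_subset ugraph_def)
  define y where "y s = (SOME m. aggregates (consensus_op A t)
      {#node_msg A v (mv v). v \<in># mset_set s#} m)" for s
  define z where "z s = (SOME m. aggregates (aggregation_op A t)
      {#msg_to A N C me y s e. e \<in># mset_set (incident_edges N C s)#} m)" for s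
  define a where "a s = (if incident_edges N C s = {} then None else Some (z s))" for s
  have 1: "aggregates (consensus_op A t) {#node_msg A v (mv v). v \<in># mset_set s#} (y s)"
    if "s \<in> supernode C ` nodes N" for s
  proof -
    from that obtain v where v: "v \<in> nodes N" "s = supernode C v" by auto
    then have "finite s" "v \<in> s" using finite_supernode[OF G CE] by (auto simp: supernode_def)
    then have "{#node_msg A v (mv v). v \<in># mset_set s#} \<noteq> {#}"
      by (auto simp: mset_set_empty_iff)
    then show ?thesis unfolding y_def by (rule someI_ex[OF aggregates_exists])
  qed
  have 2: "aggregates (aggregation_op A t)
      {#msg_to A N C me y s e. e \<in># mset_set (incident_edges N C s)#} (z s)"
    if "incident_edges N C s \<noteq> {}" for s
  proof -
    have "finite (incident_edges N C s)"
      using finE by (rule rev_finite_subset) (auto simp: incident_edges_def minor_edges_def)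
    with that have "{#msg_to A N C me y s e. e \<in># mset_set (incident_edges N C s)#} \<noteq> {#}"
      by (auto simp: mset_set_empty_iff)
    then show ?thesis unfolding z_def by (rule someI_ex[OF aggregates_exists])
  qed
  have "ma_round A N t mv me y a
     (\<lambda>v. mv v @ [(y (supernode C v), a (supernode C v))])
     (\<lambda>e. me e @ [if e \<in> minor_edges N C
           then Some (y (supernode C (Min e)), y (supernode C (Max e))) else None])"
    unfolding ma_round_def Let_def C_def[symmetric] using 1 2 by (auto simp: a_def)
  then show ?thesis by blast
qed

lemma execution_exists:
  assumes "ugraph (nodes N) (edges N)"
  shows "\<exists>mv me y a. execution A N mv me y a"
proof -
  define step where "step t m = (SOME q. case q of (y, a, mv', me') \<Rightarrow>
      ma_round A N t (fst m) (snd m) y a mv' me')" for t m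
  have step: "case step t m of (y, a, mv', me') \<Rightarrow> ma_round A N t (fst m) (snd m) y a mv' me'" for t m
    unfolding step_def
    by (rule someI_ex) (use ma_round_exists[OF assms, of A t "fst m" "snd m"] in auto)
  define m where "m = rec_nat (\<lambda>_. [], \<lambda>_. []) (\<lambda>t m. snd (snd (step t m)))"
  have m: "m 0 = (\<lambda>_. [], \<lambda>_. [])" "m (Suc t) = snd (snd (step t (m t)))" for t
    by (simp_all add: m_def)
  have "execution A N (\<lambda>t. fst (m t)) (\<lambda>t. snd (m t))
     (\<lambda>t. fst (step t (m t))) (\<lambda>t. fst (snd (step t (m t))))"
    unfolding execution_def using step by (auto simp: m split_beta)
  then show ?thesis by blast
qed

end

theory Submission
  imports Defs
begin

text \<open>Write \<open>w(e, f)\<close> for the weight of the edges whose tree path contains both \<open>e\<close> and \<open>f\<close>, so that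
  \<open>Cut(e, f) = Cut(e) + Cut(f) - 2 w(e, f)\<close>. All cut values of single edges are suffix sums along the
  paths. A pair can beat both single cuts only if \<open>w(e, f)\<close> is more than half of the weight that
  leaves the path of \<open>e\<close> below \<open>e\<close> towards other paths. Grouping the edges of a path by the order of
  magnitude of that weight, the partner path carries more than a quarter of the weight of one of
  logarithmically many suffixes, so it is one of four weighted quantiles of the path identifiers. For
  each pair of quantile indices the paths that select each other form a matching, and these pairs
  are treated in parallel. For one pair of paths the matrix of cut values has the Monge property, and
  a divide and conquer over dyadic blocks of one path finds its minimum in logarithmically many levels.

  Suffix sums need positions. Segments of the paths are merged in pairs, the symmetry being broken by
  the first bit in which the identifiers of adjacent segments differ.\<close>

section \<open>Fixed-width messages\<close>

text \<open>The model shapes the construction in three ways. The algorithm is not told the number of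
  nodes, so two calibration rounds first agree on a bit length \<open>L\<close> that sizes all later
  fields. The order of aggregation is arbitrary, so only addition modulo a power of two and maximum
  are used. Contraction joins connected pieces only, so all shared data belongs to contiguous
  stretches of a path.

  A pair that beats both of its single cuts satisfies the half-weight condition from both sides;
  this is why insisting on a mutual choice loses nothing.

  In the divide and conquer, a block of one path and its interval on the other can talk only over an
  edge that joins them. If there is none, the rectangle is dropped. This is sound: with no edge
  inside, its rows compare its columns exactly as the middle row of the parent block did, so the
  optimum found there is as good. As cut values involve entire suffixes, the weight between what
  lies beyond the block and what lies beyond the interval is carried along separately.\<close>

type_synonym vec = "nat \<Rightarrow> nat"

definition enc :: "nat \<Rightarrow> vec \<Rightarrow> msg" where
  "enc n x = map (\<lambda>j. bit (x (j div n)) (j mod n)) [0..<8 * n]"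

text \<open>The field width is read off the message length. Indices from 8 on yield 0, so decoded
  messages are total functions and can be compared by plain equality.\<close>

definition dec :: "msg \<Rightarrow> vec" where
  "dec m i = (if i < 8 then horner_sum of_bool 2
     (map (\<lambda>k. m ! (i * (length m div 8) + k)) [0..<length m div 8]) else 0)"

definition trunc :: "nat \<Rightarrow> vec \<Rightarrow> vec" where
  "trunc n x i = (if i < 8 then x i mod 2 ^ n else 0)"

lemma length_enc [simp]: "length (enc n x) = 8 * n"
  by (simp add: enc_def)

lemma dec_enc: "dec (enc n x) = trunc n x"
proof
  fix i
  have "map (\<lambda>k. enc n x ! (i * n + k)) [0..<n] = map (bit (x i)) [0..<n]" if "i < 8"
  proof (rule map_cong[OF refl])
    fix k assume "k \<in> set [0..<n]"
    then have k: "k < n" by simp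
    have "Suc i * n \<le> 8 * n" using that by (intro mult_le_mono1) simp
    then have "i * n + k < 8 * n" using k unfolding mult_Suc by linarith
    then show "enc n x ! (i * n + k) = bit (x i) k"
      using k by (simp add: enc_def)
  qed
  then show "dec (enc n x) i = trunc n x i"
    by (cases "i < 8") (simp_all add: dec_def trunc_def horner_sum_bit_eq_take_bit take_bit_eq_mod
      del: map_eq_conv)
qed

lemma dec_less: "length m = 8 * n \<Longrightarrow> dec m i < 2 ^ n"
  using horner_sum_of_bool_2_less[of "map (\<lambda>k. m ! (i * n + k)) [0..<n]", where ?'a = nat]
  by (simp add: dec_def)

text \<open>Fields 0 and 1 are added modulo the field width, the others are maximised. The operator
  recovers the field width from the length of its arguments.\<close>

definition vec_op :: "msg \<Rightarrow> msg \<Rightarrow> msg" where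
  "vec_op m m' = (if length m = length m'
     then enc (length m div 8) (\<lambda>i. if i < 2 then dec m i + dec m' i else max (dec m i) (dec m' i))
     else [])"

text \<open>Applied to unary strings, whose aggregate then has the maximum length. It serves while
  no common field width is known.\<close>

definition longer :: "msg \<Rightarrow> msg \<Rightarrow> msg" where
  "longer m m' = (if length m \<le> length m' then m' else m)"

text \<open>The result has \<open>8 * (length m div 8)\<close> bits or none, never more than the
  arguments. Hence the bound holds for every \<open>B\<close>, although the operator knows neither
  \<open>B\<close> nor the intended width.\<close>

lemma aggregation_operator_vec_op: "aggregation_operator B vec_op"
  by (auto simp: aggregation_operator_def vec_op_def)

lemma aggregation_operator_longer: "aggregation_operator B longer"
  by (auto simp: aggregation_operator_def longer_def)

lemma aggregates_longer:
  "aggregates longer M m \<Longrightarrow> M \<noteq> {#} \<and> length m = Max (length ` set_mset M)"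
proof (induction rule: aggregates.induct)
  case (combine M x N y)
  then show ?case by (auto simp: longer_def image_Un Max_Un max_def)
qed simp

text \<open>Addition modulo \<open>2 ^ n\<close> and maximum are associative and commutative, so
  every order of aggregation decodes to the same value. This removes the nondeterminism of the
  model.\<close>

lemma aggregates_vec_op:
  "aggregates vec_op M m \<Longrightarrow> \<forall>y\<in>#M. length y = 8 * n \<Longrightarrow>
   M \<noteq> {#} \<and> length m = 8 * n \<and>
   dec m i = (if i < 2 then (\<Sum>y\<in>#M. dec y i) mod 2 ^ n else Max ((\<lambda>y. dec y i) ` set_mset M))"
proof (induction rule: aggregates.induct)
  case (single x)
  then show ?case by (simp add: dec_less)
next
  case (combine M x N y)
  then have IH: "length x = 8 * n" "length y = 8 * n" "M \<noteq> {#}" "N \<noteq> {#}"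
    "dec x i = (if i < 2 then (\<Sum>y\<in>#M. dec y i) mod 2 ^ n else Max ((\<lambda>y. dec y i) ` set_mset M))"
    "dec y i = (if i < 2 then (\<Sum>y\<in>#N. dec y i) mod 2 ^ n else Max ((\<lambda>y. dec y i) ` set_mset N))"
    by auto
  have "dec (vec_op x y) i = (if i < 2 then (dec x i + dec y i) mod 2 ^ n else max (dec x i) (dec y i))"
    using dec_less[OF IH(1), of i] dec_less[OF IH(2), of i]
    by (auto simp: vec_op_def IH(1,2) dec_enc trunc_def) (auto simp: dec_def)
  then show ?case
    using IH by (simp add: image_Un Max_Un mod_simps vec_op_def)
qed

text \<open>The order-independent value of an aggregation. Inserting 0 into the maximum gives the
  empty set the zero vector, in agreement with \<open>opt_vec None\<close> at a node without
  incident edges.\<close>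

definition vagg :: "nat \<Rightarrow> ('a \<Rightarrow> vec) \<Rightarrow> 'a set \<Rightarrow> vec" where
  "vagg n f K i = (if i < 2 then (\<Sum>u\<in>K. f u i) mod 2 ^ n
     else if i < 8 then Max (insert 0 ((\<lambda>u. f u i mod 2 ^ n) ` K)) else 0)"

lemma aggregates_enc:
  assumes "aggregates vec_op {#enc n (f u). u \<in># mset_set K#} m" "finite K"
  shows "dec m = vagg n f K" "length m = 8 * n"
proof -
  note A = aggregates_vec_op[OF assms(1), of n]
  from A assms(2) have ne: "K \<noteq> {}" and "length m = 8 * n" by auto
  then show "length m = 8 * n" by simp
  show "dec m = vagg n f K"
  proof
    fix i
    have "Max ((\<lambda>u. f u i mod 2 ^ n) ` K) = Max (insert 0 ((\<lambda>u. f u i mod 2 ^ n) ` K))"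
      using ne assms(2) by (subst Max_insert) auto
    moreover have "(\<Sum>u\<in>K. f u i mod 2 ^ n) mod 2 ^ n = (\<Sum>u\<in>K. f u i) mod 2 ^ n"
      by (rule mod_sum_eq)
    moreover have "(\<lambda>u. 0::nat) ` K = {0}" using ne by auto
    ultimately show "dec m i = vagg n f K i"
      using A[of i] assms(2)
      by (auto simp: vagg_def dec_enc trunc_def image_image sum_unfold_sum_mset[symmetric]
          image_mset.compositionality comp_def)
  qed
qed

lemma vagg_cong:
  assumes "K = K'" "\<And>u. u \<in> K' \<Longrightarrow> f u = g u"
  shows "vagg n f K = vagg n g K'"
proof
  fix i
  have "(\<lambda>u. f u i mod 2 ^ n) ` K = (\<lambda>u. g u i mod 2 ^ n) ` K'" using assms by auto
  then show "vagg n f K i = vagg n g K' i" using assms by (simp add: vagg_def)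
qed

lemma vagg_reindex:
  assumes "inj_on h K" shows "vagg n f (h ` K) = vagg n (\<lambda>u. f (h u)) K"
  using assms by (intro ext) (simp add: vagg_def sum.reindex image_image)

section \<open>Programs and their compilation\<close>

definition bitlen :: "nat \<Rightarrow> nat" where
  "bitlen x = (LEAST k. x < 2 ^ k)"

lemma less_two_power_bitlen: "x < 2 ^ bitlen x"
  unfolding bitlen_def by (rule LeastI[of _ x]) simp

lemma bitlen_le: "x < 2 ^ k \<Longrightarrow> bitlen x \<le> k"
  unfolding bitlen_def by (rule Least_le)

text \<open>A step takes two rounds. In the first nothing is contracted: every node sends \<open>bcast\<close> to its
  edges, and an edge returns \<open>reply w d x x'\<close> to the endpoint that sent \<open>x\<close>, where \<open>d\<close> is 0 for a
  nontree edge, 1 if that endpoint is the child, and 2 if it is the parent. In the second the tree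
  edges with \<open>join x x'\<close> (\<open>x\<close> being sent by the parent) are contracted and the values \<open>share\<close> are
  aggregated over the supernodes.\<close>

record 's step =
  bcast :: "'s \<Rightarrow> vec"
  reply :: "nat \<Rightarrow> nat \<Rightarrow> vec \<Rightarrow> vec \<Rightarrow> vec"
  join :: "vec \<Rightarrow> vec \<Rightarrow> bool"
  share :: "'s \<Rightarrow> vec \<Rightarrow> vec"
  update :: "'s \<Rightarrow> vec \<Rightarrow> vec \<Rightarrow> 's"

text \<open>Eight fields of this width make \<open>128 * (L + 1)\<close> bits, from which
  \<open>width_inv\<close> recovers \<open>L\<close>. The factor 16 leaves room for all numbers up
  to \<open>2 ^ (15 * L + 15)\<close>; sums of weights in the program stay below
  \<open>2 ^ (5 * L + 15)\<close>.\<close>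

definition width :: "nat \<Rightarrow> nat" where
  "width L = 16 * (L + 1)"

definition width_inv :: "msg \<Rightarrow> nat" where
  "width_inv m = length m div 128 - 1"

definition opt_vec :: "msg option \<Rightarrow> vec" where
  "opt_vec x = (case x of None \<Rightarrow> \<lambda>_. 0 | Some m \<Rightarrow> dec m)"

definition direction :: "edge_input \<Rightarrow> node \<Rightarrow> nat" where
  "direction inp v = (case input_parent inp of None \<Rightarrow> 0 | Some p \<Rightarrow> if p = v then 2 else 1)"

text \<open>Memory is the raw history, so the state is recomputed from it. Entry 1 holds the
  calibration string of length \<open>L\<close>; entries \<open>2 + 2 * i\<close> and
  \<open>3 + 2 * i\<close> belong to the two rounds of step \<open>i\<close>.\<close>

primrec node_state ::
  "(nat \<Rightarrow> 's step list) \<Rightarrow> (node \<Rightarrow> 's) \<Rightarrow> node \<Rightarrow> node_memory \<Rightarrow> nat \<Rightarrow> 's" where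
  "node_state prog init v mem 0 = init v"
| "node_state prog init v mem (Suc i) =
     update (prog (length (fst (mem ! 1))) ! i) (node_state prog init v mem i)
       (opt_vec (snd (mem ! (2 + 2 * i)))) (dec (fst (mem ! (3 + 2 * i))))"

text \<open>Rounds 0 and 1 calibrate: edges announce the bit lengths of their weights in unary, then
  the entire graph is contracted and the longest string over all weights and identifiers is agreed
  on. Edges do not see that string, as all of them are contracted in round 1; they read
  \<open>L\<close> off the width of the encoded messages that reach them later.\<close>

definition compile ::
  "(nat \<Rightarrow> 's step list) \<Rightarrow> (node \<Rightarrow> 's) \<Rightarrow> ('s \<Rightarrow> nat) \<Rightarrow> algorithm" where
  "compile prog init outp = \<lparr>
     contract = (\<lambda>inp mem. let t = length mem in
       if t = 1 then True else if even t then False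
       else (case last mem of None \<Rightarrow> False | Some (a, b) \<Rightarrow>
         (case input_parent inp of None \<Rightarrow> False | Some p \<Rightarrow>
           (let s = prog (width_inv a) ! (t div 2 - 1) in
             if p = lower_id inp then join s (dec a) (dec b) else join s (dec b) (dec a))))),
     node_msg = (\<lambda>v mem. let t = length mem in
       if t = 0 then []
       else if t = 1 then replicate (max (bitlen v)
         (case snd (mem ! 0) of None \<Rightarrow> 0 | Some m \<Rightarrow> length m)) True
       else (let L = length (fst (mem ! 1)); i = t div 2 - 1; st = node_state prog init v mem i;
                 s = prog L ! i in
         if even t then enc (width L) (bcast s st)
         else enc (width L) (share s st (opt_vec (snd (mem ! (t - 1))))))),
     consensus_op = (\<lambda>t. if t < 2 then longer else vec_op),
     edge_msg = (\<lambda>inp mem (a, b). let t = length mem in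
       if t = 0 then (replicate (bitlen (input_weight inp)) True, replicate (bitlen (input_weight inp)) True)
       else if odd t then ([], [])
       else (let L = width_inv a; s = prog L ! (t div 2 - 1) in
         (enc (width L) (reply s (input_weight inp) (direction inp (lower_id inp)) (dec a) (dec b)),
          enc (width L) (reply s (input_weight inp) (direction inp (upper_id inp)) (dec b) (dec a))))),
     aggregation_op = (\<lambda>t. if t < 2 then longer else vec_op),
     result = (\<lambda>v mem. if length mem < 2 then None
       else (let L = length (fst (mem ! 1)); i = length (prog L) in
         if length mem < 2 + 2 * i then None else Some (outp (node_state prog init v mem i)))) \<rparr>"

lemma compile_ops:
  "consensus_op (compile prog init outp) t = (if t < 2 then longer else vec_op)"
  "aggregation_op (compile prog init outp) t = (if t < 2 then longer else vec_op)"
  by (simp_all add: compile_def)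

definition sent :: "nat \<Rightarrow> 's step \<Rightarrow> (node \<Rightarrow> 's) \<Rightarrow> node \<Rightarrow> vec" where
  "sent L s st v = trunc (width L) (bcast s (st v))"

definition nbr_agg :: "network \<Rightarrow> nat \<Rightarrow> 's step \<Rightarrow> (node \<Rightarrow> 's) \<Rightarrow> node \<Rightarrow> vec" where
  "nbr_agg N L s st v = vagg (width L)
     (\<lambda>u. reply s (weight N {v, u}) (direction (edge_input_of N {v, u}) v) (sent L s st v) (sent L s st u))
     {u. {v, u} \<in> edges N}"

definition joined :: "network \<Rightarrow> nat \<Rightarrow> 's step \<Rightarrow> (node \<Rightarrow> 's) \<Rightarrow> edge set" where
  "joined N L s st = {{p, c} | p c. child_of (tree N) (tree_root N) p c \<and>
     join s (sent L s st p) (sent L s st c)}"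

definition exec :: "network \<Rightarrow> nat \<Rightarrow> 's step \<Rightarrow> (node \<Rightarrow> 's) \<Rightarrow> node \<Rightarrow> 's" where
  "exec N L s st v = update s (st v) (nbr_agg N L s st v)
     (vagg (width L) (\<lambda>u. share s (st u) (nbr_agg N L s st u)) (supernode (joined N L s st) v))"

definition run :: "network \<Rightarrow> nat \<Rightarrow> 's step list \<Rightarrow> (node \<Rightarrow> 's) \<Rightarrow> node \<Rightarrow> 's" where
  "run N L ss st = foldl (\<lambda>st s. exec N L s st) st ss"

lemma run_Nil [simp]: "run N L [] st = st"
  and run_Cons [simp]: "run N L (s # ss) st = run N L ss (exec N L s st)"
  and run_append: "run N L (ss @ ss') st = run N L ss' (run N L ss st)"
  by (simp_all add: run_def)

definition oriented :: "network \<Rightarrow> bool" where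
  "oriented N \<longleftrightarrow> tree N \<subseteq> edges N \<and>
     (\<forall>e\<in>tree N. \<exists>p c. e = {p, c} \<and> child_of (tree N) (tree_root N) p c)"

lemma input_parent_edge_input_of:
  assumes "child_of (tree N) (tree_root N) p c"
  shows "input_parent (edge_input_of N {p, c}) = Some p"
proof -
  have "(THE u. \<exists>v. {p, c} = {u, v} \<and> child_of (tree N) (tree_root N) u v) = p"
    using assms by (intro the_equality) (auto simp: child_of_def doubleton_eq_iff)
  then show ?thesis using assms by (simp add: edge_input_of_def child_of_def)
qed

lemma supernode_empty [simp]: "supernode {} v = {v}"
  by (auto simp: supernode_def adj_def elim: rtranclE)

section \<open>An arbitrary execution of a compiled program, for any order of its
  aggregations\<close>

locale compiled_run =
  fixes N :: network and prog :: "nat \<Rightarrow> 's step list" and init :: "node \<Rightarrow> 's" and outp :: "'s \<Rightarrow> nat"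
    and mv me y a
  assumes ugraph: "ugraph (nodes N) (edges N)"
    and connected: "connected_graph (nodes N) (edges N)"
    and oriented: "oriented N"
    and execution: "execution (compile prog init outp) N mv me y a"
begin

abbreviation "A \<equiv> compile prog init outp"

definition "C t = contracted A N (me t)"

lemma edge_cases:
  assumes "e \<in> edges N"
  obtains u v where "e = {u, v}" "u < v" "Min e = u" "Max e = v" "u \<in> nodes N" "v \<in> nodes N"
proof -
  from assms ugraph have "card e = 2" "e \<subseteq> nodes N" by (auto simp: ugraph_def)
  then obtain a b where ab: "e = {a, b}" "a \<noteq> b" by (meson card_2_iff)
  show thesis
  proof (cases "a < b")
    case True
    then show thesis using that[of a b] ab \<open>e \<subseteq> nodes N\<close> by auto
  next
    case False
    then show thesis using that[of b a] ab \<open>e \<subseteq> nodes N\<close> by (auto simp: insert_commute)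
  qed
qed

lemma finite_nodes: "finite (nodes N)"
  using ugraph by (simp add: ugraph_def)

lemma finite_edges: "finite (edges N)"
proof -
  have "edges N \<subseteq> Pow (nodes N)" using ugraph by (auto simp: ugraph_def)
  then show ?thesis using finite_nodes by (meson finite_Pow_iff finite_subset)
qed

lemma nodes_memory:
  "v \<in> nodes N \<Longrightarrow> mv t v = map (\<lambda>k. (y k (supernode (C k) v), a k (supernode (C k) v))) [0..<t]"
proof (induction t)
  case 0
  then show ?case using execution by (simp add: execution_def)
next
  case (Suc t)
  have "ma_round A N t (mv t) (me t) (y t) (a t) (mv (Suc t)) (me (Suc t))"
    using execution by (simp add: execution_def)
  with Suc show ?case by (simp add: ma_round_def Let_def C_def)
qed

lemma edges_memory:
  "e \<in> edges N \<Longrightarrow> me t e = map (\<lambda>k. if e \<in> minor_edges N (C k)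
     then Some (y k (supernode (C k) (Min e)), y k (supernode (C k) (Max e))) else None) [0..<t]"
proof (induction t)
  case 0
  then show ?case using execution by (simp add: execution_def)
next
  case (Suc t)
  have "ma_round A N t (mv t) (me t) (y t) (a t) (mv (Suc t)) (me (Suc t))"
    using execution by (simp add: execution_def)
  with Suc show ?case by (simp add: ma_round_def Let_def C_def)
qed

lemma length_memory [simp]:
  "v \<in> nodes N \<Longrightarrow> length (mv t v) = t" "e \<in> edges N \<Longrightarrow> length (me t e) = t"
  by (simp_all add: nodes_memory edges_memory)

lemma memory_Nil [simp]:
  "v \<in> nodes N \<Longrightarrow> mv t v = [] \<longleftrightarrow> t = 0" "e \<in> edges N \<Longrightarrow> me t e = [] \<longleftrightarrow> t = 0"
  by (simp_all add: nodes_memory edges_memory)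

lemma memory_nth:
  "v \<in> nodes N \<Longrightarrow> k < t \<Longrightarrow> mv t v ! k = (y k (supernode (C k) v), a k (supernode (C k) v))"
  by (simp add: nodes_memory)

lemma supernode_subset:
  assumes "v \<in> nodes N" "D \<subseteq> edges N"
  shows "supernode D v \<subseteq> nodes N"
proof
  fix u assume "u \<in> supernode D v"
  then have "(v, u) \<in> (adj D)\<^sup>*" by (simp add: supernode_def)
  then show "u \<in> nodes N"
  proof (induction rule: rtrancl_induct)
    case (step u w)
    then have "{u, w} \<in> edges N" using assms(2) by (auto simp: adj_def)
    then show ?case using ugraph unfolding ugraph_def by blast
  qed (rule assms(1))
qed

lemma C_subset: "C t \<subseteq> edges N"
  by (auto simp: C_def contracted_def)

lemma consensus:
  assumes "v \<in> nodes N"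
  shows "aggregates (consensus_op A t)
    {#node_msg A u (mv t u). u \<in># mset_set (supernode (C t) v)#} (y t (supernode (C t) v))"
proof -
  have "ma_round A N t (mv t) (me t) (y t) (a t) (mv (Suc t)) (me (Suc t))"
    using execution by (simp add: execution_def)
  with assms show ?thesis by (simp add: ma_round_def Let_def C_def)
qed

lemma aggregation:
  assumes "v \<in> nodes N"
  shows "incident_edges N (C t) (supernode (C t) v) = {} \<Longrightarrow> a t (supernode (C t) v) = None"
    "incident_edges N (C t) (supernode (C t) v) \<noteq> {} \<Longrightarrow> \<exists>m. a t (supernode (C t) v) = Some m \<and>
      aggregates (aggregation_op A t)
        {#msg_to A N (C t) (me t) (y t) (supernode (C t) v) e.
          e \<in># mset_set (incident_edges N (C t) (supernode (C t) v))#} m"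
proof -
  have "ma_round A N t (mv t) (me t) (y t) (a t) (mv (Suc t)) (me (Suc t))"
    using execution by (simp add: execution_def)
  with assms show "incident_edges N (C t) (supernode (C t) v) = {} \<Longrightarrow> a t (supernode (C t) v) = None"
    "incident_edges N (C t) (supernode (C t) v) \<noteq> {} \<Longrightarrow> \<exists>m. a t (supernode (C t) v) = Some m \<and>
      aggregates (aggregation_op A t)
        {#msg_to A N (C t) (me t) (y t) (supernode (C t) v) e.
          e \<in># mset_set (incident_edges N (C t) (supernode (C t) v))#} m"
    by (simp_all add: ma_round_def Let_def C_def)
qed

lemma C_even: "even t \<Longrightarrow> C t = {}"
  by (auto simp: C_def contracted_def compile_def Let_def)

lemma C_1: "C (Suc 0) = edges N"
  by (auto simp: C_def contracted_def compile_def Let_def)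

lemma supernode_C_1: "v \<in> nodes N \<Longrightarrow> supernode (C (Suc 0)) v = nodes N"
  using supernode_subset[OF _ C_subset, of v "Suc 0"] connected
  by (auto simp: C_1 connected_graph_def supernode_def)

lemma minor_edges_empty: "minor_edges N {} = edges N"
  by (auto simp: minor_edges_def elim: edge_cases)

lemma incident_edges_empty: "incident_edges N {} {v} = {e \<in> edges N. v \<in> e}"
  by (auto simp: incident_edges_def minor_edges_empty elim: edge_cases)

section \<open>The calibration rounds and the common bit length\<close>

definition "L = length (y (Suc 0) (nodes N))"

lemma phase_0:
  assumes v: "v \<in> nodes N"
  shows "(\<forall>e\<in>edges N. v \<in> e \<longrightarrow> (\<exists>m. a 0 {v} = Some m \<and> bitlen (weight N e) \<le> length m)) \<and>
    (\<forall>m. a 0 {v} = Some m \<longrightarrow> (\<exists>e\<in>edges N. length m = bitlen (weight N e)))"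
proof -
  let ?I = "{e \<in> edges N. v \<in> e}"
  have fin: "finite ?I" using finite_edges by simp
  have M: "length (msg_to A N {} (me 0) (y 0) {v} e) = bitlen (weight N e)" if "e \<in> ?I" for e
  proof -
    have "me 0 e = []" using that by (simp add: edges_memory)
    then show ?thesis by (simp add: msg_to_def edge_msgs_def compile_def edge_input_of_def)
  qed
  have *: "if ?I = {} then a 0 {v} = None
    else \<exists>m. a 0 {v} = Some m \<and> aggregates longer {#msg_to A N {} (me 0) (y 0) {v} e. e \<in># mset_set ?I#} m"
    using aggregation[OF v, of 0] C_even[of 0] by (simp add: incident_edges_empty compile_ops)
  show ?thesis
  proof (cases "?I = {}")
    case True
    then show ?thesis using * by auto
  next
    case False
    then obtain m where m: "a 0 {v} = Some m"
      "aggregates longer {#msg_to A N {} (me 0) (y 0) {v} e. e \<in># mset_set ?I#} m"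
      using * unfolding if_not_P[OF False] by blast
    have "length m = Max ((\<lambda>e. bitlen (weight N e)) ` ?I)"
      using aggregates_longer[OF m(2)] fin M by (simp add: image_image cong: image_cong_simp)
    moreover have "Max ((\<lambda>e. bitlen (weight N e)) ` ?I) \<in> (\<lambda>e. bitlen (weight N e)) ` ?I"
      using False fin by (intro Max_in) auto
    moreover have "bitlen (weight N e) \<le> Max ((\<lambda>e. bitlen (weight N e)) ` ?I)" if "e \<in> ?I" for e
      using that fin by (intro Max_ge) auto
    ultimately show ?thesis using m(1) by auto
  qed
qed

lemma phase_1:
  shows "\<forall>v\<in>nodes N. length (node_msg A v (mv (Suc 0) v)) \<le> L"
    and "\<exists>v\<in>nodes N. length (node_msg A v (mv (Suc 0) v)) = L"
proof -
  obtain v where v: "v \<in> nodes N" using ugraph by (auto simp: ugraph_def)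
  have "aggregates longer {#node_msg A u (mv (Suc 0) u). u \<in># mset_set (nodes N)#} (y (Suc 0) (nodes N))"
    using consensus[OF v, of "Suc 0"] by (simp add: supernode_C_1[OF v] compile_ops)
  from aggregates_longer[OF this]
  have L: "L = Max ((\<lambda>v. length (node_msg A v (mv (Suc 0) v))) ` nodes N)"
    using finite_nodes by (simp add: L_def image_image)
  show "\<forall>v\<in>nodes N. length (node_msg A v (mv (Suc 0) v)) \<le> L"
    unfolding L using finite_nodes by auto
  have "L \<in> (\<lambda>v. length (node_msg A v (mv (Suc 0) v))) ` nodes N"
    unfolding L using v finite_nodes by (intro Max_in) auto
  then show "\<exists>v\<in>nodes N. length (node_msg A v (mv (Suc 0) v)) = L" by auto
qed

lemma length_node_msg_1:
  "v \<in> nodes N \<Longrightarrow> length (node_msg A v (mv (Suc 0) v)) =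
    max (bitlen v) (case a 0 {v} of None \<Rightarrow> 0 | Some m \<Rightarrow> length m)"
  by (simp add: compile_def nodes_memory C_even)

lemma node_less: assumes "v \<in> nodes N" shows "v < 2 ^ L"
proof -
  have "bitlen v \<le> L" using phase_1(1) assms by (auto simp: length_node_msg_1)
  then show ?thesis using less_two_power_bitlen[of v] by (meson less_le_trans one_le_numeral power_increasing)
qed

lemma weight_less: assumes "e \<in> edges N" shows "weight N e < 2 ^ L"
proof -
  obtain v where "v \<in> e" "v \<in> nodes N" using assms by (auto elim: edge_cases)
  then obtain m where "a 0 {v} = Some m" "bitlen (weight N e) \<le> length m"
    using phase_0 assms by blast
  then have "bitlen (weight N e) \<le> L" using phase_1(1) \<open>v \<in> nodes N\<close> by (auto simp: length_node_msg_1)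
  then show ?thesis
    using less_two_power_bitlen[of "weight N e"] by (meson less_le_trans one_le_numeral power_increasing)
qed

text \<open>\<open>L\<close> is attained by some identifier or weight. Correctness rests on
  \<open>L\<close> being large enough (\<open>node_less\<close>, \<open>weight_less\<close>), the
  bounds on rounds and message size on this converse.\<close>

lemma L_le:
  assumes "\<forall>v\<in>nodes N. v < 2 ^ K" "\<forall>e\<in>edges N. weight N e < 2 ^ K"
  shows "L \<le> K"
proof -
  obtain v where v: "v \<in> nodes N" "length (node_msg A v (mv (Suc 0) v)) = L" using phase_1(2) by auto
  have "bitlen v \<le> K" "\<forall>e\<in>edges N. bitlen (weight N e) \<le> K" using v assms by (auto intro: bitlen_le)
  then show ?thesis
    using v phase_0[OF v(1)]
    by (auto simp: length_node_msg_1 max_def split: option.splits if_splits)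
qed

lemma length_fst_memory: "v \<in> nodes N \<Longrightarrow> t \<ge> 2 \<Longrightarrow> length (fst (mv t v ! 1)) = L"
  by (simp add: nodes_memory supernode_C_1 L_def)

text \<open>Indexing with \<open>!\<close> instead of using \<open>run\<close> keeps the state
  defined past the end of the program. The model constrains messages in all rounds, also in those
  after the output.\<close>

definition "st i = foldl (\<lambda>st s. exec N L s st) init (map ((!) (prog L)) [0..<i])"

lemma st_Suc: "st (Suc i) = exec N L (prog L ! i) (st i)"
  by (simp add: st_def)

lemma width_inv_enc [simp]: "width_inv (enc (width K) x) = K"
  by (simp add: width_inv_def width_def)

context
  fixes i
  assumes IH: "\<And>v t. v \<in> nodes N \<Longrightarrow> t \<ge> 2 + 2 * i \<Longrightarrow> node_state prog init v (mv t v) i = st i v"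
begin

abbreviation "s \<equiv> prog L ! i"
abbreviation "t0 \<equiv> 2 + 2 * i"

text \<open>Nothing is contracted, so a supernode is a single node and its aggregate can only stem
  from the rule \<open>single\<close>: a combination would split one message into two nonempty
  parts.\<close>

lemma consensus_even:
  assumes v: "v \<in> nodes N"
  shows "y t0 {v} = enc (width L) (bcast s (st i v))"
proof -
  have "aggregates vec_op {#enc (width L) (bcast s (st i v))#} (y t0 {v})"
    using consensus[OF v, of t0] v length_fst_memory[OF v, of t0] IH[OF v, of t0]
    by (simp add: C_even compile_def Let_def)
  then show ?thesis
  proof (cases rule: aggregates.cases)
    case (combine M x M' y)
    have ne: "M \<noteq> {#}" if "aggregates f M x" for f M x
      using that by induction auto
    have "size M + size M' = 1" using combine(1) by (metis size_single size_union)
    then show ?thesis using ne[OF combine(3)] ne[OF combine(4)] by (cases "size M") auto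
  qed auto
qed

lemma edge_msgs_even:
  assumes "e \<in> edges N"
  shows "edge_msgs A N {} (me t0) (y t0) e =
     (enc (width L) (reply s (weight N e) (direction (edge_input_of N e) (Min e))
        (sent L s (st i) (Min e)) (sent L s (st i) (Max e))),
      enc (width L) (reply s (weight N e) (direction (edge_input_of N e) (Max e))
        (sent L s (st i) (Max e)) (sent L s (st i) (Min e))))"
proof -
  from assms have "Min e \<in> nodes N" "Max e \<in> nodes N" by (auto elim: edge_cases)
  then show ?thesis using assms
    by (simp add: edge_msgs_def consensus_even[simplified] compile_def Let_def dec_enc sent_def edge_input_of_def)
qed

lemma aggregation_even:
  assumes v: "v \<in> nodes N"
  shows "opt_vec (a t0 {v}) = nbr_agg N L s (st i) v"
proof -
  let ?I = "{e \<in> edges N. v \<in> e}"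
  let ?U = "{u. {v, u} \<in> edges N}"
  let ?f = "\<lambda>u. reply s (weight N {v, u}) (direction (edge_input_of N {v, u}) v)
    (sent L s (st i) v) (sent L s (st i) u)"
  \<comment> \<open>Messages are indexed by edges, \<open>nbr_agg\<close> by neighbours. Selecting
    the other endpoint translates between the two, and \<open>vagg_reindex\<close> then removes the
    choice.\<close>
  let ?g = "\<lambda>e. ?f (THE u. e = {v, u})"
  have fin: "finite ?I" using finite_edges by simp
  have the: "(THE u. {v, w} = {v, u}) = w" for w
    by (rule the_equality) (auto simp: doubleton_eq_iff)
  have I: "?I = (\<lambda>u. {v, u}) ` ?U"
  proof (intro equalityI subsetI)
    fix e assume e: "e \<in> ?I"
    then obtain u w where "e = {u, w}" by (auto elim: edge_cases)
    with e have "e = {v, u} \<or> e = {v, w}" by auto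
    with e show "e \<in> (\<lambda>u. {v, u}) ` ?U" by auto
  qed auto
  have inj: "inj_on (\<lambda>u. {v, u}) ?U" by (auto simp: inj_on_def doubleton_eq_iff)
  have msg: "msg_to A N {} (me t0) (y t0) {v} e = enc (width L) (?g e)" if e: "e \<in> ?I" for e
  proof -
    from e have "e \<in> edges N" "v \<in> e" by auto
    then obtain u w where uw: "e = {u, w}" "u < w" "Min e = u" "Max e = w" by (auto elim: edge_cases)
    have "u = v \<or> w = v" using uw \<open>v \<in> e\<close> by auto
    then show ?thesis
    proof
      assume "u = v"
      then show ?thesis using uw edge_msgs_even[OF \<open>e \<in> edges N\<close>] by (auto simp: msg_to_def the)
    next
      assume w: "w = v"
      then have ee: "e = {v, u}" using uw by auto
      show ?thesis unfolding msg_to_def edge_msgs_even[OF \<open>e \<in> edges N\<close>] using uw(2-4) w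
        by (simp add: ee the)
    qed
  qed
  have *: "if ?I = {} then a t0 {v} = None
    else \<exists>m. a t0 {v} = Some m \<and> aggregates vec_op {#msg_to A N {} (me t0) (y t0) {v} e. e \<in># mset_set ?I#} m"
    using aggregation[OF v, of t0] C_even[of t0] by (simp add: incident_edges_empty compile_ops)
  have **: "{#msg_to A N {} (me t0) (y t0) {v} e. e \<in># mset_set ?I#} = {#enc (width L) (?g e). e \<in># mset_set ?I#}"
    using msg fin by (intro image_mset_cong) auto
  have "opt_vec (a t0 {v}) = vagg (width L) ?g ?I"
  proof (cases "?I = {}")
    case True
    then have "a t0 {v} = None" using * by simp
    then show ?thesis unfolding True by (auto simp: opt_vec_def vagg_def fun_eq_iff)
  next
    case False
    then obtain m where m: "a t0 {v} = Some m"
      "aggregates vec_op {#enc (width L) (?g e). e \<in># mset_set ?I#} m"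
      using * unfolding ** if_not_P[OF False] by blast
    show ?thesis using aggregates_enc(1)[OF m(2) fin] m(1) by (simp add: opt_vec_def)
  qed
  also have "\<dots> = nbr_agg N L s (st i) v"
    unfolding I vagg_reindex[OF inj] nbr_agg_def by (simp add: the)
  finally show ?thesis .
qed

text \<open>In the round before, nothing was contracted, so every edge has just learned the
  broadcasts of both endpoints and can evaluate \<open>join\<close> on them, in the order parent,
  child.\<close>

lemma C_odd: "C (Suc t0) = joined N L s (st i)"
proof -
  have me: "last (me (Suc t0) e) = Some (y t0 {Min e}, y t0 {Max e})" if "e \<in> edges N" for e
    using that by (simp add: edges_memory C_even minor_edges_empty)
  have yy: "y t0 {v} = enc (width L) (bcast s (st i v))" if "v \<in> nodes N" for v
    using consensus_even[OF that] .
  have "e \<in> C (Suc t0) \<longleftrightarrow> e \<in> joined N L s (st i)" for e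
  proof (cases "e \<in> tree N")
    case False
    then show ?thesis
      by (auto simp: C_def contracted_def compile_def Let_def edge_input_of_def joined_def child_of_def
          split: option.splits prod.splits)
  next
    case True
    then obtain p c where pc: "e = {p, c}" "child_of (tree N) (tree_root N) p c" "e \<in> edges N"
      using oriented unfolding oriented_def by blast
    have ip: "input_parent (edge_input_of N e) = Some p"
      using input_parent_edge_input_of pc by simp
    have J: "e \<in> joined N L s (st i) \<longleftrightarrow> join s (sent L s (st i) p) (sent L s (st i) c)"
      using pc(1,2) by (auto simp: joined_def child_of_def doubleton_eq_iff)
    obtain u w where uw: "e = {u, w}" "u < w" "Min e = u" "Max e = w" "u \<in> nodes N" "w \<in> nodes N"
      using \<open>e \<in> edges N\<close> by (auto elim: edge_cases)
    have low: "lower_id (edge_input_of N e) = u" using uw by (simp add: edge_input_of_def)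
    have "u = p \<and> w = c \<or> u = c \<and> w = p" using uw(1) pc(1) by (auto simp: doubleton_eq_iff)
    then show ?thesis unfolding J
      using uw ip low me[OF pc(3)] yy[OF uw(5)] yy[OF uw(6)] \<open>e \<in> edges N\<close>
      by (auto simp: C_def contracted_def compile_def Let_def dec_enc sent_def)
  qed
  then show ?thesis by auto
qed

lemma node_state_Suc:
  assumes v: "v \<in> nodes N" and t: "t \<ge> 2 + 2 * Suc i"
  shows "node_state prog init v (mv t v) (Suc i) = st (Suc i) v"
proof -
  let ?S = "supernode (joined N L s (st i)) v"
  have sub: "?S \<subseteq> nodes N" using supernode_subset[OF v] C_subset C_odd by metis
  have "aggregates vec_op {#node_msg A u (mv (Suc t0) u). u \<in># mset_set ?S#} (y (Suc t0) ?S)"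
    using consensus[OF v, of "Suc t0"] unfolding C_odd by (simp add: compile_ops)
  moreover have "{#node_msg A u (mv (Suc t0) u). u \<in># mset_set ?S#} =
     {#enc (width L) (share s (st i u) (nbr_agg N L s (st i) u)). u \<in># mset_set ?S#}"
  proof (rule image_mset_cong)
    fix u assume "u \<in># mset_set ?S"
    then have "u \<in> nodes N" using sub by (metis elem_mset_set infinite_set_mset_mset_set subset_iff empty_iff)
    then show "node_msg A u (mv (Suc t0) u) = enc (width L) (share s (st i u) (nbr_agg N L s (st i) u))"
      using length_fst_memory[of u "Suc t0"] IH[of u "Suc t0"] aggregation_even[of u]
      by (simp add: compile_def Let_def memory_nth C_even)
  qed
  ultimately have "aggregates vec_op
     {#enc (width L) (share s (st i u) (nbr_agg N L s (st i) u)). u \<in># mset_set ?S#} (y (Suc t0) ?S)" by simp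
  from aggregates_enc(1)[OF this finite_subset[OF sub finite_nodes]]
  have S: "dec (y (Suc t0) ?S) =
    vagg (width L) (\<lambda>u. share s (st i u) (nbr_agg N L s (st i) u)) ?S" .
  have "mv t v ! t0 = (y t0 {v}, a t0 {v})"
    using t v by (simp add: nodes_memory C_even)
  moreover have "mv t v ! Suc t0 = (y (Suc t0) ?S, a (Suc t0) ?S)"
    using t v C_odd by (simp add: nodes_memory)
  moreover have "3 + 2 * i = Suc t0" by simp
  moreover have "node_state prog init v (mv t v) i = st i v" using IH[OF v, of t] t by simp
  moreover have "length (fst (mv t v ! 1)) = L" using length_fst_memory[OF v, of t] t by simp
  ultimately show ?thesis
    by (simp only: node_state.simps st_Suc exec_def fst_conv snd_conv aggregation_even[OF v] S)
qed

end

lemma node_state_eq: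
  "v \<in> nodes N \<Longrightarrow> t \<ge> 2 + 2 * i \<Longrightarrow> node_state prog init v (mv t v) i = st i v"
proof (induction i arbitrary: v t)
  case 0
  then show ?case by (simp add: st_def)
next
  case (Suc i)
  show ?case by (rule node_state_Suc[OF Suc.IH Suc.prems])
qed

lemma result_eq:
  assumes "v \<in> nodes N"
  shows "result A v (mv t v) = (if t < 2 + 2 * length (prog L) then None
    else Some (outp (run N L (prog L) init v)))"
proof -
  have "st (length (prog L)) = run N L (prog L) init" by (simp add: st_def run_def map_nth)
  then show ?thesis using assms length_fst_memory[OF assms, of t] node_state_eq[OF assms]
    by (simp add: compile_def Let_def)
qed

text \<open>Encoding fixes the length of every message, whatever the step does. This also covers the
  rounds after the end of the program, in which \<open>prog L ! i\<close> is an unspecified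
  step.\<close>

lemma respects: "respects_msg_size A N (128 * (L + 1)) mv me y"
proof -
  have t_cases: "t = 0 \<or> t = 1 \<or> (\<exists>i. t = 2 + 2 * i) \<or> (\<exists>i. t = 3 + 2 * i)" for t :: nat
  proof -
    have "\<exists>i. t = 2 + 2 * i" if "even t" "t \<noteq> 0" using that by presburger
    moreover have "\<exists>i. t = 3 + 2 * i" if "odd t" "t \<noteq> 1" using that by presburger
    ultimately show ?thesis by blast
  qed
  have nm: "length (node_msg A v (mv t v)) \<le> 128 * (L + 1)" if v: "v \<in> nodes N" for v t
  proof -
    consider "t = 0" | "t = 1" | "t \<ge> 2" by linarith
    then show ?thesis
    proof cases
      case 1
      then show ?thesis using v by (simp add: compile_def)
    next
      case 2
      then show ?thesis using phase_1(1) v by force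
    next
      case 3
      then show ?thesis using v length_fst_memory[OF v, of t] by (auto simp: compile_def Let_def width_def)
    qed
  qed
  have em: "length (fst (edge_msgs A N (C t) (me t) (y t) e)) \<le> 128 * (L + 1) \<and>
      length (snd (edge_msgs A N (C t) (me t) (y t) e)) \<le> 128 * (L + 1)" if e: "e \<in> edges N" for e t
    using t_cases[of t]
  proof (elim disjE exE)
    assume "t = 0"
    moreover have "bitlen (weight N e) \<le> L" using weight_less[OF e] by (rule bitlen_le)
    ultimately show ?thesis using e by (simp add: edge_msgs_def compile_def edge_input_of_def)
  next
    assume "t = 1"
    then show ?thesis using e by (simp add: edge_msgs_def compile_def)
  next
    fix i assume "t = 2 + 2 * i"
    then show ?thesis using edge_msgs_even[OF node_state_eq e] by (simp add: C_even width_def)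
  next
    fix i assume "t = 3 + 2 * i"
    then show ?thesis using e by (simp add: edge_msgs_def compile_def)
  qed
  show ?thesis
    unfolding respects_msg_size_def Let_def C_def[symmetric]
    using nm em by (auto simp: minor_edges_def)
qed

end

lemma aggregation_operator_compile:
  "aggregation_operator B (consensus_op (compile prog init outp) t)"
  "aggregation_operator B (aggregation_op (compile prog init outp) t)"
  by (simp_all add: compile_ops aggregation_operator_vec_op aggregation_operator_longer)

text \<open>\<open>K\<close> exists only in the analysis; the execution finds its own
  \<open>L\<close>. Hence correctness is required for each \<open>L \<le> K\<close> that
  accommodates all identifiers and weights, and the round bound for each
  \<open>L \<le> K\<close>.\<close>

lemma computes_compile:
  assumes G: "ugraph (nodes N) (edges N)" "connected_graph (nodes N) (edges N)" "oriented N"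
    and K: "\<forall>v\<in>nodes N. v < 2 ^ K" "\<forall>e\<in>edges N. weight N e < 2 ^ K"
    and correct: "\<And>L v. L \<le> K \<Longrightarrow> \<forall>v\<in>nodes N. v < 2 ^ L \<Longrightarrow> \<forall>e\<in>edges N. weight N e < 2 ^ L \<Longrightarrow>
      v \<in> nodes N \<Longrightarrow> outp (run N L (prog L) init v) = val"
    and B: "128 * (K + 1) \<le> B"
    and R: "\<And>L. L \<le> K \<Longrightarrow> 2 + 2 * length (prog L) \<le> R"
  shows "computes (compile prog init outp) N B R val"
  unfolding computes_def
proof (intro conjI allI impI)
  fix mv me y a
  assume "execution (compile prog init outp) N mv me y a"
  then interpret compiled_run N prog init outp mv me y a
    using G by unfold_locales
  have LK: "L \<le> K" using K by (rule L_le)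
  have "respects_msg_size A N (128 * (L + 1)) mv me y" by (rule respects)
  moreover have "128 * (L + 1) \<le> B" using LK B by simp
  ultimately show "respects_msg_size A N B mv me y"
    unfolding respects_msg_size_def Let_def by (meson le_trans)
  show "\<forall>v\<in>nodes N. (\<forall>t. result A v (mv t v) \<in> {None, Some val}) \<and>
                     (\<forall>t\<ge>R. result A v (mv t v) = Some val)"
    using correct[OF LK] node_less weight_less R[OF LK] by (auto simp: result_eq)
qed (rule aggregation_operator_compile)+

section \<open>Simple paths in trees\<close>

lemma simple_path_exists:
  assumes "(u, v) \<in> (adj T)\<^sup>*"
  shows "\<exists>p. simple_path T p \<and> hd p = u \<and> last p = v"
  using assms
proof (induction rule: rtrancl_induct)
  case base
  then show ?case by (intro exI[of _ "[u]"]) (simp add: simple_path_def)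
next
  case (step y z)
  then obtain p where p: "p \<noteq> []" "distinct p" "successively (\<lambda>u v. {u, v} \<in> T) p" "hd p = u" "last p = y"
    by (auto simp: simple_path_def)
  have yz: "{y, z} \<in> T" using step.hyps(2) by (simp add: adj_def)
  show ?case
  proof (cases "z \<in> set p")
    case True
    then obtain p1 p2 where "p = p1 @ z # p2" by (meson split_list)
    with p have "simple_path T (p1 @ [z])" "hd (p1 @ [z]) = u"
      by (auto simp: simple_path_def successively_append_iff hd_append)
    then show ?thesis by (intro exI[of _ "p1 @ [z]"]) auto
  next
    case False
    with p yz have "simple_path T (p @ [z])" "hd (p @ [z]) = u"
      by (auto simp: simple_path_def successively_append_iff hd_append)
    then show ?thesis by (intro exI[of _ "p @ [z]"]) auto
  qed
qed

text \<open>Two simple paths that diverge right after a common first node close a cycle at the first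
  node of one that lies on the other.\<close>

lemma simple_path_unique:
  assumes "acyclic_graph T" "simple_path T p" "simple_path T q" "hd p = hd q" "last p = last q"
  shows "p = q"
  using assms(2-)
proof (induction p arbitrary: q)
  case Nil
  then show ?case by (simp add: simple_path_def)
next
  case (Cons u p)
  from Cons.prems obtain q' where q: "q = u # q'" by (cases q) (auto simp: simple_path_def)
  show ?case
  proof (cases "p = [] \<or> q' = []")
    case True
    show ?thesis
    proof (cases "p = []")
      case True
      then have "last q = u" using Cons.prems by simp
      moreover have "u \<notin> set q'" using Cons.prems q by (simp add: simple_path_def)
      ultimately have "q' = []" using q last_in_set[of q'] by (auto split: if_splits)
      then show ?thesis using True q by simp
    next
      case False
      with True have "q' = []" by simp
      then have "last p = u" using Cons.prems q False by simp
      then show ?thesis using Cons.prems False last_in_set[of p] by (auto simp: simple_path_def)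
    qed
  next
    case False
    then have ne: "p \<noteq> []" "q' \<noteq> []" by auto
    have P: "distinct p" "u \<notin> set p" "successively (\<lambda>u v. {u, v} \<in> T) p" "{u, hd p} \<in> T"
      using Cons.prems(1) ne by (auto simp: simple_path_def successively_Cons)
    have Q: "distinct q'" "u \<notin> set q'" "successively (\<lambda>u v. {u, v} \<in> T) q'" "{u, hd q'} \<in> T"
      using Cons.prems(2) ne q by (auto simp: simple_path_def successively_Cons)
    have lst: "last p = last q'" using Cons.prems(4) q ne by simp
    show ?thesis
    proof (cases "hd p = hd q'")
      case True
      have "p = q'"
        by (rule Cons.IH) (use P Q ne lst True in \<open>auto simp: simple_path_def\<close>)
      then show ?thesis using q by simp
    next
      case False
      have "\<exists>x\<in>set p. x \<in> set q'" using lst ne by (metis last_in_set)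
      then obtain p1 x p2 where p: "p = p1 @ x # p2" "x \<in> set q'" "\<forall>y\<in>set p1. y \<notin> set q'"
        using split_list_first_prop[of p "\<lambda>x. x \<in> set q'"] by auto
      from p(2) obtain q1 q2 where q': "q' = q1 @ x # q2" by (meson split_list)
      let ?c = "u # p1 @ x # rev q1"
      have sym: "(\<lambda>a b. {a, b} \<in> T) = (\<lambda>a b. {b, a} \<in> T)" by (simp add: insert_commute)
      have r: "successively (\<lambda>a b. {a, b} \<in> T) (rev (q1 @ [x]))"
        unfolding successively_rev using Q(3) q' by (simp add: insert_commute successively_append_iff)
      have l: "successively (\<lambda>a b. {a, b} \<in> T) (u # p1 @ [x])"
        using P(3,4) p(1) by (auto simp: successively_append_iff successively_Cons hd_append)
      have "successively (\<lambda>a b. {a, b} \<in> T) ?c"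
        using l r by (auto simp: successively_append_iff successively_Cons hd_append split: if_splits)
      moreover have "distinct ?c" using P(1,2) Q(1,2) p q' by auto
      ultimately have "simple_path T ?c" by (simp add: simple_path_def)
      moreover have "last ?c = hd q'" using q' by (cases q1) (auto simp: last_rev)
      \<comment> \<open>A shorter list would need \<open>p1\<close> and \<open>q1\<close> both
        empty, and then both paths would continue with \<open>x\<close>.\<close>
      moreover have "length ?c \<ge> 3"
        using False p(1) q' by (cases p1; cases q1) auto
      ultimately have False
        using assms(1) Q(4) unfolding acyclic_graph_def by (metis insert_commute list.sel(1))
      then show ?thesis ..
    qed
  qed
qed

lemma path_edges_Cons: "path_edges (x # y # p) = insert {x, y} (path_edges (y # p))"
proof -
  have "{i. Suc i < length (x # y # p)} = insert 0 (Suc ` {i. Suc i < length (y # p)})"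
    by (auto simp: image_iff) (metis not0_implies_Suc Suc_less_eq)
  moreover have "path_edges q = (\<lambda>i. {q ! i, q ! Suc i}) ` {i. Suc i < length q}" for q
    by (auto simp: path_edges_def)
  ultimately show ?thesis by (simp add: image_image)
qed

lemma path_edges_subset: "e \<in> path_edges p \<Longrightarrow> e \<subseteq> set p"
  by (auto simp: path_edges_def)

text \<open>If \<open>e\<close> is the only edge across \<open>S\<close>, a path changes sides
  exactly when it traverses \<open>e\<close>, and a simple path does so at most once. This turns the
  cuts, defined by tree paths, into sets of edges crossing a node set.\<close>

lemma path_edge_crossing:
  assumes "simple_path T p"
    and cross: "\<And>x y. {x, y} \<in> T \<Longrightarrow> (x \<in> S) \<noteq> (y \<in> S) \<longleftrightarrow> {x, y} = e"
  shows "e \<in> path_edges p \<longleftrightarrow> (hd p \<in> S) \<noteq> (last p \<in> S)"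
  using assms(1)
proof (induction p)
  case Nil
  then show ?case by (simp add: simple_path_def)
next
  case (Cons x p)
  show ?case
  proof (cases p)
    case Nil
    then show ?thesis by (simp add: path_edges_def)
  next
    case (Cons y p')
    with Cons.prems have p: "simple_path T p" "{x, y} \<in> T" "x \<notin> set p"
      by (auto simp: simple_path_def)
    have "e \<noteq> {x, y} \<or> e \<notin> path_edges p" using p(3) path_edges_subset by blast
    then show ?thesis
      using Cons.IH[OF p(1)] cross[OF p(2)] unfolding Cons path_edges_Cons by auto
  qed
qed

section \<open>The structure of star instances\<close>

locale star_net =
  fixes N :: network and Ps :: "node list list" and link :: bool
  assumes ugraph: "ugraph (nodes N) (edges N)"
    and connected: "connected_graph (nodes N) (edges N)"
    and spanning: "spanning_tree (nodes N) (edges N) (tree N)"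
    and root_in: "tree_root N \<in> nodes N"
    and star: "star_instance N Ps"
begin

abbreviation "V \<equiv> nodes N"
abbreviation "E \<equiv> edges N"
abbreviation "T \<equiv> tree N"
abbreviation "r \<equiv> tree_root N"
abbreviation "child \<equiv> child_of T r"

definition pos :: "node \<Rightarrow> nat" where
  "pos v = (if v = r then 0 else THE k. \<exists>P\<in>set Ps. k < length P \<and> P ! k = v)"

text \<open>A path is named after its top node. The successor reserves 0 for the root, so the name
  alone tells the root from all path nodes.\<close>

definition pth :: "node \<Rightarrow> nat" where
  "pth v = (if v = r then 0 else Suc (hd (THE P. P \<in> set Ps \<and> v \<in> set P)))"

definition V' :: "node set" where
  "V' = V - {r}"

text \<open>The parent relation in terms of path and position only. \<open>child_iff\<close> shows
  that it is the relation \<open>child\<close> defined by depth.\<close>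

definition par :: "node \<Rightarrow> node \<Rightarrow> bool" where
  "par u v \<longleftrightarrow> v \<in> V' \<and> (if pos v = 0 then u = r else u \<in> V' \<and> pth u = pth v \<and> pos v = Suc (pos u))"

lemma finite_V: "finite V"
  using ugraph by (simp add: ugraph_def)

lemma finite_E: "finite E"
proof -
  have "E \<subseteq> Pow V" using ugraph by (auto simp: ugraph_def)
  then show ?thesis using finite_V by (meson finite_Pow_iff finite_subset)
qed

lemma finite_V' [simp]: "finite V'"
  using finite_V by (simp add: V'_def)

lemma Ps_nonempty: "P \<in> set Ps \<Longrightarrow> P \<noteq> []"
  using star by (auto simp: star_instance_def descending_path_def)

lemma Ps_child: "P \<in> set Ps \<Longrightarrow> Suc k < length P \<Longrightarrow> child (P ! k) (P ! Suc k)"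
  using star by (auto simp: star_instance_def descending_path_def successively_conv_nth)

lemma Ps_root_child: "P \<in> set Ps \<Longrightarrow> child r (P ! 0)"
  using star Ps_nonempty by (auto simp: star_instance_def hd_conv_nth)

lemma Ps_distinct:
  assumes "P \<in> set Ps" shows "distinct P"
proof -
  have "successively (\<lambda>u v. depth T r u < depth T r v) P"
    using Ps_child[OF assms] by (auto simp: successively_conv_nth child_of_def)
  then have "sorted_wrt (<) (map (depth T r) P)"
    unfolding successively_map[symmetric] by (subst (asm) successively_conv_sorted_wrt) (auto intro: transpI)
  then show ?thesis by (metis distinct_map strict_sorted_iff)
qed

lemma Ps_unique:
  assumes "P \<in> set Ps" "Q \<in> set Ps" "v \<in> set P" "v \<in> set Q" shows "P = Q"
proof -
  from assms obtain i j where "i < length Ps" "j < length Ps" "P = Ps ! i" "Q = Ps ! j"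
    by (metis in_set_conv_nth)
  with assms star show ?thesis unfolding star_instance_def by (metis IntI empty_iff)
qed

lemma V'_iff: "v \<in> V' \<longleftrightarrow> (\<exists>P\<in>set Ps. \<exists>k<length P. v = P ! k)"
  using star unfolding V'_def star_instance_def by (auto simp: in_set_conv_nth)

lemma nth_V': "P \<in> set Ps \<Longrightarrow> k < length P \<Longrightarrow> P ! k \<in> V'"
  by (auto simp: V'_iff)

lemma pos_nth:
  assumes "P \<in> set Ps" "k < length P" shows "pos (P ! k) = k"
proof -
  have "(THE j. \<exists>Q\<in>set Ps. j < length Q \<and> Q ! j = P ! k) = k"
  proof (rule the_equality)
    fix j assume "\<exists>Q\<in>set Ps. j < length Q \<and> Q ! j = P ! k"
    then obtain Q where Q: "Q \<in> set Ps" "j < length Q" "Q ! j = P ! k" by blast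
    have "Q = P" using Ps_unique[OF Q(1) assms(1), of "P ! k"] Q assms by (metis nth_mem)
    then show "j = k" using Q assms Ps_distinct nth_eq_iff_index_eq by metis
  qed (use assms in auto)
  then show ?thesis using nth_V'[OF assms] by (simp add: pos_def V'_def)
qed

lemma pth_nth:
  assumes "P \<in> set Ps" "k < length P" shows "pth (P ! k) = Suc (P ! 0)"
proof -
  have "(THE Q. Q \<in> set Ps \<and> P ! k \<in> set Q) = P"
    using assms Ps_unique by (intro the_equality) auto
  then show ?thesis using nth_V'[OF assms] Ps_nonempty[OF assms(1)]
    by (simp add: pth_def V'_def hd_conv_nth)
qed

lemma V'_cases:
  assumes "v \<in> V'"
  obtains P where "P \<in> set Ps" "pos v < length P" "v = P ! pos v" "pth v = Suc (P ! 0)"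
  using assms V'_iff pos_nth pth_nth by metis

lemma pth_root [simp]: "pth r = 0"
  by (simp add: pth_def)

lemma pth_pos: "v \<in> V' \<Longrightarrow> pth v \<noteq> 0"
  by (simp add: pth_def V'_def)

lemma pos_root [simp]: "pos r = 0"
  by (simp add: pos_def)

lemma pth_0_iff: "v \<in> V \<Longrightarrow> pth v = 0 \<longleftrightarrow> v = r"
  by (simp add: pth_def)

lemma V'_pth: "v \<in> V' \<longleftrightarrow> v \<in> V \<and> pth v \<noteq> 0"
  by (auto simp: V'_def pth_def)

lemma V'_eqI:
  assumes "u \<in> V'" "v \<in> V'" "pth u = pth v" "pos u = pos v" shows "u = v"
proof -
  obtain P where P: "P \<in> set Ps" "pos u < length P" "u = P ! pos u" "pth u = Suc (P ! 0)"
    using assms(1) by (rule V'_cases)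
  obtain Q where Q: "Q \<in> set Ps" "pos v < length Q" "v = Q ! pos v" "pth v = Suc (Q ! 0)"
    using assms(2) by (rule V'_cases)
  have "P = Q" using Ps_unique[OF P(1) Q(1), of "P ! 0"] P Q assms(3) by (metis Ps_nonempty Suc_inject length_greater_0_conv nth_mem)
  then show ?thesis using P Q assms(4) by simp
qed

lemma V_eqI: "u \<in> V \<Longrightarrow> v \<in> V \<Longrightarrow> pth u = pth v \<Longrightarrow> pos u = pos v \<Longrightarrow> u = v"
  using V'_eqI[of u v] pth_0_iff[of u] pth_0_iff[of v] by (auto simp: V'_pth)

lemma pos_0_pth: "v \<in> V' \<Longrightarrow> pos v = 0 \<Longrightarrow> pth v = Suc v"
  by (erule V'_cases) simp

lemma V'_up:
  assumes "v \<in> V'" "k \<le> pos v"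
  obtains u where "u \<in> V'" "pth u = pth v" "pos u = k"
proof -
  obtain P where P: "P \<in> set Ps" "pos v < length P" "pth v = Suc (P ! 0)"
    using assms(1) by (rule V'_cases)
  have k: "k < length P" using P assms(2) by simp
  show thesis by (rule that[of "P ! k"]) (use P k nth_V' pos_nth pth_nth in auto)
qed

lemma par_exists:
  assumes "v \<in> V'" obtains u where "par u v"
proof (cases "pos v")
  case 0
  then show thesis using that[of r] assms by (simp add: par_def)
next
  case (Suc k)
  obtain u where "u \<in> V'" "pth u = pth v" "pos u = k" using V'_up[OF assms, of k] Suc by auto
  then show thesis using that[of u] assms Suc by (simp add: par_def)
qed

lemma par_unique: "par u v \<Longrightarrow> par u' v \<Longrightarrow> u = u'"
  by (auto simp: par_def split: if_splits intro: V'_eqI)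

lemma par_child:
  assumes "par u v" shows "child u v"
proof -
  have v: "v \<in> V'" using assms by (simp add: par_def)
  then obtain P where P: "P \<in> set Ps" "pos v < length P" "v = P ! pos v" "pth v = Suc (P ! 0)"
    by (rule V'_cases)
  show ?thesis
  proof (cases "pos v")
    case 0
    then show ?thesis using assms P Ps_root_child by (simp add: par_def)
  next
    case (Suc k)
    then have u: "u \<in> V'" "pth u = pth v" "pos u = k" using assms by (auto simp: par_def)
    have k: "k < length P" using P Suc by simp
    have "u = P ! k"
      by (rule V'_eqI) (use u P k nth_V' pos_nth pth_nth in auto)
    then show ?thesis using Ps_child[of P k] P Suc by simp
  qed
qed

lemma par_in: "par u v \<Longrightarrow> u \<in> V" "par u v \<Longrightarrow> v \<in> V'" "par u v \<Longrightarrow> v \<in> V"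
  using root_in by (auto simp: par_def V'_def split: if_splits)

lemma par_tree: "par u v \<Longrightarrow> {u, v} \<in> T"
  using par_child by (simp add: child_of_def)

lemma root_reach:
  assumes "v \<in> V" shows "(r, v) \<in> (adj {{u, v} | u v. par u v})\<^sup>*"
proof (cases "v = r")
  case False
  have "(r, v) \<in> (adj {{u, v} | u v. par u v})\<^sup>*" if "v \<in> V'" "pos v = k" for k v
    using that
  proof (induction k arbitrary: v)
    case 0
    then have "par r v" by (simp add: par_def)
    then have "(r, v) \<in> adj {{u, v} | u v. par u v}" by (auto simp: adj_def)
    then show ?case by blast
  next
    case (Suc k)
    obtain u where u: "par u v" using Suc.prems par_exists by blast
    then have "u \<in> V'" "pos u = k" using Suc.prems by (auto simp: par_def)
    from Suc.IH[OF this] have "(r, u) \<in> (adj {{u, v} | u v. par u v})\<^sup>*" .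
    moreover have "(u, v) \<in> adj {{u, v} | u v. par u v}" using u by (auto simp: adj_def)
    ultimately show ?case by (rule rtrancl_into_rtrancl)
  qed
  then show ?thesis using False assms by (simp add: V'_def)
qed simp

lemma adj_sym: "(u, v) \<in> (adj X)\<^sup>* \<Longrightarrow> (v, u) \<in> (adj X)\<^sup>*"
proof -
  have "sym (adj X)" by (auto simp: sym_def adj_def insert_commute)
  then show "(u, v) \<in> (adj X)\<^sup>* \<Longrightarrow> (v, u) \<in> (adj X)\<^sup>*" by (meson sym_rtrancl symD)
qed

lemma acyclic: "acyclic_graph T" and T_sub: "T \<subseteq> E" and T_conn: "connected_graph V T"
  using spanning by (auto simp: spanning_tree_def)

text \<open>The pairs in \<open>par\<close> already connect all nodes. The ends of any further tree
  edge would be joined by two different simple paths, which acyclicity forbids.\<close>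

lemma T_eq: "T = {{u, v} | u v. par u v}"
proof
  show "{{u, v} | u v. par u v} \<subseteq> T" using par_tree by auto
  show "T \<subseteq> {{u, v} | u v. par u v}"
  proof
    fix e assume e: "e \<in> T"
    then have "card e = 2" "e \<subseteq> V" using ugraph T_sub unfolding ugraph_def by blast+
    then obtain u v where uv: "e = {u, v}" "u \<noteq> v" "u \<in> V" "v \<in> V" by (metis card_2_iff insert_subset)
    let ?T = "{{u, v} | u v. par u v}"
    have "(u, v) \<in> (adj ?T)\<^sup>*"
      using root_reach[OF uv(3)] root_reach[OF uv(4)] adj_sym by (meson rtrancl_trans)
    from simple_path_exists[OF this] obtain p where p: "simple_path ?T p" "hd p = u" "last p = v" by blast
    have "?T \<subseteq> T" using par_tree by auto
    then have "simple_path T p" using p(1) unfolding simple_path_def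
      by (auto elim!: successively_mono)
    moreover have "simple_path T [u, v]" using uv e by (simp add: simple_path_def)
    ultimately have "p = [u, v]" using simple_path_unique[OF acyclic] p by simp
    then show "e \<in> ?T" using p(1) uv by (simp add: simple_path_def)
  qed
qed

lemma oriented: "oriented N"
proof -
  have "\<exists>p c. e = {p, c} \<and> child p c" if "e \<in> T" for e
    using that par_child unfolding T_eq by auto
  then show ?thesis using T_sub by (simp add: oriented_def)
qed

lemma child_iff: "child u v \<longleftrightarrow> par u v"
proof
  assume c: "child u v"
  then have "{u, v} \<in> T" by (simp add: child_of_def)
  then obtain u' v' where p: "{u, v} = {u', v'}" "par u' v'" using T_eq by auto
  then have "child u' v'" using par_child by blast
  then show "par u v" using p c by (auto simp: doubleton_eq_iff child_of_def)
qed (rule par_child)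

text \<open>The subtree under \<open>v\<close>, which in a star is a suffix of the path. The tree
  edge above \<open>v\<close> is the only one leaving it, so cuts of tree edges are the crossing
  sets of these suffixes.\<close>

definition below :: "node \<Rightarrow> node set" where
  "below v = {x \<in> V'. pth x = pth v \<and> pos v \<le> pos x}"

lemma below_sub: "below v \<subseteq> V'" "below v \<subseteq> V"
  by (auto simp: below_def V'_def)

lemma finite_below [simp]: "finite (below v)"
  using below_sub(1) finite_V' finite_subset by blast

lemma tree_edge_crossing_par:
  assumes "par u v" "par x y"
  shows "(x \<in> below v) \<noteq> (y \<in> below v) \<longleftrightarrow> x = u \<and> y = v"
proof -
  have v: "v \<in> V'" and y: "y \<in> V'" using assms by (auto simp: par_def)
  show ?thesis
  proof (cases "pos y = 0")
    case True
    then have x: "x = r" using assms by (simp add: par_def)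
    have "x \<notin> below v" using x by (auto simp: below_def V'_def)
    moreover have "y \<in> below v \<longleftrightarrow> y = v"
      using True v y V'_eqI by (auto simp: below_def)
    moreover have "x = u" if "y = v" using that assms par_unique by blast
    ultimately show ?thesis by auto
  next
    case False
    then have x: "x \<in> V'" "pth x = pth y" "pos y = Suc (pos x)" using assms by (auto simp: par_def)
    have "(x \<in> below v) \<noteq> (y \<in> below v) \<longleftrightarrow> pth y = pth v \<and> pos y = pos v"
      using x y by (auto simp: below_def)
    also have "\<dots> \<longleftrightarrow> y = v" using V'_eqI v y by auto
    finally show ?thesis using assms par_unique by auto
  qed
qed

lemma tree_edge_crossing:
  assumes "par u v" "{x, y} \<in> T"
  shows "(x \<in> below v) \<noteq> (y \<in> below v) \<longleftrightarrow> {x, y} = {u, v}"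
proof -
  have uv: "u \<noteq> v" using par_child[OF assms(1)] by (auto simp: child_of_def)
  have asym: "\<not> par v u" using par_child[of v u] par_child[OF assms(1)] by (auto simp: child_of_def)
  from assms(2) have "par x y \<or> par y x" unfolding T_eq by (auto simp: doubleton_eq_iff)
  then show ?thesis
    using tree_edge_crossing_par[OF assms(1)] asym by (auto simp: doubleton_eq_iff)
qed

lemma tree_path:
  assumes "u \<in> V" "v \<in> V"
  shows "simple_path T (tree_path T u v)" "hd (tree_path T u v) = u" "last (tree_path T u v) = v"
proof -
  have "\<exists>!p. simple_path T p \<and> hd p = u \<and> last p = v"
    using simple_path_exists T_conn assms simple_path_unique[OF acyclic]
    unfolding connected_graph_def by metis
  from theI'[OF this] show "simple_path T (tree_path T u v)" "hd (tree_path T u v) = u" "last (tree_path T u v) = v"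
    by (auto simp: tree_path_def)
qed

lemma tree_path_crossing:
  assumes "par a b" "u \<in> V" "v \<in> V"
  shows "{a, b} \<in> path_edges (tree_path T u v) \<longleftrightarrow> (u \<in> below b) \<noteq> (v \<in> below b)"
  using path_edge_crossing[OF tree_path(1)[OF assms(2,3)] tree_edge_crossing[OF assms(1)]]
    tree_path(2,3)[OF assms(2,3)] by simp

definition wt :: "node \<Rightarrow> node \<Rightarrow> nat" where
  "wt x y = (if {x, y} \<in> E then weight N {x, y} else 0)"

lemma wt_sym: "wt x y = wt y x"
  by (simp add: wt_def insert_commute)

lemma wt_refl [simp]: "wt x x = 0"
  using ugraph by (auto simp: wt_def ugraph_def)

lemma edge_in: "{u, v} \<in> E \<Longrightarrow> u \<in> V \<and> v \<in> V \<and> u \<noteq> v"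
proof -
  assume "{u, v} \<in> E"
  then have "{u, v} \<subseteq> V" "card {u, v} = 2" using ugraph by (auto simp: ugraph_def)
  then show ?thesis by (cases "u = v") auto
qed

definition cr :: "node set \<Rightarrow> edge set" where
  "cr S = {d \<in> E. \<exists>u v. d = {u, v} \<and> u \<in> S \<and> v \<notin> S}"

lemma cr_iff: "{u, v} \<in> cr S \<longleftrightarrow> {u, v} \<in> E \<and> (u \<in> S) \<noteq> (v \<in> S)"
  by (auto simp: cr_def doubleton_eq_iff)

lemma finite_cr: "finite (cr S)"
  using finite_E by (simp add: cr_def)

lemma cut1_eq:
  assumes "par a b" shows "cut1 N {a, b} = (\<Sum>d\<in>cr (below b). weight N d)"
proof -
  have "{d. d \<in> E \<and> (\<exists>u v. d = {u, v} \<and> {a, b} \<in> path_edges (tree_path T u v))} = cr (below b)"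
    using tree_path_crossing[OF assms] edge_in by (auto simp: cr_def) (metis insert_commute)+
  then show ?thesis by (simp add: cut1_def)
qed

lemma E_cases:
  assumes "d \<in> E" obtains u v where "d = {u, v}" "u \<in> V" "v \<in> V"
proof -
  have "card d = 2" "d \<subseteq> V" using assms ugraph by (auto simp: ugraph_def)
  then show thesis using that by (auto simp: card_2_iff)
qed

lemma cut2_eq:
  assumes "par a b" "par a' b'"
  shows "cut2 N {a, b} {a', b'} = (\<Sum>d\<in>(cr (below b) - cr (below b')) \<union> (cr (below b') - cr (below b)). weight N d)"
proof -
  have "(\<exists>u v. d = {u, v} \<and> ({a, b} \<in> path_edges (tree_path T u v)) \<noteq> ({a', b'} \<in> path_edges (tree_path T u v)))
    \<longleftrightarrow> (d \<in> cr (below b)) \<noteq> (d \<in> cr (below b'))" if "d \<in> E" for d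
  proof -
    obtain u v where uv: "d = {u, v}" "u \<in> V" "v \<in> V" using E_cases[OF \<open>d \<in> E\<close>] by blast
    have "({a, b} \<in> path_edges (tree_path T x y)) \<noteq> ({a', b'} \<in> path_edges (tree_path T x y))
      \<longleftrightarrow> (d \<in> cr (below b)) \<noteq> (d \<in> cr (below b'))" if "d = {x, y}" for x y
    proof -
      have xy: "x \<in> V" "y \<in> V" using uv that by (auto simp: doubleton_eq_iff)
      show ?thesis using \<open>d \<in> E\<close> unfolding that cr_iff
          tree_path_crossing[OF assms(1) xy] tree_path_crossing[OF assms(2) xy] by blast
    qed
    then show ?thesis using uv(1) by blast
  qed
  moreover have "cr S \<subseteq> E" for S by (auto simp: cr_def)
  ultimately have "{d. d \<in> E \<and> (\<exists>u v. d = {u, v} \<and> ({a, b} \<in> path_edges (tree_path T u v)) \<noteq> ({a', b'} \<in> path_edges (tree_path T u v)))}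
    = (cr (below b) - cr (below b')) \<union> (cr (below b') - cr (below b))"
    by blast
  then show ?thesis by (simp add: cut2_def)
qed

lemma sum_edges_between:
  assumes "S \<subseteq> V" "S' \<subseteq> V" "S \<inter> S' = {}"
  shows "(\<Sum>d | d \<in> E \<and> (\<exists>u\<in>S. \<exists>v\<in>S'. d = {u, v}). weight N d) = (\<Sum>x\<in>S. \<Sum>y\<in>S'. wt x y)"
proof -
  let ?D = "{(x, y). x \<in> S \<and> y \<in> S' \<and> {x, y} \<in> E}"
  have fin: "finite S" "finite S'" using assms finite_V by (auto intro: finite_subset)
  have "{d. d \<in> E \<and> (\<exists>u\<in>S. \<exists>v\<in>S'. d = {u, v})} = (\<lambda>(x, y). {x, y}) ` ?D" by auto
  moreover have "inj_on (\<lambda>(x, y). {x, y}) ?D"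
    using assms(3) by (auto simp: inj_on_def doubleton_eq_iff)
  ultimately have "(\<Sum>d | d \<in> E \<and> (\<exists>u\<in>S. \<exists>v\<in>S'. d = {u, v}). weight N d)
      = (\<Sum>(x, y)\<in>?D. weight N {x, y})"
    by (simp add: sum.reindex case_prod_beta')
  also have "\<dots> = (\<Sum>(x, y)\<in>S \<times> S'. wt x y)"
    using fin by (intro sum.mono_neutral_cong_left) (auto simp: wt_def split: if_splits)
  also have "\<dots> = (\<Sum>x\<in>S. \<Sum>y\<in>S'. wt x y)" by (simp add: sum.cartesian_product)
  finally show ?thesis .
qed

definition c1 :: "node \<Rightarrow> nat" where
  "c1 v = (\<Sum>x\<in>below v. \<Sum>y\<in>V - below v. wt x y)"

definition W :: "node \<Rightarrow> node \<Rightarrow> nat" where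
  "W v w = (\<Sum>x\<in>below v. \<Sum>y\<in>below w. wt x y)"

lemma cr_below: "(\<Sum>d\<in>cr (below v). weight N d) = c1 v"
proof -
  have "cr (below v) = {d. d \<in> E \<and> (\<exists>u\<in>below v. \<exists>w\<in>V - below v. d = {u, w})}"
    using edge_in by (fastforce simp: cr_def)
  then show ?thesis using sum_edges_between[of "below v" "V - below v"] below_sub
    by (simp add: c1_def)
qed

lemma cut1_par: "par a b \<Longrightarrow> cut1 N {a, b} = c1 b"
  by (simp add: cut1_eq cr_below)

text \<open>Inclusion and exclusion: suffixes of different paths are disjoint, so the edges that
  cross both are those running between them. The additive form avoids truncated subtraction.\<close>

lemma cut2_par:
  assumes "par a b" "par a' b'" "pth b \<noteq> pth b'"
  shows "cut2 N {a, b} {a', b'} + 2 * W b b' = c1 b + c1 b'"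
proof -
  let ?A = "cr (below b)" and ?B = "cr (below b')"
  have disj: "below b \<inter> below b' = {}" using assms(3) by (auto simp: below_def)
  have "?A \<inter> ?B = {d. d \<in> E \<and> (\<exists>u\<in>below b. \<exists>v\<in>below b'. d = {u, v})}"
  proof (intro equalityI subsetI)
    fix d assume d: "d \<in> ?A \<inter> ?B"
    then obtain u v where uv: "d = {u, v}" "u \<in> below b" "v \<notin> below b" by (auto simp: cr_def)
    have "u \<notin> below b'" using uv disj by auto
    with d uv have "v \<in> below b'" by (auto simp: cr_iff)
    with d uv show "d \<in> {d. d \<in> E \<and> (\<exists>u\<in>below b. \<exists>v\<in>below b'. d = {u, v})}" by (auto simp: cr_def)
  next
    fix d assume "d \<in> {d. d \<in> E \<and> (\<exists>u\<in>below b. \<exists>v\<in>below b'. d = {u, v})}"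
    then show "d \<in> ?A \<inter> ?B" using disj by (auto simp: cr_iff)
  qed
  then have W: "(\<Sum>d\<in>?A \<inter> ?B. weight N d) = W b b'"
    using sum_edges_between[of "below b" "below b'"] below_sub disj by (simp add: W_def)
  have "cut2 N {a, b} {a', b'} = (\<Sum>d\<in>?A - ?B. weight N d) + (\<Sum>d\<in>?B - ?A. weight N d)"
    unfolding cut2_eq[OF assms(1,2)] by (rule sum.union_disjoint) (auto simp: finite_cr)
  moreover have "c1 b = (\<Sum>d\<in>?A - ?B. weight N d) + (\<Sum>d\<in>?A \<inter> ?B. weight N d)"
    unfolding cr_below[symmetric] using sum.Int_Diff[OF finite_cr, of "weight N" "below b" ?B] by simp
  moreover have "c1 b' = (\<Sum>d\<in>?B - ?A. weight N d) + (\<Sum>d\<in>?B \<inter> ?A. weight N d)"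
    unfolding cr_below[symmetric] using sum.Int_Diff[OF finite_cr, of "weight N" "below b'" ?A] by simp
  ultimately show ?thesis using W by (simp add: Int_commute)
qed

text \<open>Tree edges are represented by their lower endpoints. The edge above a top node leads to
  the root, and \<open>link\<close> decides whether it may occur in a pair.\<close>

definition elig :: "node \<Rightarrow> bool" where
  "elig v \<longleftrightarrow> v \<in> V' \<and> (link \<or> pos v \<noteq> 0)"

lemma star_path_edges_iff:
  assumes "P \<in> set Ps"
  shows "e \<in> star_path_edges link N P \<longleftrightarrow> (\<exists>u v. par u v \<and> e = {u, v} \<and> elig v \<and> pth v = Suc (P ! 0))"
proof
  assume e: "e \<in> star_path_edges link N P"
  show "\<exists>u v. par u v \<and> e = {u, v} \<and> elig v \<and> pth v = Suc (P ! 0)"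
  proof (cases link)
    case True
    then obtain k where k: "k < length P" "e = {(r # P) ! k, P ! k}"
      using e by (auto simp: star_path_edges_def path_edges_def)
    have "par ((r # P) ! k) (P ! k)"
      using k assms nth_V' pos_nth pth_nth by (cases k) (auto simp: par_def)
    moreover have "elig (P ! k)" using \<open>link\<close> k assms nth_V' unfolding elig_def by blast
    ultimately show ?thesis using k assms pth_nth by blast
  next
    case False
    then obtain k where k: "Suc k < length P" "e = {P ! k, P ! Suc k}"
      using e by (auto simp: star_path_edges_def path_edges_def)
    have "par (P ! k) (P ! Suc k)"
      using k assms nth_V' pos_nth pth_nth by (auto simp: par_def)
    moreover have "elig (P ! Suc k)" using k assms nth_V' pos_nth by (auto simp: elig_def)
    ultimately show ?thesis using k assms pth_nth by blast
  qed
next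
  assume "\<exists>u v. par u v \<and> e = {u, v} \<and> elig v \<and> pth v = Suc (P ! 0)"
  then obtain u v where uv: "par u v" "e = {u, v}" "elig v" "pth v = Suc (P ! 0)" by blast
  have v: "v \<in> V'" using uv(1) by (rule par_in)
  obtain Q where Q: "Q \<in> set Ps" "pos v < length Q" "v = Q ! pos v" "pth v = Suc (Q ! 0)"
    using v by (rule V'_cases)
  have "P = Q" using Ps_unique[OF assms Q(1), of "P ! 0"] Q(4) uv(4) Ps_nonempty assms Q(1)
    by (metis Suc_inject length_greater_0_conv nth_mem)
  with Q have P: "pos v < length P" "v = P ! pos v" by auto
  have u: "u = (r # P) ! pos v"
  proof (cases "pos v")
    case 0
    then show ?thesis using uv(1) by (simp add: par_def)
  next
    case (Suc k)
    then have u: "u \<in> V'" "pth u = pth v" "pos u = k" using uv(1) by (auto simp: par_def)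
    have k: "k < length P" using P(1) Suc by simp
    have "u = P ! k"
      by (rule V'_eqI) (simp_all add: u uv(4) nth_V'[OF assms k] pth_nth[OF assms k] pos_nth[OF assms k])
    then show ?thesis using Suc by simp
  qed
  show "e \<in> star_path_edges link N P"
  proof (cases link)
    case True
    have "e = {(r # P) ! pos v, (r # P) ! Suc (pos v)}" using uv(2) u P(2)[symmetric] by simp
    then show ?thesis using True P(1) unfolding star_path_edges_def path_edges_def by auto
  next
    case False
    then have "pos v \<noteq> 0" using uv(3) unfolding elig_def by blast
    then obtain k where k: "pos v = Suc k" by (cases "pos v") auto
    have "u = P ! k" using u k by simp
    moreover have "v = P ! Suc k" using P(2) unfolding k .
    ultimately have "e = {P ! k, P ! Suc k}" using uv(2) by simp
    then show ?thesis using False P(1) k unfolding star_path_edges_def path_edges_def by auto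
  qed
qed

lemma cut2_commute: "cut2 N e f = cut2 N f e"
  unfolding cut2_def by (intro sum.cong Collect_cong conj_cong ex_cong1 refl) blast

lemma W_commute: "W v w = W w v"
  unfolding W_def by (subst sum.swap) (simp add: wt_sym)

lemma W_le:
  assumes "v \<in> V'" "w \<in> V'" "pth v \<noteq> pth w" shows "W v w \<le> c1 v"
proof -
  have "below w \<subseteq> V - below v" using below_sub assms(3) by (auto simp: below_def V'_def)
  then show ?thesis unfolding W_def c1_def using finite_V
    by (intro sum_mono sum_mono2) auto
qed

definition smc :: nat where "smc = star_min_cut link N Ps"

definition cands :: "nat set" where
  "cands = c1 ` V' \<union> {c1 v + c1 w - 2 * W v w | v w. elig v \<and> elig w \<and> pth v \<noteq> pth w}"

lemma cands_eq:
  "cands = {cut1 N e | e. e \<in> tree N} \<union>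
     {cut2 N e f | e f i j. i < j \<and> j < length Ps \<and>
        e \<in> star_path_edges link N (Ps ! i) \<and> f \<in> star_path_edges link N (Ps ! j)}"
  (is "_ = ?A \<union> ?B")
proof -
  have A: "?A = c1 ` V'"
  proof (intro equalityI subsetI)
    fix x assume "x \<in> ?A"
    then show "x \<in> c1 ` V'" unfolding T_eq using cut1_par par_in by auto
  next
    fix x assume "x \<in> c1 ` V'"
    then obtain v where "v \<in> V'" "x = c1 v" by auto
    moreover then obtain u where "par u v" using par_exists by blast
    ultimately show "x \<in> ?A" using cut1_par[of u v] par_tree[of u v] by force
  qed
  have B: "?B = {c1 v + c1 w - 2 * W v w | v w. elig v \<and> elig w \<and> pth v \<noteq> pth w}" (is "_ = ?B'")
  proof (intro equalityI subsetI)
    fix x assume "x \<in> ?B"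
    then obtain e f i j where x: "x = cut2 N e f" "i < j" "j < length Ps"
        "e \<in> star_path_edges link N (Ps ! i)" "f \<in> star_path_edges link N (Ps ! j)" by blast
    have P: "Ps ! i \<in> set Ps" "Ps ! j \<in> set Ps" using x by auto
    obtain u v where uv: "par u v" "e = {u, v}" "elig v" "pth v = Suc (Ps ! i ! 0)"
      using x(4) star_path_edges_iff[OF P(1)] by auto
    obtain u' v' where uv': "par u' v'" "f = {u', v'}" "elig v'" "pth v' = Suc (Ps ! j ! 0)"
      using x(5) star_path_edges_iff[OF P(2)] by auto
    have "set (Ps ! i) \<inter> set (Ps ! j) = {}" using star x(2,3) unfolding star_instance_def by auto
    then have "pth v \<noteq> pth v'" using uv(4) uv'(4) P Ps_nonempty
      by (metis Suc_inject disjoint_iff length_greater_0_conv nth_mem)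
    then show "x \<in> ?B'" using cut2_par[OF uv(1) uv'(1)] uv uv' x(1) by force
  next
    fix x assume "x \<in> ?B'"
    then obtain v w where vw: "x = c1 v + c1 w - 2 * W v w" "elig v" "elig w" "pth v \<noteq> pth w" by blast
    then have V: "v \<in> V'" "w \<in> V'" by (auto simp: elig_def)
    obtain a b where ab: "par a v" "par b w" using par_exists V by metis
    obtain P where P: "P \<in> set Ps" "pth v = Suc (P ! 0)" using V(1) by (rule V'_cases)
    obtain Q where Q: "Q \<in> set Ps" "pth w = Suc (Q ! 0)" using V(2) by (rule V'_cases)
    obtain i j where ij: "i < length Ps" "j < length Ps" "P = Ps ! i" "Q = Ps ! j"
      using P(1) Q(1) by (metis in_set_conv_nth)
    have "i \<noteq> j" using ij P Q vw(4) by auto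
    have e: "{a, v} \<in> star_path_edges link N P" "{b, w} \<in> star_path_edges link N Q"
      using star_path_edges_iff[OF P(1), THEN iffD2, OF exI[of _ a], OF exI[of _ v]]
        star_path_edges_iff[OF Q(1), THEN iffD2, OF exI[of _ b], OF exI[of _ w]] ab vw P(2) Q(2) by simp_all
    have "x = cut2 N {a, v} {b, w}" using cut2_par[OF ab vw(4)] vw(1) by simp
    then have x: "x = cut2 N {a, v} {b, w}" "x = cut2 N {b, w} {a, v}" using cut2_commute by simp_all
    from \<open>i \<noteq> j\<close> consider "i < j" | "j < i" by linarith
    then show "x \<in> ?B"
    proof cases
      case 1
      then show ?thesis using e ij x(1) by blast
    next
      case 2
      then show ?thesis using e ij x(2) by blast
    qed
  qed
  show ?thesis unfolding cands_def A B ..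
qed

lemma V'_nonempty: "V' \<noteq> {}"
proof -
  obtain P where "P \<in> set Ps" using star by (auto simp: star_instance_def) (meson last_in_set)
  then show ?thesis using nth_V' Ps_nonempty by fastforce
qed

lemma finite_cands: "finite cands"
proof -
  have "cands \<subseteq> c1 ` V' \<union> (\<lambda>(v, w). c1 v + c1 w - 2 * W v w) ` (V' \<times> V')"
    by (auto simp: cands_def elig_def)
  then show ?thesis by (rule finite_subset) auto
qed

lemma smc_Min: "smc = Min cands"
  by (simp add: smc_def star_min_cut_def cands_eq)

lemma smc_le: "x \<in> cands \<Longrightarrow> smc \<le> x"
  using finite_cands by (simp add: smc_Min)

lemma smc_in: "smc \<in> cands"
  unfolding smc_Min using V'_nonempty by (intro Min_in finite_cands) (auto simp: cands_def)

end

section \<open>Executing steps on star instances\<close>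

text \<open>In the first phase, \<open>off\<close> is the offset of a node from the top of its segment, and \<open>mk\<close> marks the
  segments that have been merged in the current stage; afterwards \<open>off\<close> is the position on the path.
  \<open>xin\<close> and \<open>acc\<close> are the input and the output of suffix sums. \<open>cutm\<close> is \<open>cut\<close> with a huge value at the
  edges that do not take part in pairs. \<open>dn\<close> and \<open>dd\<close> are the weights of the edges to other paths
  from a node and from its suffix.

  For a matched pair of paths, a node of the right path is assigned to the block \<open>rk\<close> of the left
  path, and \<open>qs\<close>, \<open>cq\<close> and \<open>bs\<close> describe the best node of its interval: its position, its cut, and the
  weight from the interval below it to the left nodes beyond the block. \<open>lq\<close> (one more than \<open>qs\<close>, or 0
  if nothing was received), \<open>lc\<close> and \<open>lb\<close> are the copies at the left block. \<open>gam\<close> is the weight between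
  what lies beyond the block and what lies beyond the interval.\<close>

record nst =
  ident :: nat
  pid :: nat
  seg :: nat
  off :: nat
  mk :: nat
  xin :: nat
  acc :: nat
  cut :: nat
  cutm :: nat
  dn :: nat
  dd :: nat
  tot :: nat
  kap :: nat
  kl :: nat
  kr :: nat
  rk :: nat
  qs :: nat
  bet :: nat
  bs :: nat
  cq :: nat
  lq :: nat
  lb :: nat
  lc :: nat
  gam :: nat
  best :: nat

definition vl :: "nat list \<Rightarrow> vec" where
  "vl xs i = (if i < length xs then xs ! i else 0)"

lemma vl_simps [simp]:
  "vl [] = (\<lambda>_. 0)" "vl (x # xs) 0 = x" "vl (x # xs) (Suc i) = vl xs i"
  "vl (x # xs) 1 = vl xs 0" "vl (x # xs) (numeral k) = vl xs (pred_numeral k)"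
  by (auto simp: vl_def fun_eq_iff numeral_eq_Suc)

definition local_step :: "(nst \<Rightarrow> nst) \<Rightarrow> nst step" where
  "local_step f = \<lparr> bcast = \<lambda>_. vl [], reply = \<lambda>_ _ _ _. vl [], join = \<lambda>_ _. False,
     share = \<lambda>_ _. vl [], update = \<lambda>st _ _. f st \<rparr>"

lemma exec_local [simp]: "exec N L (local_step f) st v = f (st v)"
  by (simp add: exec_def local_step_def)

lemma vagg_sum: "i < 2 \<Longrightarrow> (\<Sum>u\<in>K. f u i) < 2 ^ n \<Longrightarrow> vagg n f K i = (\<Sum>u\<in>K. f u i)"
  by (simp add: vagg_def)

lemma vagg_max_eqI:
  assumes "2 \<le> i" "i < 8" "finite K" "\<And>u. u \<in> K \<Longrightarrow> f u i \<le> m" "m < 2 ^ n" "m = 0 \<or> (\<exists>u\<in>K. f u i = m)"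
  shows "vagg n f K i = m"
proof -
  have eq: "f u i mod 2 ^ n = f u i" if "u \<in> K" for u
    using assms(4)[OF that] assms(5) by simp
  then have "(\<lambda>u. f u i mod 2 ^ n) ` K = (\<lambda>u. f u i) ` K" by (auto cong: image_cong_simp)
  moreover have "Max (insert 0 ((\<lambda>u. f u i) ` K)) = m"
    using assms(3,4,6) by (intro Max_eqI) auto
  ultimately show ?thesis using assms(1,2) by (simp add: vagg_def)
qed

lemma sent_vl:
  assumes "bcast s (st v) = vl xs" "length xs \<le> 8" "\<forall>x\<in>set xs. x < 2 ^ width L"
  shows "sent L s st v = vl xs"
proof
  fix i
  show "sent L s st v i = vl xs i"
    using assms by (auto simp: sent_def trunc_def vl_def)
qed

locale star_prog = star_net +
  fixes L :: nat
  assumes node_less: "v \<in> V \<Longrightarrow> v < 2 ^ L"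
    and weight_less: "e \<in> E \<Longrightarrow> weight N e < 2 ^ L"
begin

abbreviation "n \<equiv> width L"

lemma pow_width:
  fixes x :: nat
  assumes k: "k \<le> 15" "c \<le> 15" "x \<le> 2 ^ (k * L + c)" shows "x < 2 ^ n"
proof -
  have "k * L + c \<le> 15 * L + 15" using k by (intro add_mono mult_le_mono1)
  also have "\<dots> < n" by (simp add: width_def)
  finally have "k * L + c < n" .
  then have "(2::nat) ^ (k * L + c) < 2 ^ n" by simp
  then show ?thesis using k(3) by linarith
qed

lemma card_V: "card V \<le> 2 ^ L"
proof -
  have "V \<subseteq> {..<2 ^ L}" using node_less by auto
  from card_mono[OF _ this] show ?thesis by simp
qed

text \<open>The nodes at positions \<open>0\<close> to \<open>pos v\<close> and the root are
  distinct, and there are at most \<open>2 ^ L\<close> nodes. Counting the root makes the inequality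
  strict.\<close>

lemma pos_less': assumes "v \<in> V'" shows "Suc (pos v) < 2 ^ L"
proof -
  have "{..pos v} \<subseteq> pos ` V'"
  proof
    fix k assume "k \<in> {..pos v}"
    then obtain u where "u \<in> V'" "pos u = k" using V'_up[OF assms, of k] by auto
    then show "k \<in> pos ` V'" by auto
  qed
  then have "card {..pos v} \<le> card V'" by (metis card_image_le card_mono finite_V' finite_imageI le_trans)
  also have "card V' < card V" using finite_V root_in unfolding V'_def
    by (intro psubset_card_mono) auto
  finally show ?thesis using card_V by simp
qed

lemma pos_less: "v \<in> V \<Longrightarrow> pos v < 2 ^ L"
  using pos_less'[of v] by (cases "v = r") (auto simp: V'_def)

lemma pth_le: assumes "v \<in> V" shows "pth v \<le> 2 ^ L"
proof (cases "v = r")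
  case False
  then have "v \<in> V'" using assms by (simp add: V'_def)
  then obtain u where u: "u \<in> V'" "pth u = pth v" "pos u = 0" using V'_up[of v 0] by auto
  then have "pth v = Suc u" using pos_0_pth by metis
  then show ?thesis using node_less[of u] u(1) by (simp add: V'_def)
qed simp

lemma small_width: "(x::nat) \<le> 2 ^ L \<Longrightarrow> x < 2 ^ n"
  using pow_width[of 1 0 x] by simp

lemma wt_le: "wt u v \<le> 2 ^ L"
  using weight_less by (auto simp: wt_def intro: less_imp_le)

lemma sum_le: "K \<subseteq> V \<Longrightarrow> (\<And>u. u \<in> K \<Longrightarrow> f u \<le> B) \<Longrightarrow> (\<Sum>u\<in>K. f u) \<le> 2 ^ L * (B :: nat)"
proof -
  assume "K \<subseteq> V" "\<And>u. u \<in> K \<Longrightarrow> f u \<le> B"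
  then have "(\<Sum>u\<in>K. f u) \<le> of_nat (card K) * B" by (intro sum_bounded_above) auto
  also have "\<dots> \<le> 2 ^ L * B"
    using card_mono[OF finite_V \<open>K \<subseteq> V\<close>] card_V by (intro mult_le_mono1) simp
  finally show ?thesis .
qed

lemma wt_sum_le: "K \<subseteq> V \<Longrightarrow> (\<Sum>u\<in>K. wt v u) \<le> 2 ^ (2 * L)"
  using sum_le[of K "wt v" "2 ^ L"] wt_le by (simp add: power_add mult_2)

lemma finite_sub: "K \<subseteq> V \<Longrightarrow> finite K"
  using finite_V finite_subset by blast

lemma direction_eq:
  assumes "{v, u} \<in> E"
  shows "direction (edge_input_of N {v, u}) v = (if par u v then 1 else if par v u then 2 else 0)"
proof -
  consider "par u v" | "par v u" | "{v, u} \<notin> T"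
    unfolding T_eq by (auto simp: doubleton_eq_iff)
  then show ?thesis
  proof cases
    case 1
    then have "input_parent (edge_input_of N {v, u}) = Some u"
      using input_parent_edge_input_of[of N u v] child_iff by (simp add: insert_commute)
    moreover have "u \<noteq> v" using edge_in[OF assms] by auto
    ultimately show ?thesis using 1 by (simp add: direction_def)
  next
    case 2
    then have "input_parent (edge_input_of N {v, u}) = Some v"
      using input_parent_edge_input_of[of N v u] child_iff by simp
    moreover have "\<not> par u v" using 2 child_iff[of u v] child_iff[of v u] by (auto simp: child_of_def)
    ultimately show ?thesis using 2 by (simp add: direction_def)
  next
    case 3
    then have "\<not> par u v" "\<not> par v u" using par_tree[of u v] par_tree[of v u] by (auto simp: insert_commute)
    then show ?thesis using 3 by (simp add: direction_def edge_input_of_def)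
  qed
qed

lemma par_pth: "par p c \<Longrightarrow> pth p = 0 \<longleftrightarrow> p = r" "par p c \<Longrightarrow> 0 < pth p \<longleftrightarrow> p \<noteq> r"
  using par_in pth_0_iff[of p] by auto

lemma nbrs_sub: "v \<in> V \<Longrightarrow> {u. {v, u} \<in> E} \<subseteq> V"
  using edge_in by auto

lemma nbr_agg_sum:
  assumes "v \<in> V" "i < 2"
    and "\<And>u. {v, u} \<in> E \<Longrightarrow> reply s (weight N {v, u}) (direction (edge_input_of N {v, u}) v)
      (sent L s st v) (sent L s st u) i = (if Q u then weight N {v, u} else 0)"
  shows "nbr_agg N L s st v i = (\<Sum>u | u \<in> V \<and> Q u. wt v u)"
proof -
  let ?U = "{u. {v, u} \<in> E}"
  let ?f = "\<lambda>u. reply s (weight N {v, u}) (direction (edge_input_of N {v, u}) v)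
      (sent L s st v) (sent L s st u)"
  have "(\<Sum>u\<in>?U. ?f u i) = (\<Sum>u\<in>?U. if Q u then wt v u else 0)"
    by (intro sum.cong refl) (simp add: assms(3) wt_def)
  also have "\<dots> = (\<Sum>u\<in>V. if Q u then wt v u else 0)"
    using nbrs_sub[OF assms(1)] finite_V by (intro sum.mono_neutral_left) (auto simp: wt_def)
  also have "\<dots> = (\<Sum>u | u \<in> V \<and> Q u. wt v u)"
    using finite_V by (simp add: sum.inter_filter)
  finally have eq: "(\<Sum>u\<in>?U. ?f u i) = (\<Sum>u | u \<in> V \<and> Q u. wt v u)" .
  have "(\<Sum>u | u \<in> V \<and> Q u. wt v u) < 2 ^ n"
    using wt_sum_le[of "{u. u \<in> V \<and> Q u}" v] by (intro pow_width[of 2 0]) auto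
  then show ?thesis unfolding nbr_agg_def using vagg_sum[of i ?f ?U n] assms(2) eq by simp
qed

lemma nbr_agg_max:
  assumes "v \<in> V" "2 \<le> i" "i < 8" "m < 2 ^ n"
    and "\<And>u. {v, u} \<in> E \<Longrightarrow> reply s (weight N {v, u}) (direction (edge_input_of N {v, u}) v)
      (sent L s st v) (sent L s st u) i \<le> m"
    and "m = 0 \<or> (\<exists>u. {v, u} \<in> E \<and> reply s (weight N {v, u}) (direction (edge_input_of N {v, u}) v)
      (sent L s st v) (sent L s st u) i = m)"
  shows "nbr_agg N L s st v i = m"
  unfolding nbr_agg_def
  by (rule vagg_max_eqI) (use assms finite_sub[OF nbrs_sub[OF assms(1)]] in auto)

text \<open>A monotone label is constant on contiguous stretches of a path, so contracting the edges
  between consecutive nodes of equal label connects each class. The root is never joined and stays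
  alone. Paths, dyadic blocks, segments and intervals are all contracted as instances of
  this.\<close>

lemma supernode_lab:
  fixes lab :: "node \<Rightarrow> nat"
  assumes mono: "\<And>u v. u \<in> V' \<Longrightarrow> v \<in> V' \<Longrightarrow> pth u = pth v \<Longrightarrow> pos u \<le> pos v \<Longrightarrow> lab u \<le> lab v"
    and join: "\<And>p c. par p c \<Longrightarrow> join s (sent L s st p) (sent L s st c) \<longleftrightarrow> p \<noteq> r \<and> lab p = lab c"
    and v: "v \<in> V"
  shows "supernode (joined N L s st) v = {u \<in> V. pth u = pth v \<and> lab u = lab v}"
proof -
  let ?J = "joined N L s st"
  have J: "?J = {{p, c} | p c. par p c \<and> p \<noteq> r \<and> lab p = lab c}"
    unfolding joined_def child_iff using join by blast
  have step: "u' \<in> V \<and> pth u' = pth u \<and> lab u' = lab u" if "(u, u') \<in> adj ?J" "u \<in> V" for u u'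
  proof -
    from that obtain p c where pc: "{u, u'} = {p, c}" "par p c" "p \<noteq> r" "lab p = lab c"
      unfolding J adj_def by auto
    have "pth p = pth c" using pc(2,3) by (auto simp: par_def split: if_splits)
    moreover have "p \<in> V" "c \<in> V" using pc(2) par_in by auto
    ultimately show ?thesis using pc by (auto simp: doubleton_eq_iff)
  qed
  have 1: "u \<in> {u \<in> V. pth u = pth v \<and> lab u = lab v}" if "(v, u) \<in> (adj ?J)\<^sup>*" for u
    using that
  proof (induction rule: rtrancl_induct)
    case (step y z)
    then show ?case using \<open>\<And>u u'. (u, u') \<in> adj ?J \<Longrightarrow> u \<in> V \<Longrightarrow> u' \<in> V \<and> pth u' = pth u \<and> lab u' = lab u\<close>[of y z]
      by auto
  qed (use v in auto)
  have 2: "(a, b) \<in> (adj ?J)\<^sup>*" if "a \<in> V'" "b \<in> V'" "pth a = pth b" "lab a = lab b" "pos b = pos a + k" for a b k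
    using that
  proof (induction k arbitrary: b)
    case 0
    then have "a = b" using V'_eqI by simp
    then show ?case by simp
  next
    case (Suc k)
    obtain p where p: "par p b" using par_exists[OF Suc.prems(2)] by blast
    then have p': "p \<in> V'" "pth p = pth b" "pos b = Suc (pos p)" using Suc.prems(5) by (auto simp: par_def)
    have "lab a \<le> lab p" by (rule mono) (use Suc.prems p' in auto)
    moreover have "lab p \<le> lab b" by (rule mono) (use Suc.prems p' in auto)
    ultimately have l: "lab p = lab b" using Suc.prems(4) by simp
    have "(a, p) \<in> (adj ?J)\<^sup>*" by (rule Suc.IH) (use Suc.prems p' l in auto)
    moreover have "(p, b) \<in> adj ?J" unfolding J adj_def using p p' l by (auto simp: V'_def)
    ultimately show ?case by (rule rtrancl_into_rtrancl)
  qed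
  have 3: "(v, u) \<in> (adj ?J)\<^sup>*" if u: "u \<in> V" "pth u = pth v" "lab u = lab v" for u
  proof (cases "v = r")
    case True
    then have "u = r" using u pth_0_iff by simp
    then show ?thesis using True by simp
  next
    case False
    then have vV: "v \<in> V'" using v by (simp add: V'_def)
    then have uV: "u \<in> V'" using u by (simp add: V'_pth)
    show ?thesis
    proof (cases "pos v \<le> pos u")
      case True
      then show ?thesis using 2[of v u "pos u - pos v"] vV uV u by simp
    next
      case False
      then show ?thesis using 2[of u v "pos v - pos u"] vV uV u by (auto intro: adj_sym[of u])
    qed
  qed
  show ?thesis
  proof (rule set_eqI)
    fix u
    show "u \<in> supernode ?J v \<longleftrightarrow> u \<in> {u \<in> V. pth u = pth v \<and> lab u = lab v}"
      unfolding supernode_def mem_Collect_eq using 1[of u] 3[of u] by blast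
  qed
qed

lemma supernode_path:
  assumes "\<And>p c. par p c \<Longrightarrow> join s (sent L s st p) (sent L s st c) \<longleftrightarrow> p \<noteq> r" "v \<in> V"
  shows "supernode (joined N L s st) v = {u \<in> V. pth u = pth v}"
  using supernode_lab[where lab = "\<lambda>_. 0", of s st v] assms by simp

definition base :: "(node \<Rightarrow> nst) \<Rightarrow> bool" where
  "base st \<longleftrightarrow> (\<forall>v\<in>V. pid (st v) = pth v \<and> off (st v) = pos v)"

lemma baseD: "base st \<Longrightarrow> v \<in> V \<Longrightarrow> pid (st v) = pth v" "base st \<Longrightarrow> v \<in> V \<Longrightarrow> off (st v) = pos v"
  by (auto simp: base_def)

end

section \<open>Suffix sums along the paths\<close>

text \<open>In a dyadic block of length \<open>2 ^ Suc l\<close>, the suffix of a node in the first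
  half is the rest of that half together with the entire second half. One contraction, sharing the
  total of the second half, therefore doubles the reach of \<open>acc\<close>.\<close>

definition suffix_step :: "nat \<Rightarrow> nst step" where
  "suffix_step l = \<lparr> bcast = \<lambda>st. vl [pid st, off st div 2 ^ Suc l], reply = \<lambda>_ _ _ _. vl [],
     join = \<lambda>p c. p 0 \<noteq> 0 \<and> p 1 = c 1,
     share = \<lambda>st _. vl [if odd (off st div 2 ^ l) then xin st else 0],
     update = \<lambda>st _ S. st\<lparr>acc := acc st + (if even (off st div 2 ^ l) then S 0 else 0)\<rparr> \<rparr>"

definition suffix :: "nat \<Rightarrow> nst step list" where
  "suffix cap = local_step (\<lambda>st. st\<lparr>acc := xin st\<rparr>) # map suffix_step [0..<cap]"

lemma suffix_0: "suffix 0 = [local_step (\<lambda>st. st\<lparr>acc := xin st\<rparr>)]"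
  and suffix_Suc: "suffix (Suc cap) = suffix cap @ [suffix_step cap]"
  by (simp_all add: suffix_def)

context star_prog begin

definition blk :: "nat \<Rightarrow> node \<Rightarrow> node set" where
  "blk cap v = {u \<in> V. pth u = pth v \<and> pos u div 2 ^ cap = pos v div 2 ^ cap}"

text \<open>The range summed after \<open>cap\<close> doublings: it stops at the end of the dyadic
  block. \<open>level\<close> relies on this when it sums inside blocks only.\<close>

definition bsuf :: "nat \<Rightarrow> node \<Rightarrow> node set" where
  "bsuf cap v = {u \<in> blk cap v. pos v \<le> pos u}"

lemma blk_sub: "blk cap v \<subseteq> V" "bsuf cap v \<subseteq> V"
  by (auto simp: blk_def bsuf_def)

lemma blkD: "u \<in> blk cap v \<Longrightarrow> u \<in> V" "u \<in> bsuf cap v \<Longrightarrow> u \<in> V"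
  by (auto simp: blk_def bsuf_def)

lemma supernode_blk:
  assumes "\<And>p c. par p c \<Longrightarrow> join s (sent L s st p) (sent L s st c) \<longleftrightarrow> p \<noteq> r \<and> pos p div 2 ^ l = pos c div 2 ^ l"
    and "v \<in> V"
  shows "supernode (joined N L s st) v = blk l v"
  unfolding blk_def by (rule supernode_lab) (use assms in \<open>auto intro: div_le_mono\<close>)

lemma div_pow_width: "v \<in> V \<Longrightarrow> pos v div 2 ^ l < 2 ^ n"
  using pos_less[of v] by (intro small_width) (meson div_le_dividend le_trans less_imp_le)

lemma suffix_exec:
  assumes b: "base st" and x: "\<And>v. v \<in> V \<Longrightarrow> xin (st v) \<le> 2 ^ (4 * L)" and v: "v \<in> V"
  shows "exec N L (suffix_step l) st v = (st v)\<lparr>acc := acc (st v) +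
    (if even (pos v div 2 ^ l) then \<Sum>u | u \<in> blk (Suc l) v \<and> odd (pos u div 2 ^ l). xin (st u) else 0)\<rparr>"
proof -
  let ?s = "suffix_step l"
  have sent: "sent L ?s st v = vl [pth v, pos v div 2 ^ Suc l]" if "v \<in> V" for v
    using that b small_width pth_le div_pow_width[of v "Suc l"]
    by (intro sent_vl) (auto simp: suffix_step_def baseD)
  have K: "supernode (joined N L ?s st) v = blk (Suc l) v"
    by (rule supernode_blk[OF _ v], unfold sent[OF par_in(1)] sent[OF par_in(3)])
      (simp add: suffix_step_def par_pth del: power_Suc)
  let ?f = "\<lambda>u. share ?s (st u) (nbr_agg N L ?s st u)"
  have f: "?f u 0 = (if odd (pos u div 2 ^ l) then xin (st u) else 0)" if "u \<in> V" for u
    using that b by (simp add: suffix_step_def baseD)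
  have "(\<Sum>u\<in>blk (Suc l) v. ?f u 0) = (\<Sum>u\<in>blk (Suc l) v. if odd (pos u div 2 ^ l) then xin (st u) else 0)"
    using f by (intro sum.cong) (auto dest: blkD)
  also have "\<dots> = (\<Sum>u | u \<in> blk (Suc l) v \<and> odd (pos u div 2 ^ l). xin (st u))"
    using finite_sub[OF blk_sub(1)] by (simp add: sum.inter_filter)
  finally have eq: "(\<Sum>u\<in>blk (Suc l) v. ?f u 0) = (\<Sum>u | u \<in> blk (Suc l) v \<and> odd (pos u div 2 ^ l). xin (st u))" .
  have "(\<Sum>u | u \<in> blk (Suc l) v \<and> odd (pos u div 2 ^ l). xin (st u)) \<le> 2 ^ L * 2 ^ (4 * L)"
    using x blk_sub by (intro sum_le) auto
  also have "\<dots> = 2 ^ (5 * L + 0)" by (simp flip: power_add)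
  finally have "(\<Sum>u | u \<in> blk (Suc l) v \<and> odd (pos u div 2 ^ l). xin (st u)) < 2 ^ n" by (rule pow_width[rotated 2]) simp_all
  then have S: "vagg n ?f (blk (Suc l) v) 0 = (\<Sum>u | u \<in> blk (Suc l) v \<and> odd (pos u div 2 ^ l). xin (st u))"
    using vagg_sum[of 0 ?f "blk (Suc l) v" n] eq by simp
  show ?thesis unfolding exec_def K using S b v by (simp add: suffix_step_def baseD)
qed

lemma bsuf_Suc:
  "bsuf (Suc l) v = bsuf l v \<union> (if even (pos v div 2 ^ l) then {u \<in> blk (Suc l) v. odd (pos u div 2 ^ l)} else {})"
  "even (pos v div 2 ^ l) \<Longrightarrow> bsuf l v \<inter> {u \<in> blk (Suc l) v. odd (pos u div 2 ^ l)} = {}"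
proof -
  have D: "x div 2 ^ Suc l = y div 2 ^ Suc l \<longleftrightarrow> (x div 2 ^ l) div 2 = (y div 2 ^ l) div 2" for x y :: nat
    unfolding power_Suc2 div_mult2_eq ..
  have M: "x div 2 ^ l < y div 2 ^ l \<Longrightarrow> x \<le> y" for x y :: nat
    by (metis div_le_mono leD nat_le_linear)
  show "bsuf (Suc l) v = bsuf l v \<union> (if even (pos v div 2 ^ l) then {u \<in> blk (Suc l) v. odd (pos u div 2 ^ l)} else {})"
  proof (rule set_eqI)
    fix u
    let ?a = "pos v div 2 ^ l" and ?b = "pos u div 2 ^ l"
    have m: "pos v \<le> pos u \<Longrightarrow> ?a \<le> ?b" by (rule div_le_mono)
    have "(?b div 2 = ?a div 2 \<and> pos v \<le> pos u) \<longleftrightarrow> (?b = ?a \<and> pos v \<le> pos u) \<or> (even ?a \<and> ?b div 2 = ?a div 2 \<and> odd ?b)"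
    proof
      assume h: "?b div 2 = ?a div 2 \<and> pos v \<le> pos u"
      then have "?a \<le> ?b" using m by simp
      moreover have "b = a \<or> even a \<and> odd b" if "b div 2 = a div 2" "a \<le> b" for a b :: nat
        using that by presburger
      ultimately show "(?b = ?a \<and> pos v \<le> pos u) \<or> (even ?a \<and> ?b div 2 = ?a div 2 \<and> odd ?b)"
        using h by blast
    next
      assume "(?b = ?a \<and> pos v \<le> pos u) \<or> (even ?a \<and> ?b div 2 = ?a div 2 \<and> odd ?b)"
      then show "?b div 2 = ?a div 2 \<and> pos v \<le> pos u"
      proof
        assume h: "even ?a \<and> ?b div 2 = ?a div 2 \<and> odd ?b"
        moreover have "a < b" if "b div 2 = a div 2" "even a" "odd b" for a b :: nat
          using that by presburger
        ultimately have "?a < ?b" by blast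
        then show ?thesis using M h by blast
      qed auto
    qed
    then show "u \<in> bsuf (Suc l) v \<longleftrightarrow> u \<in> bsuf l v \<union> (if even ?a then {u \<in> blk (Suc l) v. odd (pos u div 2 ^ l)} else {})"
      unfolding bsuf_def blk_def D by auto
  qed
  show "even (pos v div 2 ^ l) \<Longrightarrow> bsuf l v \<inter> {u \<in> blk (Suc l) v. odd (pos u div 2 ^ l)} = {}"
    by (auto simp: bsuf_def blk_def)
qed

lemma suffix_run:
  assumes b: "base st" and x: "\<And>v. v \<in> V \<Longrightarrow> xin (st v) \<le> 2 ^ (4 * L)"
  shows "v \<in> V \<Longrightarrow> run N L (suffix cap) st v = (st v)\<lparr>acc := \<Sum>u\<in>bsuf cap v. xin (st u)\<rparr>"
proof (induction cap arbitrary: v)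
  case 0
  have "bsuf 0 v = {v}" using 0 V_eqI by (auto simp: bsuf_def blk_def)
  then show ?case by (simp add: suffix_0)
next
  case (Suc cap)
  let ?st = "run N L (suffix cap) st"
  have st: "?st u = (st u)\<lparr>acc := \<Sum>u\<in>bsuf cap u. xin (st u)\<rparr>" if "u \<in> V" for u
    using Suc.IH[OF that] .
  have b': "base ?st" using b st by (auto simp: base_def)
  have fin: "finite (bsuf cap v)" "finite {u \<in> blk (Suc cap) v. odd (pos u div 2 ^ cap)}"
    using finite_sub[OF blk_sub(2)[of cap v]] finite_sub[OF blk_sub(1)[of "Suc cap" v]] by simp_all
  have "exec N L (suffix_step cap) ?st v = (?st v)\<lparr>acc := acc (?st v) +
    (if even (pos v div 2 ^ cap) then \<Sum>u | u \<in> blk (Suc cap) v \<and> odd (pos u div 2 ^ cap). xin (?st u) else 0)\<rparr>"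
    by (rule suffix_exec[OF b' _ Suc.prems]) (use st x in auto)
  moreover have "(\<Sum>u | u \<in> blk (Suc cap) v \<and> odd (pos u div 2 ^ cap). xin (?st u)) =
    (\<Sum>u | u \<in> blk (Suc cap) v \<and> odd (pos u div 2 ^ cap). xin (st u))"
    using st by (intro sum.cong) (auto dest: blkD)
  moreover have "(\<Sum>u\<in>bsuf (Suc cap) v. xin (st u)) = (\<Sum>u\<in>bsuf cap v. xin (st u)) +
    (if even (pos v div 2 ^ cap) then \<Sum>u | u \<in> blk (Suc cap) v \<and> odd (pos u div 2 ^ cap). xin (st u) else 0)"
    using bsuf_Suc(1)[of cap v] bsuf_Suc(2)[of v cap] fin by (auto simp: sum.union_disjoint)
  ultimately show ?case using st[OF Suc.prems] by (simp add: suffix_Suc run_append)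
qed

text \<open>Positions are below \<open>2 ^ L\<close>, so the block of that length is the entire
  path.\<close>

lemma bsuf_full: "v \<in> V' \<Longrightarrow> bsuf L v = below v"
proof -
  have D: "x div 2 ^ L = 0" if "x < 2 ^ L" for x :: nat using that by simp
  assume "v \<in> V'"
  then show ?thesis
    using pos_less by (auto simp: bsuf_def blk_def below_def V'_pth D)
qed

end

section \<open>Path identifiers\<close>

text \<open>Only the root is not the child end of any edge, so after the first step
  \<open>pid\<close> is a flag for the other nodes. With the paths contracted, the only contribution
  comes from the top node, whose parent has flag 0, and the maximum is its name.\<close>

definition ids :: "nst step list" where
  "ids = [
    \<lparr> bcast = \<lambda>_. vl [], reply = \<lambda>w d x y. if d = 1 then vl [0, 0, 1] else vl [],
      join = \<lambda>_ _. False, share = \<lambda>_ _. vl [], update = \<lambda>st G _. st\<lparr>pid := G 2\<rparr> \<rparr>,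
    \<lparr> bcast = \<lambda>st. vl [pid st], reply = \<lambda>w d x y. if d = 1 \<and> y 0 = 0 then vl [0, 0, 1] else vl [],
      join = \<lambda>p c. p 0 \<noteq> 0, share = \<lambda>st G. if G 2 = 0 then vl [] else vl [0, 0, Suc (ident st)],
      update = \<lambda>st _ S. st\<lparr>pid := S 2, seg := Suc (ident st), off := 0\<rparr> \<rparr>]"

context star_prog begin

lemma par_root_iff: "par r v \<longleftrightarrow> v \<in> V' \<and> pos v = 0"
  by (auto simp: par_def V'_def)

lemma par_edge: "par p c \<Longrightarrow> {p, c} \<in> E" "par p c \<Longrightarrow> {c, p} \<in> E"
  using par_tree[of p c] T_sub by (auto simp: insert_commute)

lemma ids_run:
  assumes id: "\<And>v. v \<in> V \<Longrightarrow> ident (st v) = v" and v: "v \<in> V"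
  shows "run N L ids st v = (st v)\<lparr>pid := pth v, seg := Suc v, off := 0\<rparr>"
proof -
  let ?s1 = "ids ! 0" and ?s2 = "ids ! 1"
  let ?st = "exec N L ?s1 st"
  have 1: "?st v = (st v)\<lparr>pid := (if v = r then 0 else 1)\<rparr>" if v: "v \<in> V" for v
  proof -
    have "nbr_agg N L ?s1 st v 2 = (if v = r then 0 else 1)"
    proof (rule nbr_agg_max[OF v])
      show "(if v = r then 0 else 1 :: nat) < 2 ^ n" by (auto intro!: small_width)
      have nr: "\<not> par u r" for u by (auto simp: par_def V'_def)
      show "reply ?s1 (weight N {v, u}) (direction (edge_input_of N {v, u}) v) (sent L ?s1 st v) (sent L ?s1 st u) 2
        \<le> (if v = r then 0 else 1)" if "{v, u} \<in> E" for u
        using nr by (auto simp: ids_def direction_eq[OF that])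
      show "(if v = r then 0 else 1) = (0::nat) \<or> (\<exists>u. {v, u} \<in> E \<and>
        reply ?s1 (weight N {v, u}) (direction (edge_input_of N {v, u}) v) (sent L ?s1 st v) (sent L ?s1 st u) 2 = (if v = r then 0 else 1))"
      proof (cases "v = r")
        case False
        then obtain u where u: "par u v" using par_exists v by (auto simp: V'_def)
        then have "{v, u} \<in> E" by (rule par_edge)
        then show ?thesis using u False by (intro disjI2 exI[of _ u]) (auto simp: ids_def direction_eq)
      qed simp
    qed auto
    then show ?thesis by (simp add: exec_def ids_def)
  qed
  have sent: "sent L ?s2 ?st v = vl [if v = r then 0 else 1]" if "v \<in> V" for v
    using 1[OF that] by (intro sent_vl) (auto simp: ids_def intro!: small_width)
  have K: "supernode (joined N L ?s2 ?st) v = {u \<in> V. pth u = pth v}" if "v \<in> V" for v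
    by (rule supernode_path[OF _ that], unfold sent[OF par_in(1)] sent[OF par_in(3)]) (simp add: ids_def)
  have G: "nbr_agg N L ?s2 ?st v 2 = (if par r v then 1 else 0)" if v: "v \<in> V" for v
  proof (rule nbr_agg_max[OF v])
    show "(if par r v then 1 else 0 :: nat) < 2 ^ n" by (auto intro!: small_width)
    show "reply ?s2 (weight N {v, u}) (direction (edge_input_of N {v, u}) v) (sent L ?s2 ?st v) (sent L ?s2 ?st u) 2
        \<le> (if par r v then 1 else 0)" if "{v, u} \<in> E" for u
      using edge_in[OF that] by (auto simp: ids_def direction_eq[OF that] sent[unfolded ids_def, simplified])
    show "(if par r v then 1 else 0) = (0::nat) \<or> (\<exists>u. {v, u} \<in> E \<and>
        reply ?s2 (weight N {v, u}) (direction (edge_input_of N {v, u}) v) (sent L ?s2 ?st v) (sent L ?s2 ?st u) 2 = (if par r v then 1 else 0))"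
    proof (cases "par r v")
      case True
      then have "{v, r} \<in> E" by (rule par_edge)
      then show ?thesis using True sent[OF root_in] by (intro disjI2 exI[of _ r]) (auto simp: ids_def direction_eq)
    qed simp
  qed auto
  let ?f = "\<lambda>u. share ?s2 (?st u) (nbr_agg N L ?s2 ?st u)"
  have f: "?f u 2 = (if par r u then Suc u else 0)" if "u \<in> V" for u
    using G[OF that] 1[OF that] id[OF that] by (simp add: ids_def)
  have "vagg n ?f {u \<in> V. pth u = pth v} 2 = pth v"
  proof (rule vagg_max_eqI)
    show "pth v < 2 ^ n" using v pth_le small_width by blast
    show "finite {u \<in> V. pth u = pth v}" using finite_V by simp
    show "?f u 2 \<le> pth v" if "u \<in> {u \<in> V. pth u = pth v}" for u
      using that f[of u] pos_0_pth[of u] by (auto simp: par_root_iff)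
    show "pth v = 0 \<or> (\<exists>u\<in>{u \<in> V. pth u = pth v}. ?f u 2 = pth v)"
    proof (cases "v = r")
      case False
      then obtain u where u: "u \<in> V'" "pth u = pth v" "pos u = 0" using V'_up[of v 0] v by (auto simp: V'_def)
      then have "u \<in> V" "par r u" by (auto simp: par_root_iff V'_def)
      then show ?thesis using u f[of u] pos_0_pth[of u] by auto
    qed simp
  qed auto
  moreover have "run N L ids st = exec N L ?s2 ?st" by (simp add: ids_def)
  moreover have "update ?s2 x G S = x\<lparr>pid := S 2, seg := Suc (ident x), off := 0\<rparr>" for x G S
    by (simp add: ids_def)
  ultimately have "run N L ids st v = (?st v)\<lparr>pid := pth v, seg := Suc (ident (?st v)), off := 0\<rparr>"
    by (simp only: exec_def[of N L ?s2] K[OF v])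
  then show ?thesis unfolding 1[OF v] using id[OF v] by simp
qed

end

section \<open>Positions\<close>

text \<open>Each path is divided into segments, which are merged in pairs. Initially all segments are
  single nodes. A node stores the identifier of the top of its segment and its offset from the top.\<close>

definition sel_edge :: "(vec \<Rightarrow> vec \<Rightarrow> bool) \<Rightarrow> vec \<Rightarrow> vec \<Rightarrow> bool" where
  "sel_edge sel p c \<longleftrightarrow> p 0 \<noteq> 0 \<and> p 1 \<noteq> c 1 \<and> sel p c"

text \<open>The neighbour replies flag the last node of an upper segment in field 2 and the first
  node of a lower one in field 3. The former publishes the length of its segment
  (\<open>Suc (off st)\<close>) and its name, the latter the name of the lower segment, by which
  nodes recognise on which side they are. Names are successors, so 0 means that nothing was
  merged.\<close>

definition merge :: "(vec \<Rightarrow> vec \<Rightarrow> bool) \<Rightarrow> nst step" where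
  "merge sel = \<lparr> bcast = \<lambda>st. vl [pid st, seg st, mk st],
     reply = \<lambda>w d x y. if d = 1 \<and> sel_edge sel y x then vl [0, 0, 0, 1]
       else if d = 2 \<and> sel_edge sel x y then vl [0, 0, 1] else vl [],
     join = \<lambda>p c. p 0 \<noteq> 0 \<and> p 1 = c 1 \<or> sel_edge sel p c,
     share = \<lambda>st G. vl [0, 0, if G 2 = 0 then 0 else Suc (off st), if G 2 = 0 then 0 else seg st,
       if G 3 = 0 then 0 else seg st],
     update = \<lambda>st _ S. if S 4 = 0 then st
       else if seg st = S 4 then st\<lparr>off := off st + S 2, seg := S 3, mk := 1\<rparr> else st\<lparr>mk := 1\<rparr> \<rparr>"

lemma merge_simps:
  "bcast (merge sel) st = vl [pid st, seg st, mk st]"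
  "reply (merge sel) w d x y = (if d = 1 \<and> sel_edge sel y x then vl [0, 0, 0, 1]
       else if d = 2 \<and> sel_edge sel x y then vl [0, 0, 1] else vl [])"
  "join (merge sel) p c \<longleftrightarrow> p 0 \<noteq> 0 \<and> p 1 = c 1 \<or> sel_edge sel p c"
  "share (merge sel) st G = vl [0, 0, if G 2 = 0 then 0 else Suc (off st), if G 2 = 0 then 0 else seg st,
       if G 3 = 0 then 0 else seg st]"
  "update (merge sel) st G S = (if S 4 = 0 then st
       else if seg st = S 4 then st\<lparr>off := off st + S 2, seg := S 3, mk := 1\<rparr> else st\<lparr>mk := 1\<rparr>)"
  by (simp_all add: merge_def)

context star_prog begin

text \<open>\<open>tp v\<close> is the position of the top of the segment of \<open>v\<close>.\<close>

definition segs :: "(node \<Rightarrow> nst) \<Rightarrow> (node \<Rightarrow> nat) \<Rightarrow> bool" where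
  "segs st tp \<longleftrightarrow>
     (\<forall>v\<in>V. pid (st v) = pth v \<and> tp v \<le> pos v \<and> off (st v) = pos v - tp v \<and> mk (st v) \<le> 1) \<and>
     (\<forall>u\<in>V. \<forall>v\<in>V. pth u = pth v \<longrightarrow> pos u \<le> pos v \<longrightarrow> tp v \<le> pos u \<longrightarrow> tp u = tp v) \<and>
     (\<forall>u\<in>V. \<forall>v\<in>V. pth u = pth v \<longrightarrow> pos u = tp v \<longrightarrow> seg (st v) = Suc u) \<and>
     (\<forall>u\<in>V. \<forall>v\<in>V. pth u = pth v \<longrightarrow> tp u = tp v \<longrightarrow> mk (st u) = mk (st v))"

lemma node_at:
  assumes "v \<in> V" "k \<le> pos v"
  obtains u where "u \<in> V" "pth u = pth v" "pos u = k"
proof (cases "v = r")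
  case True
  then show thesis using that[of r] assms by auto
next
  case False
  then have "v \<in> V'" using assms by (simp add: V'_def)
  then obtain u where "u \<in> V'" "pth u = pth v" "pos u = k" using V'_up assms(2) by blast
  then show thesis using that by (auto simp: V'_def)
qed

lemma segsD:
  assumes "segs st tp"
  shows "v \<in> V \<Longrightarrow> pid (st v) = pth v" "v \<in> V \<Longrightarrow> tp v \<le> pos v" "v \<in> V \<Longrightarrow> off (st v) = pos v - tp v"
    "v \<in> V \<Longrightarrow> mk (st v) \<le> 1"
    "u \<in> V \<Longrightarrow> v \<in> V \<Longrightarrow> pth u = pth v \<Longrightarrow> pos u \<le> pos v \<Longrightarrow> tp v \<le> pos u \<Longrightarrow> tp u = tp v"
    "u \<in> V \<Longrightarrow> v \<in> V \<Longrightarrow> pth u = pth v \<Longrightarrow> pos u = tp v \<Longrightarrow> seg (st v) = Suc u"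
    "u \<in> V \<Longrightarrow> v \<in> V \<Longrightarrow> pth u = pth v \<Longrightarrow> tp u = tp v \<Longrightarrow> mk (st u) = mk (st v)"
  using assms unfolding segs_def by blast+

lemma segs_seg_eq:
  assumes "segs st tp" "u \<in> V" "v \<in> V" "pth u = pth v"
  shows "seg (st u) = seg (st v) \<longleftrightarrow> tp u = tp v"
proof -
  obtain a where a: "a \<in> V" "pth a = pth u" "pos a = tp u" using node_at[OF assms(2) segsD(2)[OF assms(1,2)]] .
  obtain b where b: "b \<in> V" "pth b = pth v" "pos b = tp v" using node_at[OF assms(3) segsD(2)[OF assms(1,3)]] .
  have "seg (st u) = Suc a" "seg (st v) = Suc b"
    using segsD(6)[OF assms(1)] a b assms by auto
  moreover have "a = b \<longleftrightarrow> tp u = tp v" using a b assms(4) V_eqI by auto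
  ultimately show ?thesis by simp
qed

lemma segs_seg_le:
  assumes "segs st tp" "v \<in> V" shows "seg (st v) \<le> 2 ^ L"
proof -
  obtain a where a: "a \<in> V" "pth a = pth v" "pos a = tp v" using node_at[OF assms(2) segsD(2)[OF assms]] .
  then show ?thesis using segsD(6)[OF assms(1) a(1) assms(2)] node_less[of a] by simp
qed

lemma par_nonroot: "par p c \<Longrightarrow> p \<noteq> r \<Longrightarrow> p \<in> V' \<and> c \<in> V' \<and> pth p = pth c \<and> pos c = Suc (pos p)"
  by (auto simp: par_def split: if_splits)

definition bdry :: "(node \<Rightarrow> nat) \<Rightarrow> node \<Rightarrow> node \<Rightarrow> bool" where
  "bdry tp p c \<longleftrightarrow> par p c \<and> p \<noteq> r \<and> tp p \<noteq> tp c"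

lemma bdryD:
  assumes "segs st tp" "bdry tp p c"
  shows "p \<in> V" "c \<in> V" "pth p = pth c" "pos c = Suc (pos p)" "tp c = pos c" "tp p \<le> pos p" "c \<in> V'"
proof -
  from assms(2) have pc: "par p c" "p \<noteq> r" "tp p \<noteq> tp c" by (auto simp: bdry_def)
  from par_nonroot[OF pc(1,2)] show 1: "p \<in> V" "c \<in> V" "pth p = pth c" "pos c = Suc (pos p)" "c \<in> V'"
    by (auto simp: V'_def)
  show "tp p \<le> pos p" using segsD(2)[OF assms(1) 1(1)] .
  have "tp c \<le> pos c" using segsD(2)[OF assms(1) 1(2)] .
  moreover have "\<not> tp c \<le> pos p" using segsD(5)[OF assms(1) 1(1,2,3)] 1(4) pc(3) by auto
  ultimately show "tp c = pos c" using 1(4) by linarith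
qed

lemma bdry_between:
  assumes "segs st tp" "u \<in> V" "v \<in> V" "pth u = pth v" "pos u < pos v" "tp u \<noteq> tp v"
  obtains p c where "bdry tp p c" "pth c = pth v" "tp c = tp v"
proof -
  have t: "pos u < tp v" using segsD(5)[OF assms(1-4)] assms(5,6) by force
  obtain c where c: "c \<in> V" "pth c = pth v" "pos c = tp v" using node_at[OF assms(3) segsD(2)[OF assms(1,3)]] .
  have tc: "tp c = tp v" using segsD(5)[OF assms(1) c(1) assms(3) c(2)] c(3) segsD(2)[OF assms(1,3)] by simp
  have "c \<noteq> r" using c(3) t by auto
  then have "c \<in> V'" using c by (simp add: V'_def)
  then obtain p where p: "par p c" using par_exists by blast
  then have p': "p \<in> V'" "pth p = pth c" "pos c = Suc (pos p)" using c(3) t by (auto simp: par_def split: if_splits)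
  then have "tp p \<noteq> tp c" using segsD(2)[OF assms(1), of p] tc c(3) by (auto simp: V'_def)
  then show thesis using that[of p c] p p' c tc by (auto simp: bdry_def V'_def)
qed

definition merged :: "(node \<Rightarrow> nat) \<Rightarrow> (node \<Rightarrow> node \<Rightarrow> bool) \<Rightarrow> node \<Rightarrow> nat" where
  "merged tp Sel v = (if \<exists>p c. bdry tp p c \<and> Sel p c \<and> pth c = pth v \<and> tp c = tp v
     then tp (SOME p. \<exists>c. bdry tp p c \<and> Sel p c \<and> pth c = pth v \<and> tp c = tp v) else tp v)"

end

text \<open>\<open>nonadj\<close> forbids chains: no segment is the lower side of one selected
  boundary and the upper side of another. So a merge involves exactly two segments and a single
  contraction can carry it out.\<close>

locale merging = star_prog +
  fixes st :: "node \<Rightarrow> nst" and tp :: "node \<Rightarrow> nat" and Sel :: "node \<Rightarrow> node \<Rightarrow> bool"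
    and sel :: "vec \<Rightarrow> vec \<Rightarrow> bool"
  assumes S: "segs st tp"
    and Sel: "\<And>p c. bdry tp p c \<Longrightarrow> Sel p c \<longleftrightarrow>
      sel (vl [pth p, seg (st p), mk (st p)]) (vl [pth c, seg (st c), mk (st c)])"
    and nonadj: "\<And>p c p' c'. bdry tp p c \<Longrightarrow> bdry tp p' c' \<Longrightarrow> Sel p c \<Longrightarrow> Sel p' c' \<Longrightarrow>
      pth p' = pth c \<Longrightarrow> tp p' = tp c \<Longrightarrow> False"
begin

abbreviation "tp' \<equiv> merged tp Sel"

lemma bdry_tp_unique:
  assumes "bdry tp p c" "bdry tp p' c'" "pth c = pth c'"
  shows "tp c = tp c' \<Longrightarrow> p = p' \<and> c = c'" "tp p = tp p' \<Longrightarrow> p = p' \<and> c = c'"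
proof -
  note a = bdryD[OF S assms(1)] and b = bdryD[OF S assms(2)]
  have A: "p = p' \<and> c = c'" if "pos c = pos c'" using that a b assms(3) V_eqI by auto
  show "tp c = tp c' \<Longrightarrow> p = p' \<and> c = c'" using A a(5) b(5) by simp
  assume e: "tp p = tp p'"
  have "\<not> pos c < pos c'" 
  proof
    assume "pos c < pos c'"
    then have "tp c = tp p'" using segsD(5)[OF S, of c p'] a b e assms(3) by simp
    then show False using a e by simp
  qed
  moreover have "\<not> pos c' < pos c"
  proof
    assume "pos c' < pos c"
    then have "tp c' = tp p" using segsD(5)[OF S, of c' p] a b e assms(3) by simp
    then show False using b e by simp
  qed
  ultimately show "p = p' \<and> c = c'" using A by simp
qed

lemma merged_cong: "pth u = pth v \<Longrightarrow> tp u = tp v \<Longrightarrow> tp' u = tp' v"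
  by (simp only: merged_def)

lemma merged_lower:
  assumes "bdry tp p c" "Sel p c" "pth c = pth v" "tp c = tp v"
  shows "tp' v = tp p"
proof -
  have "(SOME p. \<exists>c. bdry tp p c \<and> Sel p c \<and> pth c = pth v \<and> tp c = tp v) = p"
  proof (rule some_equality)
    fix q assume "\<exists>c. bdry tp q c \<and> Sel q c \<and> pth c = pth v \<and> tp c = tp v"
    then obtain d where "bdry tp q d" "pth d = pth v" "tp d = tp v" by blast
    then show "q = p" using bdry_tp_unique(1)[of q d p c] assms by simp
  qed (use assms in blast)
  moreover have "\<exists>p c. bdry tp p c \<and> Sel p c \<and> pth c = pth v \<and> tp c = tp v" using assms by blast
  ultimately show ?thesis by (simp only: merged_def if_True)
qed

lemma merged_other:
  assumes "\<And>p c. bdry tp p c \<Longrightarrow> Sel p c \<Longrightarrow> pth c = pth v \<Longrightarrow> tp c \<noteq> tp v"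
  shows "tp' v = tp v"
  using assms unfolding merged_def by metis

lemma merged_upper:
  assumes "bdry tp p c" "Sel p c" "pth p = pth v" "tp p = tp v"
  shows "tp' v = tp v"
  by (rule merged_other) (use nonadj assms in metis)

lemma merged_cases:
  obtains (lower) p c where "bdry tp p c" "Sel p c" "pth c = pth v" "tp c = tp v" "tp' v = tp p"
  | (other) "\<And>p c. bdry tp p c \<Longrightarrow> Sel p c \<Longrightarrow> pth c = pth v \<Longrightarrow> tp c \<noteq> tp v" "tp' v = tp v"
  using merged_lower merged_other by metis

lemma merged_le: "v \<in> V \<Longrightarrow> tp' v \<le> tp v"
proof (cases v rule: merged_cases)
  case (lower p c)
  then show ?thesis using bdryD[OF S lower(1)] by simp
qed simp

lemma merged_interval:
  assumes "u \<in> V" "v \<in> V" "pth u = pth v" "pos u \<le> pos v" "tp' v \<le> pos u"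
  shows "tp' u = tp' v"
proof (cases "tp v \<le> pos u")
  case True
  then have "tp u = tp v" using segsD(5)[OF S assms(1-4)] by simp
  then show ?thesis by (rule merged_cong[OF assms(3)])
next
  case False
  show ?thesis
  proof (cases v rule: merged_cases)
    case (lower p c)
    note b = bdryD[OF S lower(1)]
    have "pos u \<le> pos p" using False lower b by simp
    then have "tp u = tp p" using segsD(5)[OF S assms(1) b(1)] assms(3,5) lower b(3) by simp
    moreover have "tp' u = tp u" by (rule merged_upper[OF lower(1,2)]) (use calculation lower b assms(3) in auto)
    ultimately show ?thesis using lower(5) by simp
  next
    case other
    then show ?thesis using False assms(5) by simp
  qed
qed

text \<open>The tops of the merged segments are the labels with which \<open>supernode_lab\<close>
  describes the contraction performed by \<open>merge\<close>.\<close>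

lemma merged_join:
  assumes "par p c" "p \<noteq> r"
  shows "tp' p = tp' c \<longleftrightarrow> tp p = tp c \<or> bdry tp p c \<and> Sel p c"
proof -
  have pc: "p \<in> V" "c \<in> V" "pth p = pth c" "pos c = Suc (pos p)" using par_nonroot[OF assms] by (auto simp: V'_def)
  show ?thesis
  proof (cases "tp p = tp c")
    case True
    then show ?thesis using merged_cong[OF pc(3) True] by simp
  next
    case False
    then have b: "bdry tp p c" using assms by (simp add: bdry_def)
    show ?thesis
    proof (cases "Sel p c")
      case True
      then have "tp' c = tp p" "tp' p = tp p" using merged_lower[OF b] merged_upper[OF b, of p] by auto
      then show ?thesis using True b by simp
    next
      case nS: False
      have "tp' c = tp c"
        by (rule merged_other) (use bdry_tp_unique(1)[OF _ b] nS in metis)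
      moreover have "tp' p \<le> pos p" using merged_le[OF pc(1)] segsD(2)[OF S pc(1)] by simp
      ultimately show ?thesis using False nS bdryD[OF S b] by auto
    qed
  qed
qed

text \<open>In a merged segment each of the three shared fields has one possible contributor, the
  node on the relevant side of the selected boundary. The maximum thus acts as a broadcast.\<close>

lemma merge_exec:
  assumes v: "v \<in> V"
  shows "(\<forall>p c. bdry tp p c \<longrightarrow> Sel p c \<longrightarrow> pth c = pth v \<longrightarrow> tp p \<noteq> tp' v) \<Longrightarrow> exec N L (merge sel) st v = st v"
    and "bdry tp p c \<Longrightarrow> Sel p c \<Longrightarrow> pth c = pth v \<Longrightarrow> tp p = tp' v \<Longrightarrow>
      exec N L (merge sel) st v = (if tp v = tp c then (st v)\<lparr>off := pos v - tp p, seg := seg (st p), mk := 1\<rparr>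
        else (st v)\<lparr>mk := 1\<rparr>)"
proof -
  let ?s = "merge sel"
  have sent: "sent L ?s st v = vl [pth v, seg (st v), mk (st v)]" if "v \<in> V" for v
  proof (rule sent_vl)
    have "mk (st v) \<le> 2 ^ L" using segsD(4)[OF S that] by (meson le_trans one_le_numeral one_le_power)
    then show "\<forall>x\<in>set [pth v, seg (st v), mk (st v)]. x < 2 ^ width L"
      using small_width pth_le[OF that] segs_seg_le[OF S that] by auto
  qed (use segsD(1)[OF S that] in \<open>auto simp: merge_def\<close>)
  have se: "sel_edge sel (sent L ?s st p) (sent L ?s st c) \<longleftrightarrow> bdry tp p c \<and> Sel p c" if "par p c" for p c
  proof -
    have pc: "p \<in> V" "c \<in> V" using par_in that by auto
    show ?thesis
    proof (cases "p = r")
      case True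
      then show ?thesis using sent[OF root_in] by (simp add: sel_edge_def bdry_def)
    next
      case False
      have "seg (st p) = seg (st c) \<longleftrightarrow> tp p = tp c"
        using segs_seg_eq[OF S pc] par_nonroot[OF that False] by simp
      moreover have "pth p \<noteq> 0" using par_pth that False by simp
      ultimately show ?thesis using that False Sel[of p c]
        by (auto simp: sel_edge_def sent[OF pc(1)] sent[OF pc(2)] bdry_def)
    qed
  qed
  have K: "supernode (joined N L ?s st) v = {u \<in> V. pth u = pth v \<and> tp' u = tp' v}"
  proof (rule supernode_lab[OF _ _ v])
    show "tp' u \<le> tp' w" if "u \<in> V'" "w \<in> V'" "pth u = pth w" "pos u \<le> pos w" for u w
    proof -
      have V: "u \<in> V" "w \<in> V" using that by (auto simp: V'_def)
      show ?thesis
      proof (cases "tp' w \<le> pos u")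
        case True
        then show ?thesis using merged_interval[OF V] that by simp
      next
        case False
        then show ?thesis using merged_le[OF V(1)] segsD(2)[OF S V(1)] by simp
      qed
    qed
    show "join ?s (sent L ?s st p) (sent L ?s st c) \<longleftrightarrow> p \<noteq> r \<and> tp' p = tp' c" if "par p c" for p c
    proof -
      have pc: "p \<in> V" "c \<in> V" using par_in that by auto
      have J: "join ?s (sent L ?s st p) (sent L ?s st c) \<longleftrightarrow>
        p \<noteq> r \<and> seg (st p) = seg (st c) \<or> bdry tp p c \<and> Sel p c"
        using se[OF that] par_pth[OF that] by (simp add: merge_simps sent pc)
      show ?thesis
      proof (cases "p = r")
        case False
        have "seg (st p) = seg (st c) \<longleftrightarrow> tp p = tp c"
          using segs_seg_eq[OF S pc] par_nonroot[OF that False] by simp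
        then show ?thesis using J False merged_join[OF that False] by simp
      qed (use J in \<open>simp add: bdry_def\<close>)
    qed
  qed
  let ?G = "nbr_agg N L ?s st"
  have asym: "\<not> (par u w \<and> par w u)" for u w
    using child_iff[of u w] child_iff[of w u] by (auto simp: child_of_def)
  have bE: "{p, c} \<in> E" if "bdry tp p c" for p c using that par_edge by (simp add: bdry_def)
  have bP: "par p c" if "bdry tp p c" for p c using that by (simp add: bdry_def)
  have R: "reply ?s (weight N {w, u}) (direction (edge_input_of N {w, u}) w) (sent L ?s st w) (sent L ?s st u) =
     (if bdry tp u w \<and> Sel u w then vl [0, 0, 0, 1] else if bdry tp w u \<and> Sel w u then vl [0, 0, 1] else vl [])"
    if "{w, u} \<in> E" for u w
    unfolding direction_eq[OF that] using se[of u w] se[of w u] asym[of u w] bP[of u w] bP[of w u]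
    by (auto simp: merge_simps)
  have G2: "?G w 2 = (if \<exists>c. bdry tp w c \<and> Sel w c then 1 else 0)" if w: "w \<in> V" for w
  proof (rule nbr_agg_max[OF w])
    show "(if \<exists>c. bdry tp w c \<and> Sel w c then 1 else 0 :: nat) < 2 ^ n" by (auto intro!: small_width)
    show "(if \<exists>c. bdry tp w c \<and> Sel w c then 1 else 0) = (0::nat) \<or> (\<exists>u. {w, u} \<in> E \<and>
      reply ?s (weight N {w, u}) (direction (edge_input_of N {w, u}) w) (sent L ?s st w) (sent L ?s st u) 2 =
      (if \<exists>c. bdry tp w c \<and> Sel w c then 1 else 0))"
    proof (cases "\<exists>c. bdry tp w c \<and> Sel w c")
      case True
      then obtain c where c: "bdry tp w c" "Sel w c" by blast
      then have "\<not> bdry tp c w" using asym bP by blast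
      then show ?thesis using c R[OF bE[OF c(1)]] bE[OF c(1)] by (intro disjI2 exI[of _ c]) auto
    next
      case False
      then show ?thesis unfolding if_not_P[OF False] by blast
    qed
  qed (auto simp: R)
  have G3: "?G w 3 = (if \<exists>p. bdry tp p w \<and> Sel p w then 1 else 0)" if w: "w \<in> V" for w
  proof (rule nbr_agg_max[OF w])
    show "(if \<exists>p. bdry tp p w \<and> Sel p w then 1 else 0 :: nat) < 2 ^ n" by (auto intro!: small_width)
    show "(if \<exists>p. bdry tp p w \<and> Sel p w then 1 else 0) = (0::nat) \<or> (\<exists>u. {w, u} \<in> E \<and>
      reply ?s (weight N {w, u}) (direction (edge_input_of N {w, u}) w) (sent L ?s st w) (sent L ?s st u) 3 =
      (if \<exists>p. bdry tp p w \<and> Sel p w then 1 else 0))"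
    proof (cases "\<exists>p. bdry tp p w \<and> Sel p w")
      case True
      then obtain p where p: "bdry tp p w" "Sel p w" by blast
      have e: "{w, p} \<in> E" using bE[OF p(1)] by (simp add: insert_commute)
      then show ?thesis using p R[OF e] by (intro disjI2 exI[of _ p]) auto
    next
      case False
      then show ?thesis unfolding if_not_P[OF False] by blast
    qed
  qed (auto simp: R)
  let ?K = "{u \<in> V. pth u = pth v \<and> tp' u = tp' v}"
  let ?f = "\<lambda>u. share ?s (st u) (?G u)"
  have f: "?f u 2 = (if \<exists>c. bdry tp u c \<and> Sel u c then Suc (off (st u)) else 0)"
     "?f u 3 = (if \<exists>c. bdry tp u c \<and> Sel u c then seg (st u) else 0)"
     "?f u 4 = (if \<exists>p. bdry tp p u \<and> Sel p u then seg (st u) else 0)" if "u \<in> V" for u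
    by (auto simp: merge_simps G2[OF that] G3[OF that])
  have fin: "finite ?K" using finite_V by simp
  have low: "tp' c = tp p" "tp' p = tp p" "pth p = pth c" if "bdry tp p c" "Sel p c" for p c
    using merged_lower[OF that] merged_upper[OF that] bdryD(3)[OF S that(1)] by auto
  have ex: "exec N L ?s st v = (if vagg n ?f ?K 4 = 0 then st v
       else if seg (st v) = vagg n ?f ?K 4 then (st v)\<lparr>off := off (st v) + vagg n ?f ?K 2, seg := vagg n ?f ?K 3, mk := 1\<rparr>
       else (st v)\<lparr>mk := 1\<rparr>)"
    unfolding exec_def K by (simp only: merge_simps)
  {
    assume none: "\<forall>p c. bdry tp p c \<longrightarrow> Sel p c \<longrightarrow> pth c = pth v \<longrightarrow> tp p \<noteq> tp' v"
    have "vagg n ?f ?K 4 = 0"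
      by (rule vagg_max_eqI) (use fin f(3) none low in auto)
    then show "exec N L ?s st v = st v" using ex by simp
  }
  {
    assume pc: "bdry tp p c" "Sel p c" "pth c = pth v" "tp p = tp' v"
    note b = bdryD[OF S pc(1)]
    have cK: "c \<in> ?K" "p \<in> ?K" using b pc low[OF pc(1,2)] by auto
    have u1: "u = c" if "u \<in> ?K" "bdry tp q u" "Sel q u" for u q
      using bdry_tp_unique(2)[OF that(2) pc(1)] that pc low[OF that(2,3)] by auto
    have u2: "u = p" if "u \<in> ?K" "bdry tp u q" "Sel u q" for u q
      using bdry_tp_unique(2)[OF that(2) pc(1)] that pc low[OF that(2,3)] by auto
    have segc: "seg (st c) = Suc c" using segsD(6)[OF S b(2,2)] b by simp
    have S4: "vagg n ?f ?K 4 = seg (st c)"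
    proof (rule vagg_max_eqI[OF _ _ fin])
      show "?f u 4 \<le> seg (st c)" if "u \<in> ?K" for u using that f(3) u1[OF that] by auto
      show "seg (st c) < 2 ^ n" using small_width segs_seg_le[OF S b(2)] by simp
      have "\<exists>p. bdry tp p c \<and> Sel p c" using pc by blast
      then show "seg (st c) = 0 \<or> (\<exists>u\<in>?K. ?f u 4 = seg (st c))" using cK(1) f(3)[OF b(2)] by (intro disjI2 bexI[of _ c]) auto
    qed auto
    have S3: "vagg n ?f ?K 3 = seg (st p)"
    proof (rule vagg_max_eqI[OF _ _ fin])
      show "?f u 3 \<le> seg (st p)" if "u \<in> ?K" for u using that f(2) u2[OF that] by auto
      show "seg (st p) < 2 ^ n" using small_width segs_seg_le[OF S b(1)] by simp
      have "\<exists>c. bdry tp p c \<and> Sel p c" using pc by blast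
      then show "seg (st p) = 0 \<or> (\<exists>u\<in>?K. ?f u 3 = seg (st p))" using cK(2) f(2)[OF b(1)] by (intro disjI2 bexI[of _ p]) auto
    qed auto
    have S2: "vagg n ?f ?K 2 = Suc (off (st p))"
    proof (rule vagg_max_eqI[OF _ _ fin])
      show "?f u 2 \<le> Suc (off (st p))" if "u \<in> ?K" for u using that f(1) u2[OF that] by auto
      have "Suc (off (st p)) \<le> 2 ^ L" using segsD(3)[OF S b(1)] pos_less[OF b(1)] by simp
      then show "Suc (off (st p)) < 2 ^ n" by (rule small_width)
      have "\<exists>c. bdry tp p c \<and> Sel p c" using pc by blast
      then show "Suc (off (st p)) = 0 \<or> (\<exists>u\<in>?K. ?f u 2 = Suc (off (st p)))" using cK(2) f(1)[OF b(1)] by (intro disjI2 bexI[of _ p]) auto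
    qed auto
    have "seg (st v) = seg (st c) \<longleftrightarrow> tp v = tp c" using segs_seg_eq[OF S v b(2)] pc by simp
    moreover have "off (st v) + Suc (off (st p)) = pos v - tp p" if "tp v = tp c"
      using that b segsD(3)[OF S v] segsD(3)[OF S b(1)] segsD(2)[OF S v] by simp
    ultimately show "exec N L ?s st v = (if tp v = tp c then (st v)\<lparr>off := pos v - tp p, seg := seg (st p), mk := 1\<rparr>
        else (st v)\<lparr>mk := 1\<rparr>)"
      unfolding ex S4 S3 S2 segc by simp
  }
qed

lemma merged_not_lower:
  assumes "v \<in> V" "bdry tp p c" "Sel p c" "pth c = pth v" "tp p = tp' v" "tp v \<noteq> tp c"
  shows "tp v = tp' v"
proof (cases v rule: merged_cases)
  case (lower q d)
  have "q = p \<and> d = c" by (rule bdry_tp_unique(2)) (use lower assms in auto)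
  then show ?thesis using lower assms by simp
qed simp

text \<open>An unmarked segment is untouched, name and top included. This lets statements about
  pairs of unmarked segments survive later merges.\<close>

lemma merge_run:
  shows "segs (exec N L (merge sel) st) tp'"
    and "v \<in> V \<Longrightarrow> mk (exec N L (merge sel) st v) = 0 \<Longrightarrow>
      mk (st v) = 0 \<and> seg (exec N L (merge sel) st v) = seg (st v) \<and> tp' v = tp v"
    and "bdry tp p c \<Longrightarrow> Sel p c \<Longrightarrow> mk (exec N L (merge sel) st p) = 1 \<and> mk (exec N L (merge sel) st c) = 1"
    and "v \<in> V \<Longrightarrow> mk (exec N L (merge sel) st v) = mk (st v) \<and> tp' v = tp v \<or>
      (\<exists>p c. bdry tp p c \<and> Sel p c \<and> pth c = pth v \<and> tp' v = tp p \<and> mk (exec N L (merge sel) st v) = 1)"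
proof -
  let ?e = "exec N L (merge sel) st"
  have cs: "?e v = st v \<and> tp' v = tp v \<and> (\<forall>p c. bdry tp p c \<longrightarrow> Sel p c \<longrightarrow> pth c = pth v \<longrightarrow> tp p \<noteq> tp' v) \<or>
    (\<exists>p c. bdry tp p c \<and> Sel p c \<and> pth c = pth v \<and> tp p = tp' v \<and>
      (tp v = tp c \<and> ?e v = (st v)\<lparr>off := pos v - tp p, seg := seg (st p), mk := 1\<rparr> \<or>
       tp v \<noteq> tp c \<and> tp v = tp' v \<and> ?e v = (st v)\<lparr>mk := 1\<rparr>))" if v: "v \<in> V" for v
  proof (cases "\<exists>p c. bdry tp p c \<and> Sel p c \<and> pth c = pth v \<and> tp p = tp' v")
    case True
    then obtain p c where pc: "bdry tp p c" "Sel p c" "pth c = pth v" "tp p = tp' v" by blast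
    show ?thesis using merge_exec(2)[OF v pc] pc merged_not_lower[OF v pc]
      by (intro disjI2 exI[of _ p] exI[of _ c]) auto
  next
    case False
    have "tp' v = tp v" by (cases v rule: merged_cases) (use False in auto)
    then show ?thesis using merge_exec(1)[OF v] False by auto
  qed
  show "segs ?e tp'"
    unfolding segs_def
  proof (intro conjI ballI impI)
    fix v assume v: "v \<in> V"
    show "pid (?e v) = pth v" using cs[OF v] segsD(1)[OF S v] by auto
    show "tp' v \<le> pos v" using merged_le[OF v] segsD(2)[OF S v] by simp
    show "off (?e v) = pos v - tp' v" using cs[OF v] segsD(3)[OF S v] by auto
    show "mk (?e v) \<le> 1" using cs[OF v] segsD(4)[OF S v] by auto
  next
    fix u v assume "u \<in> V" "v \<in> V" "pth u = pth v" "pos u \<le> pos v" "tp' v \<le> pos u"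
    then show "tp' u = tp' v" by (rule merged_interval)
  next
    fix u v assume uv: "u \<in> V" "v \<in> V" "pth u = pth v" "pos u = tp' v"
    show "seg (?e v) = Suc u"
      using cs[OF uv(2)]
    proof (elim disjE exE conjE)
      assume "?e v = st v" "tp' v = tp v"
      then show ?thesis using segsD(6)[OF S uv(1,2,3)] uv(4) by simp
    next
      fix p c assume pc: "bdry tp p c" "pth c = pth v" "tp p = tp' v"
        "?e v = (st v)\<lparr>off := pos v - tp p, seg := seg (st p), mk := 1\<rparr>"
      then show ?thesis using segsD(6)[OF S uv(1), of p] bdryD[OF S pc(1)] uv by simp
    next
      assume "tp v = tp' v" "?e v = (st v)\<lparr>mk := 1\<rparr>"
      then show ?thesis using segsD(6)[OF S uv(1,2,3)] uv(4) by simp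
    qed
  next
    fix u v assume uv: "u \<in> V" "v \<in> V" "pth u = pth v" "tp' u = tp' v"
    show "mk (?e u) = mk (?e v)"
    proof (cases "\<exists>p c. bdry tp p c \<and> Sel p c \<and> pth c = pth v \<and> tp p = tp' v")
      case True
      then have "mk (?e u) = 1" "mk (?e v) = 1" using cs[OF uv(1)] cs[OF uv(2)] uv by auto
      then show ?thesis by simp
    next
      case False
      then have "?e u = st u \<and> tp' u = tp u" "?e v = st v \<and> tp' v = tp v"
        using cs[OF uv(1)] cs[OF uv(2)] uv by auto
      then show ?thesis using segsD(7)[OF S uv(1-3)] uv(4) by simp
    qed
  qed
  show "v \<in> V \<Longrightarrow> mk (?e v) = 0 \<Longrightarrow> mk (st v) = 0 \<and> seg (?e v) = seg (st v) \<and> tp' v = tp v"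
    using cs[of v] by auto
  show "bdry tp p c \<Longrightarrow> Sel p c \<Longrightarrow> mk (?e p) = 1 \<and> mk (?e c) = 1"
  proof -
    assume b: "bdry tp p c" "Sel p c"
    note d = bdryD[OF S b(1)]
    have "tp' c = tp p" "tp' p = tp p" using merged_lower[OF b] merged_upper[OF b] by auto
    then show ?thesis using cs[OF d(1)] cs[OF d(2)] b d(3) by auto
  qed
  show "v \<in> V \<Longrightarrow> mk (?e v) = mk (st v) \<and> tp' v = tp v \<or>
      (\<exists>p c. bdry tp p c \<and> Sel p c \<and> pth c = pth v \<and> tp' v = tp p \<and> mk (?e v) = 1)"
  proof -
    assume v: "v \<in> V"
    show ?thesis using cs[OF v]
    proof (elim disjE exE conjE)
      fix p c assume "bdry tp p c" "Sel p c" "pth c = pth v" "tp p = tp' v"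
        "?e v = (st v)\<lparr>off := pos v - tp p, seg := seg (st p), mk := 1\<rparr>"
      then show ?thesis by (intro disjI2 exI[of _ p] exI[of _ c]) simp
    next
      fix p c assume "bdry tp p c" "Sel p c" "pth c = pth v" "tp p = tp' v" "?e v = (st v)\<lparr>mk := 1\<rparr>"
      then show ?thesis by (intro disjI2 exI[of _ p] exI[of _ c]) simp
    qed simp
  qed
qed

end

text \<open>In a stage the boundaries of type \<open>(b, \<beta>)\<close> are those at which the identifiers of the adjacent
  segments first differ in bit \<open>b\<close>, the lower one having bit \<open>\<beta>\<close>. Boundaries of equal type are never
  adjacent, so going through the types yields a maximal matching of the segments; the unmatched ones
  then join a neighbour. Hence every stage doubles the least segment size.\<close>

definition sel_type :: "nat \<Rightarrow> bool \<Rightarrow> vec \<Rightarrow> vec \<Rightarrow> bool" where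
  "sel_type b \<beta> p c \<longleftrightarrow> p 2 = 0 \<and> c 2 = 0 \<and> (\<forall>k<b. bit (p 1) k = bit (c 1) k) \<and>
     bit (p 1) b \<noteq> bit (c 1) b \<and> bit (c 1) b = \<beta>"

lemma sel_typeD:
  "sel_type b \<beta> p c \<Longrightarrow> p 2 = 0" "sel_type b \<beta> p c \<Longrightarrow> c 2 = 0"
  "sel_type b \<beta> p c \<Longrightarrow> bit (p 1) b \<longleftrightarrow> \<not> \<beta>" "sel_type b \<beta> p c \<Longrightarrow> bit (c 1) b \<longleftrightarrow> \<beta>"
  unfolding sel_type_def by blast+

text \<open>Names go up to \<open>2 ^ L\<close>, hence \<open>Suc L\<close> bits. The last two
  merges attach the segments left over by the matching to their upper neighbours, and then the
  remaining ones to their lower neighbours.\<close>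

definition stage :: "nat \<Rightarrow> nst step list" where
  "stage L = local_step (\<lambda>st. st\<lparr>mk := 0\<rparr>) #
     map (\<lambda>(b, \<beta>). merge (sel_type b \<beta>)) (List.product [0..<Suc L] [False, True]) @
     [merge (\<lambda>p c. c 2 = 0), merge (\<lambda>p c. p 2 = 0)]"

definition positions :: "nat \<Rightarrow> nst step list" where
  "positions L = concat (replicate L (stage L))"

lemma differing_bit:
  assumes "x \<noteq> y" "x < 2 ^ m" "y < 2 ^ (m::nat)"
  shows "\<exists>b<m. (\<forall>k<b. bit (x::nat) k = bit y k) \<and> bit x b \<noteq> bit y b"
proof -
  let ?P = "\<lambda>b. bit x b \<noteq> bit y b"
  obtain b0 where b0: "?P b0" using assms(1) by (meson bit_eqI)
  have L: "?P (LEAST b. ?P b)" using b0 by (rule LeastI)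
  have "\<not> m \<le> b \<or> \<not> ?P b" for b
    using assms(2,3) bit_take_bit_iff[of m x b] bit_take_bit_iff[of m y b]
      take_bit_nat_eq_self[of x m] take_bit_nat_eq_self[of y m] by auto
  then have "(LEAST b. ?P b) < m" using L by (meson not_le)
  then show ?thesis using L not_less_Least by (intro exI[of _ "LEAST b. ?P b"]) blast
qed

context star_prog begin

definition big :: "(node \<Rightarrow> nat) \<Rightarrow> nat \<Rightarrow> node \<Rightarrow> bool" where
  "big tp k v \<longleftrightarrow> (\<exists>u\<in>V. pth u = pth v \<and> tp u = tp v \<and> tp v + k \<le> Suc (pos u))"

definition whole :: "(node \<Rightarrow> nat) \<Rightarrow> node \<Rightarrow> bool" where
  "whole tp v \<longleftrightarrow> (\<forall>u\<in>V. pth u = pth v \<longrightarrow> tp u = 0)"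

text \<open>A marked segment already has the size promised for the end of the stage. A path that is
  a single segment is exempt, as it may be too short.\<close>

definition stage_inv :: "nat \<Rightarrow> (node \<Rightarrow> nst) \<Rightarrow> (node \<Rightarrow> nat) \<Rightarrow> bool" where
  "stage_inv \<sigma> st tp \<longleftrightarrow> segs st tp \<and>
     (\<forall>v\<in>V. whole tp v \<or> big tp (if mk (st v) = 0 then 2 ^ \<sigma> else 2 ^ Suc \<sigma>) v)"

lemma big_mono: "big tp k v \<Longrightarrow> k' \<le> k \<Longrightarrow> big tp k' v"
  by (auto simp: big_def intro: le_trans[OF add_left_mono])

text \<open>Two segments at a boundary are not whole paths, so each has at least
  \<open>2 ^ \<sigma>\<close> nodes and their union has twice that. The second conclusion says that
  boundaries only disappear and that segments still unmarked have kept their names.\<close>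

lemma merge_stage:
  assumes inv: "stage_inv \<sigma> st tp"
    and Sel: "\<And>p c. bdry tp p c \<Longrightarrow> Sel p c \<longleftrightarrow>
      sel (vl [pth p, seg (st p), mk (st p)]) (vl [pth c, seg (st c), mk (st c)])"
    and nonadj: "\<And>p c p' c'. bdry tp p c \<Longrightarrow> bdry tp p' c' \<Longrightarrow> Sel p c \<Longrightarrow> Sel p' c' \<Longrightarrow>
      pth p' = pth c \<Longrightarrow> tp p' = tp c \<Longrightarrow> False"
  obtains tp' where "stage_inv \<sigma> (exec N L (merge sel) st) tp'"
    "\<And>p c. bdry tp' p c \<Longrightarrow> bdry tp p c \<and> \<not> Sel p c \<and>
      (mk (exec N L (merge sel) st p) = 0 \<longrightarrow> mk (st p) = 0 \<and> seg (exec N L (merge sel) st p) = seg (st p)) \<and>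
      (mk (exec N L (merge sel) st c) = 0 \<longrightarrow> mk (st c) = 0 \<and> seg (exec N L (merge sel) st c) = seg (st c))"
proof -
  let ?e = "exec N L (merge sel) st"
  let ?t = "merged tp Sel"
  from inv have S: "segs st tp"
    and B: "\<And>v. v \<in> V \<Longrightarrow> whole tp v \<or> big tp (if mk (st v) = 0 then 2 ^ \<sigma> else 2 ^ Suc \<sigma>) v"
    by (auto simp: stage_inv_def)
  interpret M: merging N Ps link L st tp Sel sel
    by unfold_locales (fact S Sel nonadj)+
  have "whole ?t v \<or> big ?t (if mk (?e v) = 0 then 2 ^ \<sigma> else 2 ^ Suc \<sigma>) v" if v: "v \<in> V" for v
    using M.merge_run(4)[OF v]
  proof (elim disjE exE conjE)
    assume same: "mk (?e v) = mk (st v)" "?t v = tp v"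
    from B[OF v] show ?thesis
    proof
      assume "whole tp v"
      then have "whole ?t v" unfolding whole_def
        using M.merged_le by (metis le_zero_eq)
      then show ?thesis ..
    next
      assume "big tp (if mk (st v) = 0 then 2 ^ \<sigma> else 2 ^ Suc \<sigma>) v"
      then obtain u where u: "u \<in> V" "pth u = pth v" "tp u = tp v"
        "tp v + (if mk (st v) = 0 then 2 ^ \<sigma> else 2 ^ Suc \<sigma>) \<le> Suc (pos u)" by (auto simp: big_def)
      have "?t u = ?t v" using M.merged_cong[OF u(2,3)] .
      then have "big ?t (if mk (?e v) = 0 then 2 ^ \<sigma> else 2 ^ Suc \<sigma>) v"
        unfolding big_def same using u by (intro bexI[of _ u]) auto
      then show ?thesis ..
    qed
  next
    fix p c assume pc: "bdry tp p c" "Sel p c" "pth c = pth v" "?t v = tp p" "mk (?e v) = 1"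
    note b = bdryD[OF S pc(1)]
    have "\<not> whole tp p" "\<not> whole tp c" using b unfolding whole_def by force+
    then have "big tp (2 ^ \<sigma>) p" "big tp (2 ^ \<sigma>) c"
      using B[OF b(1)] B[OF b(2)] by (auto intro: big_mono split: if_splits)
    then obtain u w where u: "u \<in> V" "pth u = pth c" "tp u = tp c" "tp c + 2 ^ \<sigma> \<le> Suc (pos u)"
      and w: "w \<in> V" "pth w = pth p" "tp w = tp p" "tp p + 2 ^ \<sigma> \<le> Suc (pos w)" by (auto simp: big_def)
    have "pos w < pos c"
    proof (rule ccontr)
      assume "\<not> pos w < pos c"
      then have "tp c = tp w" using segsD(5)[OF S b(2) w(1)] b w by simp
      then show False using b w by simp
    qed
    then have "tp p + 2 ^ Suc \<sigma> \<le> Suc (pos u)" using u w b by simp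
    moreover have "?t u = tp p"
      using M.merged_lower[OF pc(1,2)] u by simp
    ultimately have "big ?t (2 ^ Suc \<sigma>) v" unfolding big_def pc(4) using u pc by (intro bexI[of _ u]) auto
    then show ?thesis using pc(5) by simp
  qed
  then have 1: "stage_inv \<sigma> ?e ?t" using M.merge_run(1) by (simp add: stage_inv_def)
  have 2: "bdry tp p c \<and> \<not> Sel p c \<and> (mk (?e p) = 0 \<longrightarrow> mk (st p) = 0 \<and> seg (?e p) = seg (st p)) \<and>
      (mk (?e c) = 0 \<longrightarrow> mk (st c) = 0 \<and> seg (?e c) = seg (st c))" if b: "bdry ?t p c" for p c
  proof -
    have p: "par p c" "p \<noteq> r" "?t p \<noteq> ?t c" using b by (auto simp: bdry_def)
    have "p \<in> V" "c \<in> V" using p par_in by auto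
    moreover have "tp p \<noteq> tp c \<and> \<not> (bdry tp p c \<and> Sel p c)"
      using M.merged_join[OF p(1,2)] p(3) by blast
    ultimately show ?thesis using M.merge_run(2)[of p] M.merge_run(2)[of c] p by (auto simp: bdry_def)
  qed
  show thesis by (rule that[OF 1 2])
qed

definition types_done :: "(nat \<times> bool) set \<Rightarrow> (node \<Rightarrow> nst) \<Rightarrow> (node \<Rightarrow> nat) \<Rightarrow> bool" where
  "types_done D st tp \<longleftrightarrow> (\<forall>p c b \<beta>. bdry tp p c \<longrightarrow> (b, \<beta>) \<in> D \<longrightarrow>
     \<not> sel_type b \<beta> (vl [pth p, seg (st p), mk (st p)]) (vl [pth c, seg (st c), mk (st c)]))"

text \<open>A finished type cannot come back: it concerns boundaries between unmarked segments,
  whose names have not changed, and no boundary is new.\<close>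

lemma types_run:
  assumes "stage_inv \<sigma> st tp" "types_done D st tp"
  shows "\<exists>tp'. stage_inv \<sigma> (run N L (map (\<lambda>(b, \<beta>). merge (sel_type b \<beta>)) ts) st) tp' \<and>
    types_done (D \<union> set ts) (run N L (map (\<lambda>(b, \<beta>). merge (sel_type b \<beta>)) ts) st) tp'"
  using assms
proof (induction ts arbitrary: st tp D)
  case Nil
  then show ?case by auto
next
  case (Cons t ts)
  obtain b \<beta> where t: "t = (b, \<beta>)" by force
  let ?sel = "sel_type b \<beta>"
  let ?x = "\<lambda>st v. vl [pth v, seg (st v), mk (st v)]"
  let ?Sel = "\<lambda>p c. ?sel (?x st p) (?x st c)"
  let ?e = "exec N L (merge ?sel) st"
  have S: "segs st tp" using Cons.prems(1) by (simp add: stage_inv_def)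
  have nonadj: False if "bdry tp p c" "bdry tp p' c'" "?Sel p c" "?Sel p' c'" "pth p' = pth c" "tp p' = tp c" for p c p' c'
  proof -
    have "seg (st p') = seg (st c)"
      using segs_seg_eq[OF S] bdryD[OF S that(1)] bdryD[OF S that(2)] that(5,6) by simp
    then show False using sel_typeD(4)[OF that(3)] sel_typeD(3)[OF that(4)] by simp
  qed
  obtain tp1 where tp1: "stage_inv \<sigma> ?e tp1"
    "\<And>p c. bdry tp1 p c \<Longrightarrow> bdry tp p c \<and> \<not> ?Sel p c \<and>
      (mk (?e p) = 0 \<longrightarrow> mk (st p) = 0 \<and> seg (?e p) = seg (st p)) \<and>
      (mk (?e c) = 0 \<longrightarrow> mk (st c) = 0 \<and> seg (?e c) = seg (st c))"
  proof (rule merge_stage[OF Cons.prems(1), of ?Sel ?sel])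
    show "?Sel p c \<longleftrightarrow> ?Sel p c" for p c by (rule refl)
  qed (use nonadj in blast)+
  have "\<not> sel_type b' \<beta>' (?x ?e p) (?x ?e c)" if "bdry tp1 p c" "(b', \<beta>') \<in> insert t D" for p c b' \<beta>'
  proof
    assume s: "sel_type b' \<beta>' (?x ?e p) (?x ?e c)"
    then have "mk (?e p) = 0" "mk (?e c) = 0" using sel_typeD(1,2)[OF s] by simp_all
    then have "sel_type b' \<beta>' (?x st p) (?x st c)" using s tp1(2)[OF that(1)] by auto
    then show False using tp1(2)[OF that(1)] that(2) Cons.prems(2) t unfolding types_done_def by blast
  qed
  then have "types_done (insert t D) ?e tp1" unfolding types_done_def by blast
  from Cons.IH[OF tp1(1) this] show ?case by (simp add: t)
qed

lemma stage_run:
  assumes S: "segs st tp" and B: "\<And>v. v \<in> V \<Longrightarrow> whole tp v \<or> big tp (2 ^ \<sigma>) v"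
  shows "\<exists>tp'. segs (run N L (stage L) st) tp' \<and> (\<forall>v\<in>V. whole tp' v \<or> big tp' (2 ^ Suc \<sigma>) v)"
proof -
  let ?st0 = "\<lambda>v. (st v)\<lparr>mk := 0\<rparr>"
  let ?ts = "List.product [0..<Suc L] [False, True]"
  let ?p1 = "map (\<lambda>(b, \<beta>). merge (sel_type b \<beta>)) ?ts"
  let ?x = "\<lambda>st v. vl [pth v, seg (st v), mk (st v)]"
  have "exec N L (local_step (\<lambda>st. st\<lparr>mk := 0\<rparr>)) st = ?st0" by (rule ext) simp
  then have run: "run N L (stage L) st = run N L [merge (\<lambda>p c. c 2 = 0), merge (\<lambda>p c. p 2 = 0)] (run N L ?p1 ?st0)"
    by (simp only: stage_def run_append run_Cons)
  have "segs ?st0 tp" unfolding segs_def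
  proof (intro conjI ballI impI)
    fix u v assume "u \<in> V" "v \<in> V" "pth u = pth v" "pos u \<le> pos v" "tp v \<le> pos u"
    then show "tp u = tp v" by (rule segsD(5)[OF S])
  next
    fix u v assume "u \<in> V" "v \<in> V" "pth u = pth v" "pos u = tp v"
    then show "seg (?st0 v) = Suc u" using segsD(6)[OF S, of u v] by simp
  qed (simp_all add: segsD(1-3)[OF S])
  then have "stage_inv \<sigma> ?st0 tp" using B by (simp add: stage_inv_def)
  moreover have "types_done {} ?st0 tp" by (simp add: types_done_def)
  ultimately obtain tp1 where tp1: "stage_inv \<sigma> (run N L ?p1 ?st0) tp1"
    and "types_done ({} \<union> set ?ts) (run N L ?p1 ?st0) tp1"
    using types_run by blast
  then have d1: "\<And>p c b \<beta>. bdry tp1 p c \<Longrightarrow> (b, \<beta>) \<in> set ?ts \<Longrightarrow>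
      \<not> sel_type b \<beta> (?x (run N L ?p1 ?st0) p) (?x (run N L ?p1 ?st0) c)"
    unfolding types_done_def by blast
  define st1 where "st1 = run N L ?p1 ?st0"
  have S1: "segs st1 tp1" using tp1 by (simp add: stage_inv_def st1_def)
  \<comment> \<open>Maximality of the matching: adjacent segments have different names, which first
    differ in some bit. If both were unmarked, their boundary would have a type that has been
    processed.\<close>
  have m1: "mk (st1 p) \<noteq> 0 \<or> mk (st1 c) \<noteq> 0" if b: "bdry tp1 p c" for p c
  proof (rule ccontr)
    assume "\<not> ?thesis"
    then have m: "mk (st1 p) = 0" "mk (st1 c) = 0" by auto
    note d = bdryD[OF S1 b]
    have "seg (st1 p) \<noteq> seg (st1 c)" using segs_seg_eq[OF S1 d(1,2,3)] d by simp
    moreover have "x < 2 ^ Suc L" if "x \<le> 2 ^ L" for x :: nat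
      using that le_less_trans[of x "2 ^ L" "2 ^ Suc L"] by simp
    ultimately obtain k where k: "k < Suc L" "\<forall>j<k. bit (seg (st1 p)) j = bit (seg (st1 c)) j"
       "bit (seg (st1 p)) k \<noteq> bit (seg (st1 c)) k"
      using differing_bit[of "seg (st1 p)" "seg (st1 c)" "Suc L"] segs_seg_le[OF S1 d(1)] segs_seg_le[OF S1 d(2)] by blast
    have "sel_type k (bit (seg (st1 c)) k) (?x st1 p) (?x st1 c)"
      using k m by (simp add: sel_type_def)
    moreover have "(k, bit (seg (st1 c)) k) \<in> set ?ts" using k(1) by auto
    ultimately show False using d1[OF b] by (simp add: st1_def)
  qed
  let ?e1 = "exec N L (merge (\<lambda>p c. c 2 = 0)) st1"
  obtain tp2 where tp2: "stage_inv \<sigma> ?e1 tp2" "\<And>p c. bdry tp2 p c \<Longrightarrow> bdry tp1 p c \<and> mk (st1 c) \<noteq> 0 \<and>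
      (mk (?e1 p) = 0 \<longrightarrow> mk (st1 p) = 0 \<and> seg (?e1 p) = seg (st1 p)) \<and>
      (mk (?e1 c) = 0 \<longrightarrow> mk (st1 c) = 0 \<and> seg (?e1 c) = seg (st1 c))"
  proof (rule merge_stage[OF tp1[folded st1_def], of "\<lambda>p c. mk (st1 c) = 0" "\<lambda>p c. c 2 = 0"])
    \<comment> \<open>Adjacent selections would share the segment of \<open>c\<close>, so
      \<open>p'\<close> and \<open>c'\<close> would both be unmarked, contrary to
      \<open>m1\<close>.\<close>
    fix p c p' c' assume h: "bdry tp1 p c" "bdry tp1 p' c'" "mk (st1 c) = 0" "mk (st1 c') = 0" "pth p' = pth c" "tp1 p' = tp1 c"
    have "mk (st1 p') = mk (st1 c)" by (rule segsD(7)[OF S1 bdryD(1)[OF S1 h(2)] bdryD(2)[OF S1 h(1)] h(5,6)])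
    then show False using m1[OF h(2)] h by simp
  qed auto
  have S2: "segs ?e1 tp2" using tp2 by (simp add: stage_inv_def)
  \<comment> \<open>The merge just made took away every boundary with an unmarked lower side. This
    gives the nonadjacency needed by the next one.\<close>
  have m2: "mk (?e1 c) \<noteq> 0" if "bdry tp2 p c" for p c using tp2(2)[OF that] by auto
  let ?e2 = "exec N L (merge (\<lambda>p c. p 2 = 0)) ?e1"
  obtain tp3 where tp3: "stage_inv \<sigma> ?e2 tp3" "\<And>p c. bdry tp3 p c \<Longrightarrow> bdry tp2 p c \<and> mk (?e1 p) \<noteq> 0 \<and>
      (mk (?e2 p) = 0 \<longrightarrow> mk (?e1 p) = 0 \<and> seg (?e2 p) = seg (?e1 p)) \<and>
      (mk (?e2 c) = 0 \<longrightarrow> mk (?e1 c) = 0 \<and> seg (?e2 c) = seg (?e1 c))"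
  proof (rule merge_stage[OF tp2(1), of "\<lambda>p c. mk (?e1 p) = 0" "\<lambda>p c. p 2 = 0"])
    fix p c p' c' assume h: "bdry tp2 p c" "bdry tp2 p' c'" "mk (?e1 p) = 0" "mk (?e1 p') = 0" "pth p' = pth c" "tp2 p' = tp2 c"
    have "mk (?e1 p') = mk (?e1 c)" by (rule segsD(7)[OF S2 bdryD(1)[OF S2 h(2)] bdryD(2)[OF S2 h(1)] h(5,6)])
    then show False using m2[OF h(1)] h by simp
  qed auto
  have S3: "segs ?e2 tp3" using tp3 by (simp add: stage_inv_def)
  have m3: "mk (?e2 c) \<noteq> 0 \<and> mk (?e2 p) \<noteq> 0" if "bdry tp3 p c" for p c
  proof -
    note t = tp3(2)[OF that]
    show ?thesis using t m2[OF conjunct1[OF t]] by argo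
  qed
  \<comment> \<open>A segment that is not the whole path has a boundary, above or below, and by
    \<open>m3\<close> both sides of every boundary are marked by now.\<close>
  have "whole tp3 v \<or> big tp3 (2 ^ Suc \<sigma>) v" if v: "v \<in> V" for v
  proof (cases "\<forall>u\<in>V. pth u = pth v \<longrightarrow> tp3 u = tp3 v")
    case True
    obtain u where u: "u \<in> V" "pth u = pth v" "pos u = 0" using node_at[OF v, of 0] by auto
    then have "tp3 u = 0" using segsD(2)[OF S3 u(1)] by simp
    then show ?thesis using True u unfolding whole_def by metis
  next
    case False
    then obtain u where u: "u \<in> V" "pth u = pth v" "tp3 u \<noteq> tp3 v" by blast
    have "mk (?e2 v) \<noteq> 0"
    proof (cases "pos u < pos v")
      case True
      obtain p c where "bdry tp3 p c" "pth c = pth v" "tp3 c = tp3 v"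
        using bdry_between[OF S3 u(1) v u(2) True u(3)] .
      then show ?thesis using m3 segsD(7)[OF S3, of c v] v bdryD(2)[OF S3] by metis
    next
      case False
      have "pos v \<noteq> pos u" using u v V_eqI by metis
      with False have lt: "pos v < pos u" by simp
      \<comment> \<open>The topmost node of this set has its parent in the segment of
        \<open>v\<close>, so the edge between them is the boundary looked for.\<close>
      define A where "A = {x \<in> V. pth x = pth v \<and> pos v < pos x \<and> tp3 x \<noteq> tp3 v}"
      have uA: "u \<in> A" using u lt by (simp add: A_def)
      obtain w where w: "w \<in> A" "\<And>x. x \<in> A \<Longrightarrow> pos w \<le> pos x"
        using uA ex_has_least_nat[of "\<lambda>x. x \<in> A" u pos] by auto
      have wV: "w \<in> V'" using w(1) by (auto simp: A_def V'_def)
      obtain p where p: "par p w" using par_exists[OF wV] .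
      then have p': "p \<in> V" "p \<noteq> r" "pth p = pth w" "pos w = Suc (pos p)"
        using w(1) by (auto simp: par_def A_def V'_def split: if_splits)
      have "tp3 p = tp3 v"
      proof (cases "pos p = pos v")
        case True
        then have "p = v" using V_eqI p' v w(1) by (auto simp: A_def)
        then show ?thesis by simp
      next
        case ne: False
        have "p \<notin> A" using w(2)[of p] p' by auto
        then show ?thesis using p' w(1) ne by (auto simp: A_def)
      qed
      moreover have "bdry tp3 p w" using p p' w(1) calculation by (auto simp: bdry_def A_def)
      ultimately show ?thesis using m3[of p w] segsD(7)[OF S3, of p v] v p' w(1) by (auto simp: A_def)
    qed
    then show ?thesis using tp3(1) v by (auto simp: stage_inv_def)
  qed
  then show ?thesis using S3 run by (auto simp: st1_def)
qed

lemma positions_run: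
  assumes st: "\<And>v. v \<in> V \<Longrightarrow> pid (st v) = pth v \<and> seg (st v) = Suc v \<and> off (st v) = 0 \<and> mk (st v) = 0"
  shows "base (run N L (positions L) st)"
proof -
  have "\<exists>tp. segs (run N L (concat (replicate k (stage L))) st) tp \<and> (\<forall>v\<in>V. whole tp v \<or> big tp (2 ^ k) v)" for k
  proof (induction k)
    case 0
    have "segs st pos" unfolding segs_def using st V_eqI by auto
    moreover have "big pos 1 v" if "v \<in> V" for v using that by (auto simp: big_def)
    ultimately show ?case by auto
  next
    case (Suc k)
    then obtain tp where tp: "segs (run N L (concat (replicate k (stage L))) st) tp"
      "\<And>v. v \<in> V \<Longrightarrow> whole tp v \<or> big tp (2 ^ k) v" by blast
    have "concat (replicate (Suc k) (stage L)) = concat (replicate k (stage L)) @ stage L"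
      by (simp flip: replicate_append_same)
    then show ?case using stage_run[OF tp] by (simp add: run_append)
  qed
  from this[of L] obtain tp where tp: "segs (run N L (positions L) st) tp"
    "\<And>v. v \<in> V \<Longrightarrow> whole tp v \<or> big tp (2 ^ L) v" unfolding positions_def by blast
  have "tp v = 0" if v: "v \<in> V" for v
  proof (cases "v = r")
    case True
    then show ?thesis using segsD(2)[OF tp(1) v] by simp
  next
    case False
    \<comment> \<open>Even the entire path has fewer than \<open>2 ^ L\<close> nodes, so after
      \<open>L\<close> doublings only the exemption for whole paths is left.\<close>
    have "\<not> big tp (2 ^ L) v"
    proof
      assume "big tp (2 ^ L) v"
      then obtain u where u: "u \<in> V" "pth u = pth v" "2 ^ L \<le> Suc (pos u)" by (auto simp: big_def)
      then have "u \<in> V'" using False v pth_0_iff by (auto simp: V'_pth)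
      then show False using pos_less'[of u] u(3) by simp
    qed
    then show ?thesis using tp(2)[OF v] v by (auto simp: whole_def)
  qed
  then show ?thesis using segsD(1,3)[OF tp(1)] by (auto simp: base_def)
qed

end

section \<open>Cut values\<close>

definition nbr_step :: "(nst \<Rightarrow> nat list) \<Rightarrow> (vec \<Rightarrow> vec \<Rightarrow> bool) \<Rightarrow> (nst \<Rightarrow> nat \<Rightarrow> nst) \<Rightarrow> nst step" where
  "nbr_step bc c f = \<lparr> bcast = \<lambda>st. vl (bc st), reply = \<lambda>w d x y. vl [if c x y then w else 0],
     join = \<lambda>_ _. False, share = \<lambda>_ _. vl [], update = \<lambda>st G _. f st (G 0) \<rparr>"

definition lab_step :: "(nst \<Rightarrow> nat) \<Rightarrow> (nst \<Rightarrow> nat list) \<Rightarrow> (nst \<Rightarrow> vec \<Rightarrow> nst) \<Rightarrow> nst step" where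
  "lab_step lab h f = \<lparr> bcast = \<lambda>st. vl [pid st, lab st], reply = \<lambda>_ _ _ _. vl [],
     join = \<lambda>p c. p 0 \<noteq> 0 \<and> p 1 = c 1, share = \<lambda>st _. vl (h st), update = \<lambda>st _ S. f st S \<rparr>"

text \<open>Single cuts and \<open>W\<close> are at most \<open>2 ^ (3 * L)\<close>, from
  \<open>2 ^ L\<close> times \<open>2 ^ L\<close> pairs of weight at most \<open>2 ^ L\<close>. Four
  times this is still above the minimum after \<open>2 * W\<close> is subtracted, so it acts as
  infinity in \<open>cutm\<close> and \<open>best\<close>.\<close>

definition big_cut :: "nat \<Rightarrow> nat" where
  "big_cut L = 2 ^ (3 * L + 2)"

definition cuts :: "bool \<Rightarrow> nat \<Rightarrow> nst step list" where
  "cuts link L =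
     nbr_step (\<lambda>st. [pid st, off st]) (\<lambda>x y. \<not> (y 0 = x 0 \<and> x 1 < y 1)) (\<lambda>st g. st\<lparr>xin := g\<rparr>) # suffix L @
     local_step (\<lambda>st. st\<lparr>cut := acc st\<rparr>) #
     nbr_step (\<lambda>st. [pid st, off st]) (\<lambda>x y. y 0 = x 0 \<and> x 1 < y 1) (\<lambda>st g. st\<lparr>xin := g\<rparr>) # suffix L @
     local_step (\<lambda>st. st\<lparr>cut := cut st - acc st\<rparr>) #
     nbr_step (\<lambda>st. [pid st]) (\<lambda>x y. y 0 \<noteq> 0 \<and> y 0 \<noteq> x 0) (\<lambda>st g. st\<lparr>xin := g\<rparr>) # suffix L @
     [local_step (\<lambda>st. st\<lparr>dn := xin st, dd := acc st, best := big_cut L,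
       cutm := (if link \<or> off st \<noteq> 0 then cut st else big_cut L)\<rparr>)]"

context star_prog begin

lemma nbr_exec:
  assumes "\<And>u. u \<in> V \<Longrightarrow> length (bc (st u)) \<le> 8 \<and> (\<forall>x\<in>set (bc (st u)). x < 2 ^ n)" and v: "v \<in> V"
  shows "exec N L (nbr_step bc c f) st v =
    f (st v) (\<Sum>u | u \<in> V \<and> c (vl (bc (st v))) (vl (bc (st u))). wt v u)"
proof -
  let ?s = "nbr_step bc c f"
  have sent: "sent L ?s st u = vl (bc (st u))" if "u \<in> V" for u
    using assms(1)[OF that] by (intro sent_vl) (auto simp: nbr_step_def)
  have R: "reply ?s w d x y = vl [if c x y then w else 0]" for w d x y by (simp add: nbr_step_def)
  have "nbr_agg N L ?s st v 0 = (\<Sum>u | u \<in> V \<and> c (vl (bc (st v))) (vl (bc (st u))). wt v u)"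
    by (rule nbr_agg_sum[OF v]) (use edge_in v in \<open>auto simp: sent R\<close>)
  moreover have "update ?s x G S = f x (G 0)" for x G S by (simp add: nbr_step_def)
  ultimately show ?thesis by (simp only: exec_def)
qed

lemma lab_exec:
  assumes b: "base st" and l: "\<And>u. u \<in> V \<Longrightarrow> lab (st u) < 2 ^ n"
    and mono: "\<And>u v. u \<in> V' \<Longrightarrow> v \<in> V' \<Longrightarrow> pth u = pth v \<Longrightarrow> pos u \<le> pos v \<Longrightarrow> lab (st u) \<le> lab (st v)"
    and v: "v \<in> V"
  shows "exec N L (lab_step lab h f) st v =
    f (st v) (vagg n (\<lambda>u. vl (h (st u))) {u \<in> V. pth u = pth v \<and> lab (st u) = lab (st v)})"
proof -
  let ?s = "lab_step lab h f"
  have sent: "sent L ?s st u = vl [pth u, lab (st u)]" if "u \<in> V" for u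
    using l[OF that] small_width[OF pth_le[OF that]] baseD[OF b that] by (intro sent_vl) (auto simp: lab_step_def)
  have K: "supernode (joined N L ?s st) v = {u \<in> V. pth u = pth v \<and> lab (st u) = lab (st v)}"
  proof (rule supernode_lab[OF _ _ v])
    show "join ?s (sent L ?s st p) (sent L ?s st c) \<longleftrightarrow> p \<noteq> r \<and> lab (st p) = lab (st c)" if "par p c" for p c
      unfolding sent[OF par_in(1)[OF that]] sent[OF par_in(3)[OF that]]
      by (simp add: lab_step_def par_pth[OF that])
  qed (rule mono)
  have "update ?s x G S = f x S" "share ?s x G = vl (h x)" for x G S by (simp_all add: lab_step_def)
  then show ?thesis by (simp only: exec_def K)
qed

lemma lab_exec_sum:
  assumes b: "base st" and l: "\<And>u. u \<in> V \<Longrightarrow> lab (st u) < 2 ^ n"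
    and mono: "\<And>u v. u \<in> V' \<Longrightarrow> v \<in> V' \<Longrightarrow> pth u = pth v \<Longrightarrow> pos u \<le> pos v \<Longrightarrow> lab (st u) \<le> lab (st v)"
    and v: "v \<in> V" and h: "\<And>u. u \<in> V \<Longrightarrow> h (st u) \<le> 2 ^ (4 * L)"
  shows "exec N L (lab_step lab (\<lambda>st. [h st]) (\<lambda>st S. f st (S 0))) st v =
    f (st v) (\<Sum>u | u \<in> V \<and> pth u = pth v \<and> lab (st u) = lab (st v). h (st u))"
proof -
  let ?K = "{u \<in> V. pth u = pth v \<and> lab (st u) = lab (st v)}"
  have "(\<Sum>u\<in>?K. h (st u)) \<le> 2 ^ L * 2 ^ (4 * L)" using h by (intro sum_le) auto
  also have "\<dots> = 2 ^ (5 * L + 0)" by (simp flip: power_add)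
  finally have "(\<Sum>u\<in>?K. h (st u)) < 2 ^ n" by (rule pow_width[rotated 2]) simp_all
  then have "vagg n (\<lambda>u. vl [h (st u)]) ?K 0 = (\<Sum>u\<in>?K. h (st u))"
    using vagg_sum[of 0 "\<lambda>u. vl [h (st u)]" ?K n] by simp
  then show ?thesis
    by (subst lab_exec[where lab = lab and st = st and h = "\<lambda>st. [h st]" and f = "\<lambda>st S. f st (S 0)", OF b l mono v])
      (simp_all only:)
qed

lemma path_exec_sum:
  assumes b: "base st" and v: "v \<in> V" and h: "\<And>u. u \<in> V \<Longrightarrow> h (st u) \<le> 2 ^ (4 * L)"
  shows "exec N L (lab_step (\<lambda>_. 0) (\<lambda>st. [h st]) (\<lambda>st S. f st (S 0))) st v =
    f (st v) (\<Sum>u | u \<in> V \<and> pth u = pth v. h (st u))"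
  using lab_exec_sum[where lab = "\<lambda>_. 0" and st = st and h = h and f = f, OF b _ _ v h] by simp

definition Dn :: "node \<Rightarrow> nat" where
  "Dn v = (\<Sum>u | u \<in> V' \<and> pth u \<noteq> pth v. wt v u)"

definition D :: "node \<Rightarrow> nat" where
  "D v = (\<Sum>u\<in>below v. Dn u)"

definition cm :: "node \<Rightarrow> nat" where
  "cm v = (if elig v then c1 v else big_cut L)"

definition ready :: "(node \<Rightarrow> nst) \<Rightarrow> bool" where
  "ready st \<longleftrightarrow> base st \<and> (\<forall>v\<in>V'. cut (st v) = c1 v \<and> cutm (st v) = cm v \<and> dn (st v) = Dn v \<and> dd (st v) = D v)"

lemma suffix_exec_below:
  assumes "base st" "\<And>v. v \<in> V \<Longrightarrow> xin (st v) \<le> 2 ^ (2 * L)" "v \<in> V"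
  shows "run N L (suffix L) st v = (st v)\<lparr>acc := acc (run N L (suffix L) st v)\<rparr>"
    "v \<in> V' \<Longrightarrow> acc (run N L (suffix L) st v) = (\<Sum>u\<in>below v. xin (st u))"
proof -
  have le: "xin (st v) \<le> 2 ^ (4 * L)" if "v \<in> V" for v
    using assms(2)[OF that] by (rule le_trans) (simp add: power_increasing)
  show "run N L (suffix L) st v = (st v)\<lparr>acc := acc (run N L (suffix L) st v)\<rparr>"
    using suffix_run[OF assms(1) le assms(3), of L] by simp
  assume "v \<in> V'"
  then show "acc (run N L (suffix L) st v) = (\<Sum>u\<in>below v. xin (st u))"
    using suffix_run[OF assms(1) le assms(3), of L] bsuf_full by simp
qed

text \<open>An edge inside the suffix is counted on the left at its upper end and on the right at
  its lower end, so it cancels; an edge leaving the suffix is counted on the right only. Both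
  conditions compare just the two ends of the edge and do not mention \<open>v\<close>, so one
  suffix sum of each kind serves all \<open>v\<close> at once.\<close>

lemma c1_split:
  "c1 v + (\<Sum>x\<in>below v. \<Sum>u | u \<in> V \<and> pth u = pth x \<and> pos x < pos u. wt x u) =
   (\<Sum>x\<in>below v. \<Sum>u | u \<in> V \<and> \<not> (pth u = pth x \<and> pos x < pos u). wt x u)"
proof -
  let ?S = "below v"
  have S: "pth x = pth v" "x \<in> V'" if "x \<in> ?S" for x using that by (auto simp: below_def)
  have 1: "(\<Sum>u | u \<in> V \<and> \<not> (pth u = pth x \<and> pos x < pos u). wt x u) =
     (\<Sum>u\<in>V - ?S. wt x u) + (\<Sum>u\<in>?S. if pos u < pos x then wt x u else 0)" if x: "x \<in> ?S" for x
  proof -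
    have "{u. u \<in> V \<and> \<not> (pth u = pth x \<and> pos x < pos u)} = (V - ?S) \<union> {u \<in> ?S. pos u \<le> pos x}"
      using x by (auto simp: below_def V'_pth)
    then have "(\<Sum>u | u \<in> V \<and> \<not> (pth u = pth x \<and> pos x < pos u). wt x u) =
      (\<Sum>u\<in>V - ?S. wt x u) + (\<Sum>u | u \<in> ?S \<and> pos u \<le> pos x. wt x u)"
      using finite_V by (simp only:, intro sum.union_disjoint) auto
    also have "(\<Sum>u | u \<in> ?S \<and> pos u \<le> pos x. wt x u) = (\<Sum>u\<in>?S. if pos u \<le> pos x then wt x u else 0)"
      by (simp add: sum.inter_filter)
    also have "\<dots> = (\<Sum>u\<in>?S. if pos u < pos x then wt x u else 0)"
    proof (rule sum.cong[OF refl])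
      fix u assume "u \<in> ?S"
      then have "pos u = pos x \<Longrightarrow> u = x" using S[OF x] S[of u] V'_eqI[of u x] by auto
      then show "(if pos u \<le> pos x then wt x u else 0) = (if pos u < pos x then wt x u else 0)" by auto
    qed
    finally show ?thesis .
  qed
  have 2: "(\<Sum>u | u \<in> V \<and> pth u = pth x \<and> pos x < pos u. wt x u) = (\<Sum>u\<in>?S. if pos x < pos u then wt x u else 0)"
    if x: "x \<in> ?S" for x
  proof -
    have "{u. u \<in> V \<and> pth u = pth x \<and> pos x < pos u} = {u \<in> ?S. pos x < pos u}"
      using x by (auto simp: below_def V'_pth)
    then show ?thesis by (simp add: sum.inter_filter)
  qed
  have "(\<Sum>x\<in>?S. \<Sum>u\<in>?S. if pos u < pos x then wt x u else 0) = (\<Sum>u\<in>?S. \<Sum>x\<in>?S. if pos u < pos x then wt u x else 0)"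
    by (subst sum.swap, intro sum.cong refl) (auto intro: wt_sym)
  then show ?thesis using 1 2 by (simp add: c1_def sum.distrib)
qed

lemma c1_le: "c1 v \<le> 2 ^ (3 * L)"
proof -
  have "c1 v \<le> 2 ^ L * 2 ^ (2 * L)" unfolding c1_def
    using below_sub wt_sum_le by (intro sum_le) auto
  then show ?thesis by (simp flip: power_add)
qed

lemma Dn_le: "Dn v \<le> 2 ^ (2 * L)"
  unfolding Dn_def by (rule wt_sum_le) (auto simp: V'_def)

lemma base_exec:
  assumes "base st" "\<And>v. v \<in> V \<Longrightarrow> pid (st' v) = pid (st v)" "\<And>v. v \<in> V \<Longrightarrow> off (st' v) = off (st v)"
  shows "base st'"
  using assms by (auto simp: base_def)

lemma V'_V: "v \<in> V' \<Longrightarrow> v \<in> V"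
  by (simp add: V'_def)

lemma below_V: "u \<in> below v \<Longrightarrow> u \<in> V"
  using below_sub by blast

lemma nbr_suffix:
  fixes c :: "vec \<Rightarrow> vec \<Rightarrow> bool"
  assumes b: "base st" and bc: "bc = (\<lambda>st. [pid st, off st]) \<or> bc = (\<lambda>st. [pid st])"
  defines "st' \<equiv> run N L (nbr_step bc c (\<lambda>st g. st\<lparr>xin := g\<rparr>) # suffix L) st"
  assumes v: "v \<in> V"
  shows "st' v = (st v)\<lparr>xin := \<Sum>u | u \<in> V \<and> c (vl (bc (st v))) (vl (bc (st u))). wt v u, acc := acc (st' v)\<rparr>"
    "v \<in> V' \<Longrightarrow> acc (st' v) = (\<Sum>x\<in>below v. \<Sum>u | u \<in> V \<and> c (vl (bc (st x))) (vl (bc (st u))). wt x u)"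
proof -
  let ?e = "exec N L (nbr_step bc c (\<lambda>st g. st\<lparr>xin := g\<rparr>)) st"
  have e: "?e v = (st v)\<lparr>xin := \<Sum>u | u \<in> V \<and> c (vl (bc (st v))) (vl (bc (st u))). wt v u\<rparr>" if "v \<in> V" for v
  proof (rule nbr_exec[OF _ that])
    fix u assume u: "u \<in> V"
    have "pid (st u) < 2 ^ n" "off (st u) < 2 ^ n"
      using baseD[OF b u] small_width pth_le[OF u] less_imp_le[OF pos_less[OF u]] by simp_all
    then show "length (bc (st u)) \<le> 8 \<and> (\<forall>x\<in>set (bc (st u)). x < 2 ^ n)" using bc by auto
  qed
  have b': "base ?e" using e by (intro base_exec[OF b]) auto
  have x: "xin (?e v) \<le> 2 ^ (2 * L)" if "v \<in> V" for v
    using e[OF that] by (simp add: wt_sum_le)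
  have run: "st' = run N L (suffix L) ?e" by (simp add: st'_def)
  show "st' v = (st v)\<lparr>xin := \<Sum>u | u \<in> V \<and> c (vl (bc (st v))) (vl (bc (st u))). wt v u, acc := acc (st' v)\<rparr>"
    using suffix_exec_below(1)[OF b' x v] e[OF v] unfolding run by simp
  assume "v \<in> V'"
  then have "acc (st' v) = (\<Sum>u\<in>below v. xin (?e u))"
    using suffix_exec_below(2)[OF b' x v] unfolding run by simp
  also have "\<dots> = (\<Sum>x\<in>below v. \<Sum>u | u \<in> V \<and> c (vl (bc (st x))) (vl (bc (st u))). wt x u)"
    using e below_V by (intro sum.cong) auto
  finally show "acc (st' v) = (\<Sum>x\<in>below v. \<Sum>u | u \<in> V \<and> c (vl (bc (st x))) (vl (bc (st u))). wt x u)" .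
qed

lemma cuts_run:
  assumes b: "base st"
  shows "ready (run N L (cuts link L) st)" "v \<in> V \<Longrightarrow> best (run N L (cuts link L) st v) = big_cut L"
proof -
  let ?bc = "\<lambda>st. [pid st, off st]"
  let ?cA = "\<lambda>x y :: vec. \<not> (y 0 = x 0 \<and> x 1 < y 1)" and ?cB = "\<lambda>x y :: vec. y 0 = x 0 \<and> x 1 < y 1"
    and ?cD = "\<lambda>x y :: vec. y 0 \<noteq> 0 \<and> y 0 \<noteq> x 0"
  let ?f = "\<lambda>st g. st\<lparr>xin := g\<rparr>"
  define st1 where "st1 = run N L (nbr_step ?bc ?cA ?f # suffix L) st"
  define st2 where "st2 = (\<lambda>v. (st1 v)\<lparr>cut := acc (st1 v)\<rparr>)"
  define st3 where "st3 = run N L (nbr_step ?bc ?cB ?f # suffix L) st2"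
  define st4 where "st4 = (\<lambda>v. (st3 v)\<lparr>cut := cut (st3 v) - acc (st3 v)\<rparr>)"
  define st5 where "st5 = run N L (nbr_step (\<lambda>st. [pid st]) ?cD ?f # suffix L) st4"
  define st6 where "st6 = (\<lambda>v. (st5 v)\<lparr>dn := xin (st5 v), dd := acc (st5 v), best := big_cut L,
       cutm := (if link \<or> off (st5 v) \<noteq> 0 then cut (st5 v) else big_cut L)\<rparr>)"
  have loc: "exec N L (local_step g) s = (\<lambda>v. g (s v))" for g s by (rule ext) simp
  have run: "run N L (cuts link L) st = st6"
    unfolding cuts_def st1_def st2_def st3_def st4_def st5_def st6_def
    by (simp only: run_Cons run_append loc run_Nil)
  note s1 = nbr_suffix[OF b disjI1[OF refl], of _ ?cA, folded st1_def]
  have e1: "pid (st1 v) = pid (st v)" "off (st1 v) = off (st v)" if "v \<in> V" for v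
    by (subst s1(1)[OF that], simp)+
  have b2: "base st2" using e1 by (intro base_exec[OF b]) (auto simp: st2_def)
  note s3 = nbr_suffix[OF b2 disjI1[OF refl], of _ ?cB, folded st3_def]
  have e3: "pid (st3 v) = pid (st2 v)" "off (st3 v) = off (st2 v)" "cut (st3 v) = cut (st2 v)" if "v \<in> V" for v
    by (subst s3(1)[OF that], simp)+
  have b4: "base st4" using e3 by (intro base_exec[OF b2]) (auto simp: st4_def)
  note s5 = nbr_suffix[OF b4 disjI2[OF refl], of _ ?cD, folded st5_def]
  have e5: "pid (st5 v) = pid (st4 v)" "off (st5 v) = off (st4 v)" "cut (st5 v) = cut (st4 v)" if "v \<in> V" for v
    by (subst s5(1)[OF that], simp)+
  have b6: "base st6" using e5 by (intro base_exec[OF b4]) (auto simp: st6_def)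
  have x5: "xin (st5 v) = Dn v" if "v \<in> V" for v
  proof -
    have "xin (st5 v) = (\<Sum>u | u \<in> V \<and> ?cD (vl [pid (st4 v)]) (vl [pid (st4 u)]). wt v u)"
      by (subst s5(1)[OF that]) simp
    also have "{u. u \<in> V \<and> ?cD (vl [pid (st4 v)]) (vl [pid (st4 u)])} = {u \<in> V'. pth u \<noteq> pth v}"
      using baseD(1)[OF b4] that by (auto simp: V'_pth)
    finally show ?thesis by (simp add: Dn_def)
  qed
  have D: "acc (st5 v) = D v" if v: "v \<in> V'" for v
  proof -
    have "acc (st5 v) = (\<Sum>x\<in>below v. \<Sum>u | u \<in> V \<and> ?cD (vl [pid (st4 x)]) (vl [pid (st4 u)]). wt x u)"
      using s5(2)[OF V'_V[OF v] v] .
    also have "\<dots> = (\<Sum>x\<in>below v. xin (st5 x))"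
      by (rule sum.cong[OF refl]) (subst s5(1)[OF below_V], auto)
    also have "\<dots> = D v" unfolding D_def using x5 below_V by (intro sum.cong) auto
    finally show ?thesis .
  qed
  have C: "cut (st6 v) = c1 v" if v: "v \<in> V'" for v
  proof -
    have "acc (st1 v) = (\<Sum>x\<in>below v. \<Sum>u | u \<in> V \<and> \<not> (pth u = pth x \<and> pos x < pos u). wt x u)"
      unfolding s1(2)[OF V'_V[OF v] v]
      by (intro sum.cong refl) (use baseD[OF b] below_V in auto)
    moreover have "acc (st3 v) = (\<Sum>x\<in>below v. \<Sum>u | u \<in> V \<and> pth u = pth x \<and> pos x < pos u. wt x u)"
      unfolding s3(2)[OF V'_V[OF v] v]
      by (intro sum.cong refl) (use baseD[OF b2] below_V in auto)
    moreover have "cut (st6 v) = acc (st1 v) - acc (st3 v)"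
      using e5[OF V'_V[OF v]] e3[OF V'_V[OF v]] by (simp add: st6_def st4_def st2_def)
    ultimately show ?thesis using c1_split[of v] by simp
  qed
  have M: "cutm (st6 v) = cm v" if v: "v \<in> V'" for v
  proof -
    have "off (st5 v) = pos v" using e5[OF V'_V[OF v]] baseD(2)[OF b4 V'_V[OF v]] by simp
    moreover have "cut (st5 v) = c1 v" using C[OF v] by (simp add: st6_def)
    ultimately show ?thesis using v unfolding st6_def cm_def elig_def by simp
  qed
  show "ready (run N L (cuts link L) st)" unfolding run ready_def
    using b6 C M D x5 V'_V by (auto simp: st6_def)
  show "v \<in> V \<Longrightarrow> best (run N L (cuts link L) st v) = big_cut L" unfolding run by (simp add: st6_def)
qed

end

section \<open>Finding the heavy partners of a path\<close>

text \<open>For the suffix of a path on which \<open>dd < 2 ^ Suc s\<close>, let \<open>F k\<close> be the weight of its edges to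
  paths with identifier below \<open>k\<close>. The search finds the greatest \<open>k\<close> with \<open>4 * F k < m * tot\<close>, a
  weighted quantile of the identifiers. A path that carries more than a quarter of \<open>tot\<close> is one of
  the four quantiles.\<close>

definition find_step :: "nat \<Rightarrow> nat \<Rightarrow> nat \<Rightarrow> nst step list" where
  "find_step s m b =
    [nbr_step (\<lambda>st. [pid st, kap st + 2 ^ b]) (\<lambda>x y. y 0 \<noteq> 0 \<and> y 0 \<noteq> x 0 \<and> y 0 < x 1) (\<lambda>st g. st\<lparr>xin := g\<rparr>),
     lab_step (\<lambda>_. 0) (\<lambda>st. [if dd st < 2 ^ Suc s then xin st else 0])
       (\<lambda>st S. if 4 * S 0 < m * tot st then st\<lparr>kap := kap st + 2 ^ b\<rparr> else st)]"

definition find_partner :: "nat \<Rightarrow> nat \<Rightarrow> nat \<Rightarrow> nst step list" where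
  "find_partner L s m =
    lab_step (\<lambda>_. 0) (\<lambda>st. [if dd st < 2 ^ Suc s then dn st else 0]) (\<lambda>st S. st\<lparr>tot := S 0, kap := 0\<rparr>) #
    concat (map (find_step s m) (rev [0..<Suc L]))"

text \<open>Binary search, high bit first, for the greatest argument that satisfies a downward
  closed predicate.\<close>

primrec descend :: "(nat \<Rightarrow> bool) \<Rightarrow> nat \<Rightarrow> nat \<Rightarrow> nat" where
  "descend P 0 k = k"
| "descend P (Suc b) k = descend P b (if P (k + 2 ^ b) then k + 2 ^ b else k)"

lemma descend_eq:
  assumes "\<And>j k. P j \<Longrightarrow> k \<le> j \<Longrightarrow> P k"
    and "P j" "\<not> P (Suc j)" "k = 0 \<or> P k" "j < k + 2 ^ b"
  shows "descend P b k = j"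
  using assms(4,5)
proof (induction b arbitrary: k)
  case 0
  then have "j \<le> k" by simp
  moreover have "k \<le> j" using 0 assms(1)[of k "Suc j"] assms(3) by (cases "k = 0") (auto simp: not_less_eq_eq[symmetric])
  ultimately show ?case by simp
next
  case (Suc b)
  show ?case
  proof (cases "P (k + 2 ^ b)")
    case True
    then show ?thesis using Suc.IH[of "k + 2 ^ b"] Suc.prems by simp
  next
    case False
    have "j < k + 2 ^ b" using False assms(1)[OF assms(2)] not_le by blast
    then show ?thesis using Suc.IH[of k] Suc.prems False by simp
  qed
qed

lemma descend_le: "k + 2 ^ b \<le> M \<Longrightarrow> descend P b k \<le> M"
  by (induction b arbitrary: k) auto

context star_prog begin

text \<open>A suffix of path \<open>i\<close>, because \<open>D\<close> does not grow away from the
  root. Indexing suffixes by magnitude and not by node leaves \<open>3 * L + 1\<close> relevant ones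
  for each path.\<close>

definition tail :: "nat \<Rightarrow> nat \<Rightarrow> node set" where
  "tail s i = {x \<in> V'. pth x = i \<and> D x < 2 ^ Suc s}"

definition tail_wt :: "nat \<Rightarrow> nat \<Rightarrow> nat \<Rightarrow> nat" where
  "tail_wt s i k = (\<Sum>x\<in>tail s i. \<Sum>u | u \<in> V' \<and> pth u \<noteq> i \<and> pth u < k. wt x u)"

definition quantile :: "nat \<Rightarrow> nat \<Rightarrow> nat \<Rightarrow> nat" where
  "quantile s m i = descend (\<lambda>k. 4 * tail_wt s i k < m * (\<Sum>x\<in>tail s i. Dn x)) (Suc L) 0"

lemma quantile_le: "quantile s m i \<le> 2 ^ Suc L"
  unfolding quantile_def by (rule descend_le) simp

lemma tail_sum:
  assumes "i \<noteq> 0" "\<And>u. u \<in> V' \<Longrightarrow> dd (st u) = D u"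
  shows "(\<Sum>u | u \<in> V \<and> pth u = i. if dd (st u) < 2 ^ Suc s then g u else 0) = (\<Sum>u\<in>tail s i. g u)"
proof -
  have "{u. u \<in> V \<and> pth u = i} = {u \<in> V'. pth u = i}" using assms by (auto simp: V'_pth)
  then have "(\<Sum>u | u \<in> V \<and> pth u = i. if dd (st u) < 2 ^ Suc s then g u else 0) =
    (\<Sum>u | u \<in> V' \<and> pth u = i. if D u < 2 ^ Suc s then g u else 0)"
    using assms(2) by (intro sum.cong) auto
  also have "\<dots> = (\<Sum>u\<in>{u \<in> {u \<in> V'. pth u = i}. D u < 2 ^ Suc s}. g u)"
    by (rule sum.inter_filter[symmetric]) simp
  also have "{u \<in> {u \<in> V'. pth u = i}. D u < 2 ^ Suc s} = tail s i" by (auto simp: tail_def)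
  finally show ?thesis .
qed

lemma find_step_run:
  fixes s m :: nat
  assumes R: "ready st" and k: "\<And>v. v \<in> V \<Longrightarrow> kap (st v) \<le> 2 ^ Suc L" and b: "b \<le> L" and v: "v \<in> V"
  defines "st' \<equiv> run N L (find_step s m b) st"
  shows "st' v = (st v)\<lparr>xin := xin (st' v), kap := kap (st' v)\<rparr>"
    "v \<in> V' \<Longrightarrow> (\<And>u. u \<in> V' \<Longrightarrow> pth u = pth v \<Longrightarrow> kap (st u) = kap (st v)) \<Longrightarrow> kap (st' v) =
      (if 4 * tail_wt s (pth v) (kap (st v) + 2 ^ b) < m * tot (st v) then kap (st v) + 2 ^ b else kap (st v))"
    "kap (st' v) = kap (st v) \<or> kap (st' v) = kap (st v) + 2 ^ b"
proof -
  have B: "base st" and dd: "\<And>u. u \<in> V' \<Longrightarrow> dd (st u) = D u" using R by (auto simp: ready_def)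
  let ?c = "\<lambda>x y :: vec. y 0 \<noteq> 0 \<and> y 0 \<noteq> x 0 \<and> y 0 < x 1"
  let ?s1 = "nbr_step (\<lambda>st. [pid st, kap st + 2 ^ b]) ?c (\<lambda>st g. st\<lparr>xin := g\<rparr>)"
  let ?h = "\<lambda>st. if dd st < 2 ^ Suc s then xin st else 0"
  let ?f = "\<lambda>st g. if 4 * g < m * tot st then st\<lparr>kap := kap st + 2 ^ b\<rparr> else st"
  let ?s2 = "lab_step (\<lambda>_. 0) (\<lambda>st. [?h st]) (\<lambda>st S. ?f st (S 0))"
  let ?e = "exec N L ?s1 st"
  have run: "st' = exec N L ?s2 ?e" by (simp add: st'_def find_step_def)
  have e: "?e v = (st v)\<lparr>xin := \<Sum>u | u \<in> V \<and> ?c (vl [pid (st v), kap (st v) + 2 ^ b]) (vl [pid (st u), kap (st u) + 2 ^ b]). wt v u\<rparr>"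
    if v: "v \<in> V" for v
  proof (rule nbr_exec[OF _ v])
    fix u assume u: "u \<in> V"
    have "kap (st u) + 2 ^ b \<le> 2 ^ Suc L + 2 ^ L" using k[OF u] b by (intro add_mono power_increasing) auto
    also have "\<dots> \<le> 2 ^ (1 * L + 2)" by simp
    finally have "kap (st u) + 2 ^ b < 2 ^ n" by (rule pow_width[rotated 2]) simp_all
    then show "length [pid (st u), kap (st u) + 2 ^ b] \<le> 8 \<and> (\<forall>x\<in>set [pid (st u), kap (st u) + 2 ^ b]. x < 2 ^ n)"
      using baseD[OF B u] small_width[OF pth_le[OF u]] by simp
  qed
  have b': "base ?e" using e by (intro base_exec[OF B]) auto
  have x: "?h (?e u) \<le> 2 ^ (4 * L)" if "u \<in> V" for u
  proof -
    have "xin (?e u) \<le> 2 ^ (2 * L)" using e[OF that] by (simp add: wt_sum_le)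
    also have "\<dots> \<le> 2 ^ (4 * L)" by (simp add: power_increasing)
    finally show ?thesis by simp
  qed
  have st': "st' v = ?f (?e v) (\<Sum>u | u \<in> V \<and> pth u = pth v. ?h (?e u))"
    unfolding run by (rule path_exec_sum[where h = ?h and f = ?f, OF b' v x])
  then show "st' v = (st v)\<lparr>xin := xin (st' v), kap := kap (st' v)\<rparr>"
    "kap (st' v) = kap (st v) \<or> kap (st' v) = kap (st v) + 2 ^ b" using e[OF v] by auto
  assume vV: "v \<in> V'" and same: "\<And>u. u \<in> V' \<Longrightarrow> pth u = pth v \<Longrightarrow> kap (st u) = kap (st v)"
  have "(\<Sum>u | u \<in> V \<and> pth u = pth v. ?h (?e u)) = (\<Sum>x\<in>tail s (pth v). xin (?e x))"
    by (rule tail_sum) (use vV pth_pos dd e V'_V in auto)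
  also have "\<dots> = tail_wt s (pth v) (kap (st v) + 2 ^ b)" unfolding tail_wt_def
  proof (rule sum.cong[OF refl])
    fix x assume "x \<in> tail s (pth v)"
    then have xx: "x \<in> V'" "pth x = pth v" by (auto simp: tail_def)
    have "{u. u \<in> V \<and> ?c (vl [pid (st x), kap (st x) + 2 ^ b]) (vl [pid (st u), kap (st u) + 2 ^ b])} =
      {u. u \<in> V' \<and> pth u \<noteq> pth v \<and> pth u < kap (st v) + 2 ^ b}"
      using baseD(1)[OF B] V'_V[OF xx(1)] xx same[OF xx] by (auto simp: V'_pth)
    then show "xin (?e x) = (\<Sum>u | u \<in> V' \<and> pth u \<noteq> pth v \<and> pth u < kap (st v) + 2 ^ b. wt x u)"
      using e[OF V'_V[OF xx(1)]] by simp
  qed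
  finally show "kap (st' v) = (if 4 * tail_wt s (pth v) (kap (st v) + 2 ^ b) < m * tot (st v) then kap (st v) + 2 ^ b else kap (st v))"
    using st' e[OF v] by simp
qed

text \<open>The fields that stay fixed once \<open>cuts\<close> has run. Since \<open>ready\<close>
  depends on them alone, it is preserved by every step that keeps them.\<close>

definition core :: "nst \<Rightarrow> nat \<times> nat \<times> nat \<times> nat \<times> nat \<times> nat" where
  "core x = (pid x, off x, cut x, cutm x, dn x, dd x)"

lemma ready_cong:
  assumes "ready st" "\<And>v. v \<in> V \<Longrightarrow> core (st' v) = core (st v)"
  shows "ready st'"
  using assms V'_V by (auto simp: ready_def base_def core_def)

lemma find_steps_run:
  fixes s m :: nat
  assumes "ready st" "\<And>v. v \<in> V \<Longrightarrow> kap (st v) + 2 ^ b \<le> 2 ^ Suc L" "b \<le> Suc L"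
    and "\<And>v. v \<in> V' \<Longrightarrow> kap (st v) = kf (pth v) \<and> tot (st v) = tf (pth v)"
    and "v \<in> V"
  defines "ss \<equiv> \<lambda>b. concat (map (find_step s m) (rev [0..<b]))"
  shows "run N L (ss b) st v = (st v)\<lparr>xin := xin (run N L (ss b) st v), kap := kap (run N L (ss b) st v)\<rparr> \<and>
    (v \<in> V' \<longrightarrow> kap (run N L (ss b) st v) = descend (\<lambda>k. 4 * tail_wt s (pth v) k < m * tf (pth v)) b (kf (pth v)))"
  using assms(1-5)
proof (induction b arbitrary: st kf)
  case 0
  then show ?case by (simp add: ss_def)
next
  case (Suc b)
  let ?e = "run N L (find_step s m b) st"
  have k: "kap (st v) \<le> 2 ^ Suc L" if "v \<in> V" for v
    by (rule add_leD1[OF Suc.prems(2)[OF that]])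
  have b: "b \<le> L" using Suc.prems(3) by simp
  note F = find_step_run[OF Suc.prems(1) k b, of _ s m]
  have fr: "?e v = (st v)\<lparr>xin := xin (?e v), kap := kap (?e v)\<rparr>" if "v \<in> V" for v
    by (rule F(1)[OF _ that])
  have R: "ready ?e"
    by (rule ready_cong[OF Suc.prems(1)]) (subst fr, simp, simp add: core_def)
  have t: "tot (?e v) = tot (st v)" if "v \<in> V" for v by (subst fr[OF that]) simp
  define kf' where "kf' i = (if 4 * tail_wt s i (kf i + 2 ^ b) < m * tf i then kf i + 2 ^ b else kf i)" for i
  have k': "kap (?e v) = kf' (pth v) \<and> tot (?e v) = tf (pth v)" if v: "v \<in> V'" for v
    using F(2)[OF _ V'_V[OF v] v] Suc.prems(4) v t[OF V'_V[OF v]] by (simp add: kf'_def)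
  have le: "kap (?e v) + 2 ^ b \<le> 2 ^ Suc L" if "v \<in> V" for v
    using F(3)[OF _ that] Suc.prems(2)[OF that] by auto
  have ss: "ss (Suc b) = find_step s m b @ ss b" by (simp add: ss_def)
  have "b \<le> Suc L" using b by simp
  note IH = Suc.IH[OF R le this k' Suc.prems(5)]
  have "run N L (ss b) ?e v = (st v)\<lparr>xin := xin (run N L (ss b) ?e v), kap := kap (run N L (ss b) ?e v)\<rparr>"
  proof -
    have "(?e v)\<lparr>xin := x, kap := k\<rparr> = (st v)\<lparr>xin := x, kap := k\<rparr>" for x k
      by (subst fr[OF Suc.prems(5)]) simp
    then show ?thesis using conjunct1[OF IH] by (rule trans[rotated])
  qed
  then show ?case unfolding ss run_append using conjunct2[OF IH] by (simp add: kf'_def)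
qed

lemma find_partner_run:
  fixes s m :: nat
  assumes R: "ready st" and v: "v \<in> V"
  defines "st' \<equiv> run N L (find_partner L s m) st"
  shows "st' v = (st v)\<lparr>tot := tot (st' v), xin := xin (st' v), kap := kap (st' v)\<rparr>"
    "v \<in> V' \<Longrightarrow> kap (st' v) = quantile s m (pth v)"
proof -
  have B: "base st" and dd: "\<And>u. u \<in> V' \<Longrightarrow> dd (st u) = D u" and dn: "\<And>u. u \<in> V' \<Longrightarrow> dn (st u) = Dn u"
    using R by (auto simp: ready_def)
  let ?h = "\<lambda>st. if dd st < 2 ^ Suc s then dn st else 0"
  let ?f = "\<lambda>st S. st\<lparr>tot := S 0, kap := 0\<rparr>"
  let ?s = "lab_step (\<lambda>_. 0) (\<lambda>st. [?h st]) ?f"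
  let ?e = "exec N L ?s st"
  note le = lab_exec[where lab = "\<lambda>_. 0" and st = st and h = "\<lambda>st. [?h st]" and f = ?f, OF B]
  have fr: "?e v = (st v)\<lparr>tot := tot (?e v), kap := 0\<rparr>" if "v \<in> V" for v
    using le[OF _ _ that] by simp
  have T: "tot (?e v) = (\<Sum>x\<in>tail s (pth v). Dn x)" if v: "v \<in> V'" for v
  proof -
    let ?K = "{u. u \<in> V \<and> pth u = pth v}"
    have sum: "(\<Sum>u\<in>?K. ?h (st u)) = (\<Sum>u\<in>tail s (pth v). dn (st u))"
      by (rule tail_sum) (use pth_pos[OF v] dd in auto)
    also have eq: "\<dots> = (\<Sum>x\<in>tail s (pth v). Dn x)" using dn by (intro sum.cong) (auto simp: tail_def)
    also have "\<dots> \<le> 2 ^ L * 2 ^ (2 * L)" using Dn_le by (intro sum_le) (auto simp: tail_def V'_def)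
    also have "\<dots> = 2 ^ (3 * L + 0)" by (simp flip: power_add)
    finally have "(\<Sum>u\<in>?K. ?h (st u)) < 2 ^ n" by (rule pow_width[rotated 2]) simp_all
    then have "vagg n (\<lambda>u. vl [?h (st u)]) ?K 0 = (\<Sum>u\<in>?K. ?h (st u))"
      using vagg_sum[of 0 "\<lambda>u. vl [?h (st u)]" ?K n] by simp
    moreover have "?e v = (st v)\<lparr>tot := vagg n (\<lambda>u. vl [?h (st u)]) ?K 0, kap := 0\<rparr>"
      using le[OF _ _ V'_V[OF v]] by simp
    ultimately show ?thesis using sum eq by simp
  qed
  have Re: "ready ?e" by (rule ready_cong[OF R]) (subst fr, simp, simp add: core_def)
  have k0: "kap (?e v) = 0" if "v \<in> V" for v by (subst fr[OF that]) simp
  have st': "st' = run N L (concat (map (find_step s m) (rev [0..<Suc L]))) ?e"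
    by (simp only: st'_def find_partner_def run_Cons)
  have F: "st' v = (?e v)\<lparr>xin := xin (st' v), kap := kap (st' v)\<rparr> \<and>
    (v \<in> V' \<longrightarrow> kap (st' v) = descend (\<lambda>k. 4 * tail_wt s (pth v) k < m * (\<Sum>x\<in>tail s (pth v). Dn x)) (Suc L) 0)"
    unfolding st' by (rule find_steps_run[OF Re _ _ _ v, of "Suc L" "\<lambda>_. 0"]) (use k0 T V'_V in auto)
  then have a: "st' v = (?e v)\<lparr>xin := xin (st' v), kap := kap (st' v)\<rparr>" ..
  have t: "tot (st' v) = tot (?e v)" by (subst a) simp
  have "st' v = (st v)\<lparr>tot := tot (?e v), kap := 0, xin := xin (st' v), kap := kap (st' v)\<rparr>"
    by (rule trans[OF a], subst fr[OF v]) simp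
  then show "st' v = (st v)\<lparr>tot := tot (st' v), xin := xin (st' v), kap := kap (st' v)\<rparr>"
    unfolding t by simp
  show "v \<in> V' \<Longrightarrow> kap (st' v) = quantile s m (pth v)" using F by (simp add: quantile_def)
qed

lemma heavy_quantile:
  assumes j: "j \<noteq> 0" "j \<le> 2 ^ L" "j \<noteq> i"
    and heavy: "(\<Sum>x\<in>tail s i. Dn x) < 4 * (\<Sum>x\<in>tail s i. \<Sum>u | u \<in> V' \<and> pth u = j. wt x u)"
    and pos: "0 < (\<Sum>x\<in>tail s i. Dn x)"
  obtains m where "m \<in> {1..4}" "quantile s m i = j"
proof -
  let ?T = "\<Sum>x\<in>tail s i. Dn x"
  let ?w = "\<Sum>x\<in>tail s i. \<Sum>u | u \<in> V' \<and> pth u = j. wt x u"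
  have Suc: "tail_wt s i (Suc j) = tail_wt s i j + ?w"
  proof -
    have "{u. u \<in> V' \<and> pth u \<noteq> i \<and> pth u < Suc j} = {u. u \<in> V' \<and> pth u \<noteq> i \<and> pth u < j} \<union> {u. u \<in> V' \<and> pth u = j}"
      using j(3) by auto
    then have "(\<Sum>u | u \<in> V' \<and> pth u \<noteq> i \<and> pth u < Suc j. wt x u) =
      (\<Sum>u | u \<in> V' \<and> pth u \<noteq> i \<and> pth u < j. wt x u) + (\<Sum>u | u \<in> V' \<and> pth u = j. wt x u)" for x
      by (simp only:, intro sum.union_disjoint) auto
    then show ?thesis by (simp add: tail_wt_def sum.distrib)
  qed
  have mono: "tail_wt s i k \<le> tail_wt s i k'" if "k \<le> k'" for k k'
    unfolding tail_wt_def using that by (intro sum_mono sum_mono2) auto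
  have le: "tail_wt s i k \<le> ?T" for k
    unfolding tail_wt_def
  proof (rule sum_mono)
    fix x assume "x \<in> tail s i"
    then have "pth x = i" by (simp add: tail_def)
    then show "(\<Sum>u | u \<in> V' \<and> pth u \<noteq> i \<and> pth u < k. wt x u) \<le> Dn x"
      unfolding Dn_def by (intro sum_mono2) auto
  qed
  \<comment> \<open>The least \<open>m\<close> for which the weight before path \<open>j\<close> is
    below the threshold \<open>m * ?T / 4\<close>. Path \<open>j\<close> adds more than a quarter of
    \<open>?T\<close>, so the threshold is reached right after it; and \<open>m \<le> 4\<close>
    since the weight never exceeds \<open>?T\<close>.\<close>
  define m where "m = Suc (4 * tail_wt s i j div ?T)"
  have m1: "4 * tail_wt s i j < m * ?T"
    unfolding m_def using pos by (metis dividend_less_div_times mult.commute mult_Suc)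
  have "4 * tail_wt s i j div ?T * ?T \<le> 4 * tail_wt s i j" by simp
  then have "?T + 4 * tail_wt s i j div ?T * ?T \<le> ?T + 4 * tail_wt s i j" by (rule add_left_mono)
  moreover have "m * ?T = ?T + 4 * tail_wt s i j div ?T * ?T" by (simp add: m_def)
  ultimately have "m * ?T \<le> ?T + 4 * tail_wt s i j" by (simp only:)
  also have "\<dots> \<le> 4 * tail_wt s i (Suc j)" unfolding Suc using heavy by (simp add: distrib_left)
  finally have m2: "m * ?T \<le> 4 * tail_wt s i (Suc j)" .
  have "m * ?T \<le> 4 * ?T" by (rule le_trans[OF m2]) (use le[of "Suc j"] in simp)
  then have "m \<le> 4" using pos by simp
  then have "m \<in> {1..4}" by (simp add: m_def)
  moreover have "quantile s m i = j" unfolding quantile_def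
  proof (rule descend_eq)
    show "4 * tail_wt s i k < m * ?T" if "4 * tail_wt s i k' < m * ?T" "k \<le> k'" for k k'
      using mono[OF that(2)] that(1) by simp
    show "j < 0 + 2 ^ Suc L" using j(2) le_less_trans[of j "2 ^ L" "2 ^ Suc L"] by simp
  qed (use m1 m2 in auto)
  ultimately show thesis by (rule that)
qed

text \<open>The assumption \<open>c1 a < 2 * W a b\<close> says that the cut of the pair is smaller than that of \<open>b\<close> alone.\<close>

lemma interested:
  assumes a: "a \<in> V'" and b: "b \<in> V'" and ne: "pth a \<noteq> pth b" and W: "c1 a < 2 * W a b"
  obtains s m where "s \<le> 3 * L" "m \<in> {1..4}" "quantile s m (pth a) = pth b"
proof -
  let ?w = "\<lambda>A. \<Sum>x\<in>A. \<Sum>u | u \<in> V' \<and> pth u = pth b. wt x u"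
  have Dc: "D a \<le> c1 a" unfolding D_def c1_def Dn_def
    using finite_V by (intro sum_mono sum_mono2) (auto simp: below_def V'_def)
  have Wb: "W a b \<le> ?w (below a)" unfolding W_def
    by (intro sum_mono sum_mono2) (auto simp: below_def)
  have wD: "?w A \<le> (\<Sum>x\<in>A. Dn x)" if "\<And>x. x \<in> A \<Longrightarrow> pth x = pth a" for A
    unfolding Dn_def using ne that by (intro sum_mono sum_mono2) auto
  have DW: "D a < 2 * W a b" using Dc W by simp
  have "W a b \<le> D a" using Wb wD[of "below a"] by (simp add: D_def below_def)
  then have D0: "0 < D a" using W by simp
  have Dle: "D v \<le> 2 ^ (3 * L)" for v
  proof -
    have "D v \<le> 2 ^ L * 2 ^ (2 * L)" unfolding D_def using below_sub Dn_le by (intro sum_le) auto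
    then show ?thesis by (simp flip: power_add)
  qed
  \<comment> \<open>The magnitude of \<open>D a\<close> is the right scale: the tail then contains
    \<open>below a\<close>, while its weight is below
    \<open>2 ^ Suc s \<le> 2 * D a < 4 * W a b\<close>.\<close>
  obtain s where s: "2 ^ s \<le> D a" "D a < 2 ^ Suc s"
    using ex_power_ivl1[of 2 "D a"] D0 by auto
  have "(2::nat) ^ s \<le> 2 ^ (3 * L)" using s(1) Dle[of a] by (rule le_trans)
  then have s3: "s \<le> 3 * L" using power_increasing_iff[of "2::nat" s "3 * L"] by simp
  let ?t = "tail s (pth a)"
  have Dmono: "D v \<le> D u" if "u \<in> V'" "v \<in> V'" "pth u = pth v" "pos u \<le> pos v" for u v
    unfolding D_def using that by (intro sum_mono2) (auto simp: below_def)
  have sub: "below a \<subseteq> ?t"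
  proof
    fix x assume "x \<in> below a"
    then have x: "x \<in> V'" "pth x = pth a" "pos a \<le> pos x" by (auto simp: below_def)
    then show "x \<in> ?t" using Dmono[OF a x(1)] s(2) by (simp add: tail_def)
  qed
  have fin: "finite ?t" by (simp add: tail_def)
  have at: "a \<in> ?t" using sub a by (auto simp: below_def)
  \<comment> \<open>The tail lies below its own topmost node, which belongs to the tail and
    therefore satisfies the bound.\<close>
  have T: "(\<Sum>x\<in>?t. Dn x) < 2 ^ Suc s"
  proof -
    obtain t0 where t0: "t0 \<in> ?t" "\<And>x. x \<in> ?t \<Longrightarrow> pos t0 \<le> pos x"
      using at ex_has_least_nat[of "\<lambda>x. x \<in> ?t" a pos] by auto
    have "?t \<subseteq> below t0" using t0 by (auto simp: tail_def below_def)
    then have "(\<Sum>x\<in>?t. Dn x) \<le> D t0" unfolding D_def by (intro sum_mono2) auto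
    then show ?thesis using t0(1) by (simp add: tail_def)
  qed
  have "?w (below a) \<le> ?w ?t" using sub fin by (intro sum_mono2) auto
  then have heavy: "(\<Sum>x\<in>?t. Dn x) < 4 * ?w ?t" using T s(1) DW Wb by simp
  have "?w ?t \<le> (\<Sum>x\<in>?t. Dn x)" by (rule wD) (simp add: tail_def)
  then have "0 < (\<Sum>x\<in>?t. Dn x)" using heavy by linarith
  then obtain m where "m \<in> {1..4}" "quantile s m (pth a) = pth b"
    using heavy_quantile[OF pth_pos[OF b] pth_le[OF V'_V[OF b]] ne[symmetric] heavy] by blast
  then show thesis using that[OF s3] by blast
qed

end

section \<open>Minimising over a pair of paths\<close>

text \<open>The middle row of block \<open>k\<close>, at which it splits into the blocks
  \<open>2 * k\<close> and \<open>2 * k + 1\<close> of the next level. For \<open>l = 0\<close> the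
  block is the single row \<open>k\<close>, which is its own middle.\<close>

definition thr :: "nat \<Rightarrow> nat \<Rightarrow> nat" where
  "thr l k = k * 2 ^ l + 2 ^ l div 2"

text \<open>Broadcasts start with \<open>pid\<close>, \<open>off\<close>, \<open>kl\<close>,
  \<open>kr\<close>; here \<open>a\<close> is on the left path and \<open>b\<close> on the right
  one. A path may be left in one pair and right in another at the same time, so the two roles keep
  separate fields, with \<open>xin\<close> and \<open>acc\<close> serving both in turn.\<close>

definition matched :: "vec \<Rightarrow> vec \<Rightarrow> bool" where
  "matched a b \<longleftrightarrow> a 0 \<noteq> 0 \<and> b 0 \<noteq> 0 \<and> a 0 \<noteq> b 0 \<and> a 2 = b 0 \<and> b 3 = a 0"

text \<open>The edges between a block and its interval are the only channel to the left path. The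
  successor on the position keeps 0 for the case that there is no such edge.\<close>

definition send_left :: "nat \<Rightarrow> nst step" where
  "send_left l = \<lparr> bcast = \<lambda>st. vl [pid st, off st, kl st, kr st, rk st, qs st, bs st, cq st],
     reply = \<lambda>w d x y. if matched x y \<and> y 4 = x 1 div 2 ^ l then vl [0, 0, Suc (y 5), y 6, y 7] else vl [],
     join = \<lambda>p c. p 0 \<noteq> 0 \<and> p 1 div 2 ^ l = c 1 div 2 ^ l,
     share = \<lambda>_ G. vl [0, 0, G 2, G 3, G 4],
     update = \<lambda>st _ S. st\<lparr>lq := S 2, lb := S 3, lc := S 4\<rparr> \<rparr>"

text \<open>Packing the objective above \<open>L\<close> bits of position lets one maximum return
  the optimum together with its place; \<open>big_cut L\<close> keeps the difference nonnegative. In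
  the update of \<open>best\<close>, the weight shared by the two suffixes is split at the end of
  the block: \<open>acc\<close> belongs to the rows inside it, \<open>lb\<close> to the rows beyond
  against the interval from \<open>qs\<close> on, \<open>gam\<close> to the rows beyond against what
  follows the interval.\<close>

definition level :: "nat \<Rightarrow> nat \<Rightarrow> nst step list" where
  "level L l =
    nbr_step (\<lambda>st. [pid st, off st, kl st, kr st, rk st]) (\<lambda>x y. matched y x \<and> thr l (x 4) \<le> y 1)
      (\<lambda>st g. st\<lparr>xin := g\<rparr>) #
    suffix L @
    [nbr_step (\<lambda>st. [pid st, off st, kl st, kr st, rk st]) (\<lambda>x y. matched y x \<and> Suc (x 4) * 2 ^ l \<le> y 1)
      (\<lambda>st g. st\<lparr>bet := g\<rparr>),
     lab_step rk (\<lambda>st. [0, 0, (big_cut L + 2 * acc st - cutm st) * 2 ^ L + off st])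
      (\<lambda>st S. st\<lparr>qs := S 2 mod 2 ^ L\<rparr>),
     lab_step rk (\<lambda>st. [if qs st \<le> off st then bet st else 0, 0, if off st = qs st then cutm st else 0])
      (\<lambda>st S. st\<lparr>bs := S 0, cq := S 2\<rparr>),
     send_left l,
     nbr_step (\<lambda>st. [pid st, off st, kl st, kr st, lq st]) (\<lambda>x y. matched x y \<and> x 4 \<noteq> 0 \<and> x 4 \<le> Suc (y 1))
      (\<lambda>st g. st\<lparr>xin := g\<rparr>)] @
    suffix l @
    [local_step (\<lambda>st. st\<lparr>best := if lq st = 0 then best st
       else min (best st) (cutm st + lc st - 2 * (acc st + lb st + gam st))\<rparr>),
     lab_step (\<lambda>st. off st div 2 ^ l) (\<lambda>st. [if thr l (off st div 2 ^ l) \<le> off st then xin st else 0])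
      (\<lambda>st S. st\<lparr>gam := if lq st \<noteq> 0 \<and> off st < thr l (off st div 2 ^ l) then S 0 + lb st + gam st else gam st,
         rk := 2 * rk st + (if qs st \<le> off st then 1 else 0)\<rparr>)]"

lemma vagg_less: "finite K \<Longrightarrow> vagg n f K i < 2 ^ n"
  by (auto simp: vagg_def)

context star_prog begin

section \<open>What one level computes, in terms of sums of weights\<close>

definition mt :: "(node \<Rightarrow> nst) \<Rightarrow> node \<Rightarrow> node \<Rightarrow> bool" where
  "mt st a b \<longleftrightarrow> a \<in> V' \<and> b \<in> V' \<and> pth a \<noteq> pth b \<and> kl (st a) = pth b \<and> kr (st b) = pth a"

definition J :: "(node \<Rightarrow> nst) \<Rightarrow> node \<Rightarrow> node set" where
  "J st v = {u \<in> V. pth u = pth v \<and> rk (st u) = rk (st v)}"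

definition Xf :: "nat \<Rightarrow> (node \<Rightarrow> nst) \<Rightarrow> node \<Rightarrow> nat" where
  "Xf l st v = (\<Sum>u | u \<in> V \<and> mt st u v \<and> thr l (rk (st v)) \<le> pos u. wt v u)"

definition Bf :: "nat \<Rightarrow> (node \<Rightarrow> nst) \<Rightarrow> node \<Rightarrow> nat" where
  "Bf l st v = (\<Sum>u | u \<in> V \<and> mt st u v \<and> Suc (rk (st v)) * 2 ^ l \<le> pos u. wt v u)"

definition level_pre :: "nat \<Rightarrow> (node \<Rightarrow> nst) \<Rightarrow> bool" where
  "level_pre l st \<longleftrightarrow> ready st \<and>
     (\<forall>v\<in>V. kl (st v) \<le> 2 ^ Suc L \<and> kr (st v) \<le> 2 ^ Suc L \<and> rk (st v) < 2 ^ (L - l)) \<and>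
     (\<forall>u\<in>V'. \<forall>v\<in>V'. pth u = pth v \<longrightarrow> kl (st u) = kl (st v) \<and> kr (st u) = kr (st v)) \<and>
     (\<forall>u\<in>V'. \<forall>v\<in>V'. pth u = pth v \<longrightarrow> pos u \<le> pos v \<longrightarrow> rk (st u) \<le> rk (st v))"

text \<open>An edge over which the block of \<open>a\<close> hears from its interval.\<close>

definition active :: "nat \<Rightarrow> (node \<Rightarrow> nst) \<Rightarrow> node \<Rightarrow> node \<Rightarrow> node \<Rightarrow> bool" where
  "active l st a a' b \<longleftrightarrow> a' \<in> blk l a \<and> mt st a' b \<and> {a', b} \<in> E \<and> rk (st b) = pos a div 2 ^ l"

text \<open>\<open>qf v\<close> is the position of the best node of the interval \<open>J st v\<close>.\<close>

definition level_post :: "nat \<Rightarrow> (node \<Rightarrow> nst) \<Rightarrow> (node \<Rightarrow> nat) \<Rightarrow> (node \<Rightarrow> nst) \<Rightarrow> bool" where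
  "level_post l st qf st' \<longleftrightarrow>
     (\<forall>v\<in>V. core (st' v) = core (st v) \<and> kl (st' v) = kl (st v) \<and> kr (st' v) = kr (st v) \<and>
        rk (st' v) = 2 * rk (st v) + (if qf v \<le> pos v then 1 else 0)) \<and>
     (\<forall>u\<in>V. \<forall>v\<in>V. J st u = J st v \<longrightarrow> qf u = qf v) \<and>
     (\<forall>v\<in>V'. \<exists>q\<in>J st v. pos q = qf v \<and>
        (\<forall>b\<in>J st v. cm q + 2 * (\<Sum>u\<in>below b. Xf l st u) \<le> cm b + 2 * (\<Sum>u\<in>below q. Xf l st u))) \<and>
     (\<forall>a\<in>V'. (\<nexists>a' b. active l st a a' b) \<longrightarrow> best (st' a) = best (st a) \<and> gam (st' a) = gam (st a)) \<and>
     (\<forall>a\<in>V'. \<forall>a' b q. active l st a a' b \<longrightarrow> q \<in> J st b \<longrightarrow> pos q = qf b \<longrightarrow>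
        best (st' a) = min (best (st a)) (cm a + cm q - 2 *
          ((\<Sum>x\<in>bsuf l a. \<Sum>u | u \<in> V \<and> mt st x u \<and> pos q \<le> pos u. wt x u) +
           (\<Sum>u | u \<in> J st b \<and> pos q \<le> pos u. Bf l st u) + gam (st a))) \<and>
        gam (st' a) = (if pos a < thr l (pos a div 2 ^ l) then
          (\<Sum>x | x \<in> blk l a \<and> thr l (pos a div 2 ^ l) \<le> pos x. \<Sum>u | u \<in> V \<and> mt st x u \<and> pos q \<le> pos u. wt x u) +
           (\<Sum>u | u \<in> J st b \<and> pos q \<le> pos u. Bf l st u) + gam (st a) else gam (st a)))"

lemma Xf_le: "Xf l st v \<le> 2 ^ (2 * L)" and Bf_le: "Bf l st v \<le> 2 ^ (2 * L)"
  by (auto simp: Xf_def Bf_def intro!: wt_sum_le)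

lemma cm_le: "cm v \<le> big_cut L"
  using c1_le[of v] by (auto simp: cm_def big_cut_def intro: order_trans)

context
  fixes l :: nat and st :: "node \<Rightarrow> nst"
  assumes pre: "level_pre l st" and lL: "l \<le> L"
begin

lemma pre_ready: "ready st" and pre_base: "base st"
  using pre by (auto simp: level_pre_def ready_def)

lemma pre_small:
  assumes "v \<in> V"
  shows "pid (st v) < 2 ^ n" "off (st v) < 2 ^ n" "kl (st v) < 2 ^ n" "kr (st v) < 2 ^ n" "rk (st v) < 2 ^ n"
proof -
  show "pid (st v) < 2 ^ n" "off (st v) < 2 ^ n"
    using baseD[OF pre_base assms] small_width pth_le[OF assms] less_imp_le[OF pos_less[OF assms]] by simp_all
  have *: "x < 2 ^ n" if "x \<le> 2 ^ Suc L" for x :: nat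
    using pow_width[of 1 1 x] that by simp
  show "kl (st v) < 2 ^ n" "kr (st v) < 2 ^ n"
    using pre assms by (auto simp: level_pre_def intro!: *)
  have "rk (st v) \<le> 2 ^ (L - l)" using pre assms by (auto simp: level_pre_def intro: less_imp_le)
  also have "\<dots> \<le> 2 ^ L" by (rule power_increasing) auto
  finally show "rk (st v) < 2 ^ n" by (rule small_width)
qed

lemma mtD: "mt st a b \<Longrightarrow> a \<in> V" "mt st a b \<Longrightarrow> b \<in> V" "mt st a b \<Longrightarrow> a \<in> V'" "mt st a b \<Longrightarrow> b \<in> V'"
  by (auto simp: mt_def V'_def)

lemma matched_iff:
  assumes "a \<in> V" "b \<in> V"
  shows "matched (vl (pid (st a) # x # kl (st a) # xs)) (vl (pid (st b) # y # y' # kr (st b) # ys)) \<longleftrightarrow> mt st a b"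
  using baseD(1)[OF pre_base assms(1)] baseD(1)[OF pre_base assms(2)] assms
  by (auto simp: matched_def mt_def V'_pth)

lemma rk_mono: "u \<in> V' \<Longrightarrow> v \<in> V' \<Longrightarrow> pth u = pth v \<Longrightarrow> pos u \<le> pos v \<Longrightarrow> rk (st u) \<le> rk (st v)"
  using pre by (auto simp: level_pre_def)

lemma J_sub: "J st v \<subseteq> V" and finite_J: "finite (J st v)"
  using finite_V by (auto simp: J_def)

definition "opt v = vagg n (\<lambda>u. vl [0, 0, (big_cut L + 2 * (\<Sum>u\<in>bsuf L u. Xf l st u) - cutm (st u)) * 2 ^ L + pos u]) (J st v) 2 mod 2 ^ L"

lemma opt_less: "opt v < 2 ^ L"
  by (simp add: opt_def)

lemma opt_spec:
  assumes v: "v \<in> V'"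
  shows "\<exists>q\<in>J st v. pos q = opt v \<and>
        (\<forall>b\<in>J st v. cm q + 2 * (\<Sum>u\<in>below b. Xf l st u) \<le> cm b + 2 * (\<Sum>u\<in>below q. Xf l st u))"
proof -
  define val where "val u = big_cut L + 2 * (\<Sum>u\<in>bsuf L u. Xf l st u) - cutm (st u)" for u
  define F where "F u = val u * 2 ^ L + pos u" for u
  have JV: "u \<in> V'" "u \<in> V" if "u \<in> J st v" for u
    using that pth_pos[OF v] by (auto simp: J_def V'_pth)
  have vJ: "v \<in> J st v" using V'_V[OF v] by (simp add: J_def)
  have "Max (F ` J st v) \<in> F ` J st v" using vJ finite_J by (intro Max_in) auto
  then obtain q where q: "q \<in> J st v" "F q = Max (F ` J st v)" by auto
  then have q: "q \<in> J st v" "\<And>u. u \<in> J st v \<Longrightarrow> F u \<le> F q" using finite_J by auto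
  have cut: "cutm (st u) = cm u" if "u \<in> J st v" for u
    using pre_ready JV[OF that] by (auto simp: ready_def)
  have suf: "(\<Sum>u\<in>bsuf L u. Xf l st u) = (\<Sum>u\<in>below u. Xf l st u)" if "u \<in> J st v" for u
    using bsuf_full[OF JV(1)[OF that]] by simp
  have X: "(\<Sum>u\<in>below u. Xf l st u) \<le> 2 ^ (3 * L)" for u
  proof -
    have "(\<Sum>u\<in>below u. Xf l st u) \<le> 2 ^ L * 2 ^ (2 * L)" using below_sub Xf_le by (intro sum_le) auto
    then show ?thesis by (simp flip: power_add)
  qed
  have Fq: "F q < 2 ^ n"
  proof -
    have "val q \<le> 2 ^ (3 * L + 2) + 2 * 2 ^ (3 * L)"
      unfolding val_def suf[OF q(1)] big_cut_def using X[of q] by linarith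
    also have "\<dots> \<le> 2 ^ (3 * L + 3)" by (simp add: power_add)
    finally have "val q * 2 ^ L \<le> 2 ^ (3 * L + 3) * 2 ^ L" by simp
    moreover have "(2::nat) ^ (3 * L + 3) * 2 ^ L = 2 ^ (4 * L + 3)" by (simp flip: power_add)
    moreover have "pos q \<le> 2 ^ L" using pos_less[OF JV(2)[OF q(1)]] by simp
    moreover have "(2::nat) ^ L \<le> 2 ^ (4 * L + 3)" by (rule power_increasing) auto
    moreover have "(2::nat) ^ (4 * L + 4) = 2 ^ (4 * L + 3) + 2 ^ (4 * L + 3)" by (simp add: power_add)
    ultimately have "F q \<le> 2 ^ (4 * L + 4)" unfolding F_def by linarith
    then show ?thesis by (rule pow_width[rotated 2]) simp_all
  qed
  have "vagg n (\<lambda>u. vl [0, 0, F u]) (J st v) 2 = F q"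
    by (rule vagg_max_eqI) (use finite_J q Fq in auto)
  then have "opt v = F q mod 2 ^ L" unfolding opt_def F_def val_def by simp
  also have "\<dots> = pos q" using pos_less[OF JV(2)[OF q(1)]] by (simp add: F_def)
  finally have p: "pos q = opt v" by simp
  have "cm q + 2 * (\<Sum>u\<in>below b. Xf l st u) \<le> cm b + 2 * (\<Sum>u\<in>below q. Xf l st u)" if b: "b \<in> J st v" for b
  proof -
    \<comment> \<open>The packed numbers compare lexicographically: positions are below
      \<open>2 ^ L\<close>, so they cannot make up for a difference of the objective.\<close>
    have "val b \<le> val q"
    proof (rule ccontr)
      assume "\<not> val b \<le> val q"
      then have "Suc (val q) * 2 ^ L \<le> val b * 2 ^ L" by (intro mult_le_mono1) simp
      then have "F q < F b" using pos_less[OF JV(2)[OF q(1)]] unfolding F_def by simp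
      then show False using q(2)[OF b] by simp
    qed
    then show ?thesis unfolding val_def suf[OF b] suf[OF q(1)] cut[OF b] cut[OF q(1)]
      using cm_le[of b] cm_le[of q] by linarith
  qed
  then show ?thesis using q(1) p by blast
qed

lemma J_cong: "J st u = J st v \<Longrightarrow> opt u = opt v"
  by (simp add: opt_def)

lemma J_eq: "u \<in> J st v \<Longrightarrow> J st u = J st v"
  by (auto simp: J_def)

definition "bsum v = (\<Sum>u | u \<in> J st v \<and> opt v \<le> pos u. Bf l st u)"

lemma loc: "exec N L (local_step g) s = (\<lambda>v. g (s v))"
  by (rule ext) simp

lemma right_run:
  assumes v: "v \<in> V"
  defines "ss \<equiv> nbr_step (\<lambda>st. [pid st, off st, kl st, kr st, rk st]) (\<lambda>x y. matched y x \<and> thr l (x 4) \<le> y 1)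
      (\<lambda>st g. st\<lparr>xin := g\<rparr>) #
    suffix L @
    [nbr_step (\<lambda>st. [pid st, off st, kl st, kr st, rk st]) (\<lambda>x y. matched y x \<and> Suc (x 4) * 2 ^ l \<le> y 1)
      (\<lambda>st g. st\<lparr>bet := g\<rparr>),
     lab_step rk (\<lambda>st. [0, 0, (big_cut L + 2 * acc st - cutm st) * 2 ^ L + off st])
      (\<lambda>st S. st\<lparr>qs := S 2 mod 2 ^ L\<rparr>),
     lab_step rk (\<lambda>st. [if qs st \<le> off st then bet st else 0, 0, if off st = qs st then cutm st else 0])
      (\<lambda>st S. st\<lparr>bs := S 0, cq := S 2\<rparr>)]"
  shows "run N L ss st v = (st v)\<lparr>xin := Xf l st v, acc := \<Sum>u\<in>bsuf L v. Xf l st u, bet := Bf l st v, qs := opt v,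
    bs := bs (run N L ss st v), cq := cq (run N L ss st v)\<rparr>"
    "bs (run N L ss st v) = bsum v" "cq (run N L ss st v) < 2 ^ n"
    "v \<in> V' \<Longrightarrow> q \<in> J st v \<Longrightarrow> pos q = opt v \<Longrightarrow> cq (run N L ss st v) = cm q"
proof -
  let ?bc = "\<lambda>st. [pid st, off st, kl st, kr st, rk st]"
  let ?c1 = "\<lambda>x y. matched y x \<and> thr l (x 4) \<le> y 1" and ?c2 = "\<lambda>x y. matched y x \<and> Suc (x 4) * 2 ^ l \<le> y 1"
  let ?h4 = "\<lambda>st. [0, 0, (big_cut L + 2 * acc st - cutm st) * 2 ^ L + off st]"
  let ?f4 = "\<lambda>st S. st\<lparr>qs := S 2 mod 2 ^ L\<rparr>"
  let ?h5 = "\<lambda>st. [if qs st \<le> off st then bet st else 0, 0, if off st = qs st then cutm st else 0]"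
  let ?f5 = "\<lambda>st S. st\<lparr>bs := S 0, cq := S 2\<rparr>"
  define e1 where "e1 = exec N L (nbr_step ?bc ?c1 (\<lambda>st g. st\<lparr>xin := g\<rparr>)) st"
  define e2 where "e2 = run N L (suffix L) e1"
  define e3 where "e3 = exec N L (nbr_step ?bc ?c2 (\<lambda>st g. st\<lparr>bet := g\<rparr>)) e2"
  define e4 where "e4 = exec N L (lab_step rk ?h4 ?f4) e3"
  define e5 where "e5 = exec N L (lab_step rk ?h5 ?f5) e4"
  have run: "run N L ss st = e5"
    unfolding ss_def e1_def e2_def e3_def e4_def e5_def by (simp only: run_Cons run_append run_Nil)
  have e1: "e1 v = (st v)\<lparr>xin := Xf l st v\<rparr>" if v: "v \<in> V" for v
  proof -
    have "e1 v = (st v)\<lparr>xin := \<Sum>u | u \<in> V \<and> ?c1 (vl (?bc (st v))) (vl (?bc (st u))). wt v u\<rparr>"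
      unfolding e1_def by (rule nbr_exec[OF _ v]) (use pre_small in simp)
    moreover have "{u. u \<in> V \<and> ?c1 (vl (?bc (st v))) (vl (?bc (st u)))} = {u. u \<in> V \<and> mt st u v \<and> thr l (rk (st v)) \<le> pos u}"
      using matched_iff[OF _ v] baseD(2)[OF pre_base] by auto
    ultimately show ?thesis by (simp only: Xf_def)
  qed
  have b1: "base e1" using e1 by (intro base_exec[OF pre_base]) auto
  have e2: "e2 v = (st v)\<lparr>xin := Xf l st v, acc := \<Sum>u\<in>bsuf L v. Xf l st u\<rparr>" if v: "v \<in> V" for v
  proof -
    have "xin (e1 u) \<le> 2 ^ (4 * L)" if "u \<in> V" for u
      using e1[OF that] Xf_le[of l st u] by (simp add: order_trans[OF _ power_increasing])
    then have "e2 v = (e1 v)\<lparr>acc := \<Sum>u\<in>bsuf L v. xin (e1 u)\<rparr>"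
      unfolding e2_def by (intro suffix_run[OF b1 _ v]) auto
    moreover have "(\<Sum>u\<in>bsuf L v. xin (e1 u)) = (\<Sum>u\<in>bsuf L v. Xf l st u)"
      using e1 blkD(2) by (intro sum.cong) auto
    ultimately show ?thesis using e1[OF v] by simp
  qed
  have p2: "pid (e2 v) = pid (st v)" "off (e2 v) = off (st v)" "kl (e2 v) = kl (st v)" "kr (e2 v) = kr (st v)"
    "rk (e2 v) = rk (st v)" if "v \<in> V" for v using e2[OF that] by simp_all
  have e3: "e3 v = (e2 v)\<lparr>bet := Bf l st v\<rparr>" if v: "v \<in> V" for v
  proof -
    have "e3 v = (e2 v)\<lparr>bet := \<Sum>u | u \<in> V \<and> ?c2 (vl (?bc (e2 v))) (vl (?bc (e2 u))). wt v u\<rparr>"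
      unfolding e3_def by (rule nbr_exec[OF _ v]) (use pre_small p2 in simp)
    moreover have "{u. u \<in> V \<and> ?c2 (vl (?bc (e2 v))) (vl (?bc (e2 u)))} = {u. u \<in> V \<and> mt st u v \<and> Suc (rk (st v)) * 2 ^ l \<le> pos u}"
      using matched_iff[OF _ v] baseD(2)[OF pre_base] p2 v by auto
    ultimately show ?thesis by (simp only: Bf_def)
  qed
  have b3: "base e3" using e3 p2 by (intro base_exec[OF pre_base]) auto
  have r3: "rk (e3 v) = rk (st v)" if "v \<in> V" for v using e3[OF that] p2[OF that] by simp
  have K: "{u \<in> V. pth u = pth v \<and> rk (e3 u) = rk (e3 v)} = J st v" if "v \<in> V" for v
    using r3 that by (auto simp: J_def)
  have e4: "e4 v = (e3 v)\<lparr>qs := opt v\<rparr>" if v: "v \<in> V" for v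
  proof -
    have "e4 v = ?f4 (e3 v) (vagg n (\<lambda>u. vl (?h4 (e3 u))) {u \<in> V. pth u = pth v \<and> rk (e3 u) = rk (e3 v)})"
      unfolding e4_def
      by (rule lab_exec[where lab = rk and st = e3 and h = ?h4 and f = ?f4, OF b3 _ _ v])
        (use r3 pre_small rk_mono V'_V in simp_all)
    moreover have "vagg n (\<lambda>u. vl (?h4 (e3 u))) (J st v) = vagg n (\<lambda>u. vl [0, 0, (big_cut L + 2 * (\<Sum>u\<in>bsuf L u. Xf l st u) - cutm (st u)) * 2 ^ L + pos u]) (J st v)"
      using J_sub[of v] e3 e2 baseD(2)[OF pre_base] by (intro vagg_cong refl) (auto dest!: subsetD)
    ultimately show ?thesis unfolding K[OF v] by (simp only: opt_def)
  qed
  have b4: "base e4" using e4 by (intro base_exec[OF b3]) auto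
  have r4: "rk (e4 v) = rk (st v)" if "v \<in> V" for v using e4[OF that] r3[OF that] by simp
  have K4: "{u \<in> V. pth u = pth v \<and> rk (e4 u) = rk (e4 v)} = J st v" if "v \<in> V" for v
    using r4 that by (auto simp: J_def)
  let ?S = "\<lambda>v. vagg n (\<lambda>u. vl (?h5 (e4 u))) (J st v)"
  have e5: "e5 v = ?f5 (e4 v) (?S v)" if v: "v \<in> V" for v
  proof -
    have "e5 v = ?f5 (e4 v) (vagg n (\<lambda>u. vl (?h5 (e4 u))) {u \<in> V. pth u = pth v \<and> rk (e4 u) = rk (e4 v)})"
      unfolding e5_def
      by (rule lab_exec[where lab = rk and st = e4 and h = ?h5 and f = ?f5, OF b4 _ _ v])
        (use r4 pre_small rk_mono V'_V in simp_all)
    then show ?thesis unfolding K4[OF v] .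
  qed
  have h5: "?h5 (e4 u) = [if opt v \<le> pos u then Bf l st u else 0, 0, if pos u = opt v then cutm (st u) else 0]"
    if "u \<in> J st v" for u v
    using that J_sub[of v] e4[of u] e3[of u] e2[of u] baseD(2)[OF pre_base, of u] J_cong[OF J_eq[OF that]]
    by (auto dest!: subsetD)
  have S0: "?S v 0 = bsum v" for v
  proof -
    have eq: "(\<Sum>u\<in>J st v. vl (?h5 (e4 u)) 0) = bsum v"
    proof -
      have "(\<Sum>u\<in>J st v. vl (?h5 (e4 u)) 0) = (\<Sum>u\<in>J st v. if opt v \<le> pos u then Bf l st u else 0)"
        by (intro sum.cong refl) (simp only: h5 vl_simps)
      also have "\<dots> = bsum v" unfolding bsum_def using finite_J by (simp add: sum.inter_filter)
      finally show ?thesis .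
    qed
    have "bsum v \<le> 2 ^ L * 2 ^ (2 * L)" unfolding bsum_def using Bf_le J_sub[of v] by (intro sum_le) auto
    also have "\<dots> = 2 ^ (3 * L + 0)" by (simp flip: power_add)
    finally have "bsum v < 2 ^ n" by (rule pow_width[rotated 2]) simp_all
    then show ?thesis using vagg_sum[of 0 "\<lambda>u. vl (?h5 (e4 u))" "J st v" n] eq by simp
  qed
  show "bs (run N L ss st v) = bsum v" unfolding run using e5[OF v] S0[of v] by simp
  show "cq (run N L ss st v) < 2 ^ n" unfolding run using e5[OF v] vagg_less[OF finite_J] by simp
  show "run N L ss st v = (st v)\<lparr>xin := Xf l st v, acc := \<Sum>u\<in>bsuf L v. Xf l st u, bet := Bf l st v, qs := opt v,
    bs := bs (run N L ss st v), cq := cq (run N L ss st v)\<rparr>"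
    unfolding run using e5[OF v] e4[OF v] e3[OF v] e2[OF v] by simp
  assume vV: "v \<in> V'" and q: "q \<in> J st v" "pos q = opt v"
  have JV: "u \<in> V'" if "u \<in> J st v" for u using that pth_pos[OF vV] by (auto simp: J_def V'_pth)
  have cq: "cutm (st q) = cm q" using pre_ready JV[OF q(1)] by (simp add: ready_def)
  have "?S v 2 = cm q"
  proof (rule vagg_max_eqI)
    show "finite (J st v)" by (rule finite_J)
    show "vl (?h5 (e4 u)) 2 \<le> cm q" if u: "u \<in> J st v" for u
    proof -
      have "u = q" if "pos u = opt v" using V'_eqI[OF JV[OF u] JV[OF q(1)]] u q that by (auto simp: J_def)
      then show ?thesis unfolding h5[OF u] using cq by auto
    qed
    have "cm q \<le> 2 ^ (3 * L + 2)" using cm_le[of q] by (simp add: big_cut_def)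
    then show "cm q < 2 ^ n" by (rule pow_width[rotated 2]) simp_all
    have "vl (?h5 (e4 q)) 2 = cm q" unfolding h5[OF q(1)] using q(2) cq by simp
    then show "cm q = 0 \<or> (\<exists>u\<in>J st v. vl (?h5 (e4 u)) 2 = cm q)" using q(1) by blast
  qed auto
  then show "cq (run N L ss st v) = cm q" unfolding run using e5[OF v] by simp
qed

lemma send_left_simps:
  "bcast (send_left l) s = vl [pid s, off s, kl s, kr s, rk s, qs s, bs s, cq s]"
  "reply (send_left l) w d x y = (if matched x y \<and> y 4 = x 1 div 2 ^ l then vl [0, 0, Suc (y 5), y 6, y 7] else vl [])"
  "join (send_left l) p c \<longleftrightarrow> p 0 \<noteq> 0 \<and> p 1 div 2 ^ l = c 1 div 2 ^ l"
  "share (send_left l) s G = vl [0, 0, G 2, G 3, G 4]"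
  "update (send_left l) s G S = s\<lparr>lq := S 2, lb := S 3, lc := S 4\<rparr>"
  by (simp_all add: send_left_def)

lemma mt_J:
  assumes "mt st a b" "mt st a' b'" "pth a = pth a'" "rk (st b) = rk (st b')"
  shows "J st b = J st b'"
proof -
  have "\<forall>u\<in>V'. \<forall>v\<in>V'. pth u = pth v \<longrightarrow> kl (st u) = kl (st v) \<and> kr (st u) = kr (st v)"
    using pre unfolding level_pre_def by blast
  then have "kl (st a) = kl (st a')" using mtD(3)[OF assms(1)] mtD(3)[OF assms(2)] assms(3) by blast
  then have "pth b = pth b'" using assms(1,2) by (simp add: mt_def)
  then show ?thesis using assms(4) by (simp add: J_def)
qed

text \<open>By \<open>mt_J\<close> all edges through which a block receives something end in the
  same interval and carry the same triple, so the maxima just forward it.\<close>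

lemma send_left_run:
  assumes fr: "\<And>v. v \<in> V \<Longrightarrow> st1 v = (st v)\<lparr>xin := x1 v, acc := x2 v, bet := x3 v, qs := opt v, bs := bsum v, cq := cf v\<rparr>"
    and cf: "\<And>v. v \<in> V \<Longrightarrow> cf v < 2 ^ n" "\<And>u v. u \<in> V' \<Longrightarrow> v \<in> V' \<Longrightarrow> J st u = J st v \<Longrightarrow> cf u = cf v"
    and a: "a \<in> V"
  defines "e \<equiv> exec N L (send_left l) st1"
  shows "e a = (st1 a)\<lparr>lq := lq (e a), lb := lb (e a), lc := lc (e a)\<rparr>" "lq (e a) < 2 ^ n"
    "(\<nexists>a' b. active l st a a' b) \<Longrightarrow> lq (e a) = 0"
    "active l st a a' b \<Longrightarrow> lq (e a) = Suc (opt b) \<and> lb (e a) = bsum b \<and> lc (e a) = cf b"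
proof -
  let ?s = "send_left l"
  let ?x = "\<lambda>v. vl [pid (st v), off (st v), kl (st v), kr (st v), rk (st v), opt v, bsum v, cf v]"
  have bs: "bsum v < 2 ^ n" for v
  proof -
    have "bsum v \<le> 2 ^ L * 2 ^ (2 * L)" unfolding bsum_def using Bf_le J_sub[of v] by (intro sum_le) auto
    also have "\<dots> = 2 ^ (3 * L + 0)" by (simp flip: power_add)
    finally show ?thesis by (rule pow_width[rotated 2]) simp_all
  qed
  have op: "Suc (opt v) < 2 ^ n" for v using opt_less[of v] by (intro small_width) simp
  have sent: "sent L ?s st1 v = ?x v" if "v \<in> V" for v
    by (rule sent_vl) (use fr[OF that] pre_small[OF that] bs[of v] op[of v] cf(1)[OF that] in \<open>simp_all add: send_left_simps\<close>)
  have K: "supernode (joined N L ?s st1) v = blk l v" if v: "v \<in> V" for v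
  proof (rule supernode_blk[OF _ v])
    fix p c assume pc: "par p c"
    show "join ?s (sent L ?s st1 p) (sent L ?s st1 c) \<longleftrightarrow> p \<noteq> r \<and> pos p div 2 ^ l = pos c div 2 ^ l"
      unfolding sent[OF par_in(1)[OF pc]] sent[OF par_in(3)[OF pc]] send_left_simps
      using baseD[OF pre_base par_in(1)[OF pc]] baseD[OF pre_base par_in(3)[OF pc]] par_pth[OF pc] by simp
  qed
  let ?P = "\<lambda>v b. {v, b} \<in> E \<and> mt st v b \<and> rk (st b) = pos v div 2 ^ l"
  let ?G = "nbr_agg N L ?s st1"
  have R: "reply ?s w d (sent L ?s st1 v) (sent L ?s st1 u) =
    (if mt st v u \<and> rk (st u) = pos v div 2 ^ l then vl [0, 0, Suc (opt u), bsum u, cf u] else vl [])"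
    if "{v, u} \<in> E" for v u w d
  proof -
    have V: "v \<in> V" "u \<in> V" using edge_in[OF that] by auto
    have "matched (?x v) (?x u) \<longleftrightarrow> mt st v u" by (rule matched_iff[OF V])
    then show ?thesis unfolding sent[OF V(1)] sent[OF V(2)] send_left_simps using baseD(2)[OF pre_base V(1)] by simp
  qed
  have same: "opt u = opt b \<and> bsum u = bsum b \<and> cf u = cf b"
    if "mt st v u" "rk (st u) = pos v div 2 ^ l" "mt st w b" "rk (st b) = pos w div 2 ^ l" "pth v = pth w" "pos v div 2 ^ l = pos w div 2 ^ l"
    for u b v w
  proof -
    have J: "J st u = J st b" by (rule mt_J[OF that(1,3,5)]) (use that in simp)
    have o: "opt u = opt b" by (rule J_cong[OF J])
    have "bsum u = bsum b" unfolding bsum_def J o ..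
    then show ?thesis using o cf(2)[OF mtD(4)[OF that(1)] mtD(4)[OF that(3)] J] by simp
  qed
  have G0: "?G v i = 0" if v: "v \<in> V" and "\<nexists>b. ?P v b" "i \<in> {2, 3, 4}" for v i
    by (rule nbr_agg_max[OF v]) (use that R in auto)
  have G1: "?G v 2 = Suc (opt b) \<and> ?G v 3 = bsum b \<and> ?G v 4 = cf b" if v: "v \<in> V" and b: "?P v b" for v b
  proof (intro conjI)
    have bV: "b \<in> V" using b mtD by blast
    have eq: "reply ?s w d (sent L ?s st1 v) (sent L ?s st1 u) i =
      (if mt st v u \<and> rk (st u) = pos v div 2 ^ l then vl [0, 0, Suc (opt b), bsum b, cf b] i else 0)"
      if "{v, u} \<in> E" for u w d i
      using R[OF that, of w d] same[of v u v b] b by auto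
    show "?G v 2 = Suc (opt b)"
      by (rule nbr_agg_max[OF v]) (use b op[of b] eq in auto)
    show "?G v 3 = bsum b"
      by (rule nbr_agg_max[OF v]) (use b bs[of b] eq in auto)
    show "?G v 4 = cf b"
      by (rule nbr_agg_max[OF v]) (use b cf(1)[OF bV] eq in auto)
  qed
  let ?f = "\<lambda>u. share ?s (st1 u) (?G u)"
  have f: "?f u 2 = ?G u 2" "?f u 3 = ?G u 3" "?f u 4 = ?G u 4" for u by (simp_all add: send_left_simps)
  have fin: "finite (blk l a)" using blk_sub finite_sub by blast
  have e: "e a = (st1 a)\<lparr>lq := vagg n ?f (blk l a) 2, lb := vagg n ?f (blk l a) 3, lc := vagg n ?f (blk l a) 4\<rparr>"
    unfolding e_def exec_def K[OF a] by (simp only: send_left_simps)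
  then show "e a = (st1 a)\<lparr>lq := lq (e a), lb := lb (e a), lc := lc (e a)\<rparr>" "lq (e a) < 2 ^ n"
    using vagg_less[OF fin] by simp_all
  have bl: "u \<in> V \<and> pth u = pth a \<and> pos u div 2 ^ l = pos a div 2 ^ l" if "u \<in> blk l a" for u
    using that by (simp add: blk_def)
  {
    assume none: "\<nexists>a' b. active l st a a' b"
    have "?G u 2 = 0" if u: "u \<in> blk l a" for u
      by (rule G0) (use none u bl[OF u] in \<open>auto simp: active_def\<close>)
    then have "vagg n ?f (blk l a) 2 = 0" by (intro vagg_max_eqI) (use fin f in auto)
    then show "lq (e a) = 0" using e by simp
  }
  {
    assume act: "active l st a a' b"
    then have a': "a' \<in> blk l a" "?P a' b" using bl[of a'] by (auto simp: active_def)
    have bV: "b \<in> V" using a' mtD by blast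
    have le: "?G u 2 \<le> Suc (opt b) \<and> ?G u 3 \<le> bsum b \<and> ?G u 4 \<le> cf b" if u: "u \<in> blk l a" for u
    proof (cases "\<exists>c. ?P u c")
      case True
      then obtain c where c: "?P u c" by blast
      then show ?thesis using G1[OF _ c] bl[OF u] bl[OF a'(1)] same[of u c a' b] a'(2) by simp
    next
      case False
      then show ?thesis using G0[OF _ False] bl[OF u] by simp
    qed
    have at: "?G a' 2 = Suc (opt b)" "?G a' 3 = bsum b" "?G a' 4 = cf b" using G1[OF _ a'(2)] bl[OF a'(1)] by auto
    have "vagg n ?f (blk l a) 2 = Suc (opt b)"
      by (rule vagg_max_eqI) (use fin f le at a'(1) op[of b] in auto)
    moreover have "vagg n ?f (blk l a) 3 = bsum b"
      by (rule vagg_max_eqI) (use fin f le at a'(1) bs[of b] in auto)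
    moreover have "vagg n ?f (blk l a) 4 = cf b"
      by (rule vagg_max_eqI) (use fin f le at a'(1) cf(1)[OF bV] in auto)
    ultimately show "lq (e a) = Suc (opt b) \<and> lb (e a) = bsum b \<and> lc (e a) = cf b" using e by simp
  }
qed

lemma active_blk:
  assumes "active l st a a' b" "x \<in> blk l a" shows "active l st x a' b"
  using assms by (auto simp: active_def blk_def)

lemma level_run: "level_post l st opt (run N L (level L l) st)"
proof -
  define ss where "ss = nbr_step (\<lambda>st. [pid st, off st, kl st, kr st, rk st]) (\<lambda>x y. matched y x \<and> thr l (x 4) \<le> y 1)
      (\<lambda>st g. st\<lparr>xin := g\<rparr>) #
    suffix L @
    [nbr_step (\<lambda>st. [pid st, off st, kl st, kr st, rk st]) (\<lambda>x y. matched y x \<and> Suc (x 4) * 2 ^ l \<le> y 1)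
      (\<lambda>st g. st\<lparr>bet := g\<rparr>),
     lab_step rk (\<lambda>st. [0, 0, (big_cut L + 2 * acc st - cutm st) * 2 ^ L + off st])
      (\<lambda>st S. st\<lparr>qs := S 2 mod 2 ^ L\<rparr>),
     lab_step rk (\<lambda>st. [if qs st \<le> off st then bet st else 0, 0, if off st = qs st then cutm st else 0])
      (\<lambda>st S. st\<lparr>bs := S 0, cq := S 2\<rparr>)]"
  define e5 where "e5 = run N L ss st"
  define e6 where "e6 = exec N L (send_left l) e5"
  let ?bc = "\<lambda>st. [pid st, off st, kl st, kr st, lq st]"
  let ?c = "\<lambda>x y. matched x y \<and> x 4 \<noteq> 0 \<and> x 4 \<le> Suc (y 1)"
  let ?g9 = "\<lambda>st. st\<lparr>best := if lq st = 0 then best st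
       else min (best st) (cutm st + lc st - 2 * (acc st + lb st + gam st))\<rparr>"
  let ?h = "\<lambda>st. if thr l (off st div 2 ^ l) \<le> off st then xin st else 0"
  let ?f = "\<lambda>st x. st\<lparr>gam := if lq st \<noteq> 0 \<and> off st < thr l (off st div 2 ^ l) then x + lb st + gam st else gam st,
         rk := 2 * rk st + (if qs st \<le> off st then 1 else 0)\<rparr>"
  define e7 where "e7 = exec N L (nbr_step ?bc ?c (\<lambda>st g. st\<lparr>xin := g\<rparr>)) e6"
  define e8 where "e8 = run N L (suffix l) e7"
  define e9 where "e9 = (\<lambda>v. ?g9 (e8 v))"
  define e10 where "e10 = exec N L (lab_step (\<lambda>st. off st div 2 ^ l) (\<lambda>st. [?h st]) (\<lambda>st S. ?f st (S 0))) e9"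
  have "level L l = ss @ [send_left l, nbr_step ?bc ?c (\<lambda>st g. st\<lparr>xin := g\<rparr>)] @ suffix l @
    [local_step ?g9, lab_step (\<lambda>st. off st div 2 ^ l) (\<lambda>st. [?h st]) (\<lambda>st S. ?f st (S 0))]"
    by (simp add: level_def ss_def)
  then have run: "run N L (level L l) st = e10"
    unfolding e10_def e9_def e8_def e7_def e6_def e5_def by (simp only: run_append run_Cons run_Nil loc)
  note r5 = right_run[folded ss_def e5_def]
  define cf where "cf v = cq (e5 v)" for v
  have e5: "e5 v = (st v)\<lparr>xin := Xf l st v, acc := \<Sum>u\<in>bsuf L v. Xf l st u, bet := Bf l st v, qs := opt v, bs := bsum v, cq := cf v\<rparr>"
    if "v \<in> V" for v using r5(1)[OF that] r5(2)[OF that] by (simp add: cf_def)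
  have cf1: "cf v < 2 ^ n" if "v \<in> V" for v using r5(3)[OF that] by (simp add: cf_def)
  have cfq: "cf v = cm q" if "v \<in> V'" "q \<in> J st v" "pos q = opt v" for v q
    using r5(4)[OF V'_V[OF that(1)] that] by (simp add: cf_def)
  have cf2: "cf u = cf v" if uv: "u \<in> V'" "v \<in> V'" "J st u = J st v" for u v
  proof -
    obtain q where q: "q \<in> J st v" "pos q = opt v" using opt_spec[OF uv(2)] by blast
    then show ?thesis using cfq[OF uv(2) q] cfq[OF uv(1), of q] J_cong[OF uv(3)] uv(3) by simp
  qed
  note s6 = send_left_run[OF e5 cf1 cf2, folded e6_def]
  have e6: "e6 v = (e5 v)\<lparr>lq := lq (e6 v), lb := lb (e6 v), lc := lc (e6 v)\<rparr>" if "v \<in> V" for v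
    by (rule s6(1)[OF _ _ _ _ _ that])
  have lq: "lq (e6 v) < 2 ^ n" if "v \<in> V" for v
    by (rule s6(2)[OF _ _ _ _ _ that])
  have p6: "pid (e6 v) = pid (st v)" "off (e6 v) = off (st v)" "kl (e6 v) = kl (st v)" "kr (e6 v) = kr (st v)"
    if "v \<in> V" for v
    by (subst e6[OF that], subst e5[OF that], simp)+
  define Yf where "Yf v = (\<Sum>u | u \<in> V \<and> mt st v u \<and> lq (e6 v) \<noteq> 0 \<and> lq (e6 v) \<le> Suc (pos u). wt v u)" for v
  have e7: "e7 v = (e6 v)\<lparr>xin := Yf v\<rparr>" if v: "v \<in> V" for v
  proof -
    have "e7 v = (e6 v)\<lparr>xin := \<Sum>u | u \<in> V \<and> ?c (vl (?bc (e6 v))) (vl (?bc (e6 u))). wt v u\<rparr>"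
      unfolding e7_def by (rule nbr_exec[OF _ v]) (use pre_small p6 lq in simp)
    moreover have "{u. u \<in> V \<and> ?c (vl (?bc (e6 v))) (vl (?bc (e6 u)))} =
      {u. u \<in> V \<and> mt st v u \<and> lq (e6 v) \<noteq> 0 \<and> lq (e6 v) \<le> Suc (pos u)}"
      using matched_iff[OF v] baseD(2)[OF pre_base] p6 v by auto
    ultimately show ?thesis by (simp only: Yf_def)
  qed
  have b7: "base e7" using e7 p6 by (intro base_exec[OF pre_base]) auto
  have Y_le: "Yf v \<le> 2 ^ (4 * L)" for v
    unfolding Yf_def by (rule order_trans[OF wt_sum_le]) (auto intro: power_increasing)
  have e8: "e8 v = (e7 v)\<lparr>acc := \<Sum>u\<in>bsuf l v. Yf u\<rparr>" if v: "v \<in> V" for v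
  proof -
    have "e8 v = (e7 v)\<lparr>acc := \<Sum>u\<in>bsuf l v. xin (e7 u)\<rparr>"
      unfolding e8_def by (rule suffix_run[OF b7 _ v]) (use e7 Y_le in simp)
    moreover have "(\<Sum>u\<in>bsuf l v. xin (e7 u)) = (\<Sum>u\<in>bsuf l v. Yf u)"
      using e7 blkD(2) by (intro sum.cong) auto
    ultimately show ?thesis by simp
  qed
  have e8': "e8 v = (st v)\<lparr>xin := Yf v, acc := \<Sum>u\<in>bsuf l v. Yf u, bet := Bf l st v, qs := opt v, bs := bsum v, cq := cf v,
    lq := lq (e6 v), lb := lb (e6 v), lc := lc (e6 v)\<rparr>" if "v \<in> V" for v
    unfolding e8[OF that] e7[OF that] by (subst e6[OF that], subst e5[OF that]) simp
  have b9: "base e9" using e8' by (intro base_exec[OF pre_base]) (auto simp: e9_def)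
  have o9: "off (e9 v) = pos v" "xin (e9 v) = Yf v" if "v \<in> V" for v
    using e8'[OF that] baseD(2)[OF pre_base that] by (simp_all add: e9_def)
  have e10: "e10 v = ?f (e9 v) (\<Sum>u | u \<in> blk l v \<and> thr l (pos v div 2 ^ l) \<le> pos u. Yf u)" if v: "v \<in> V" for v
  proof -
    have "e10 v = ?f (e9 v) (\<Sum>u | u \<in> V \<and> pth u = pth v \<and> off (e9 u) div 2 ^ l = off (e9 v) div 2 ^ l. ?h (e9 u))"
      unfolding e10_def
    proof (rule lab_exec_sum[where lab = "\<lambda>st. off st div 2 ^ l" and st = e9 and h = ?h and f = ?f, OF b9 _ _ v])
      show "off (e9 u) div 2 ^ l < 2 ^ n" if "u \<in> V" for u using o9[OF that] div_pow_width[OF that] by simp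
      show "off (e9 u) div 2 ^ l \<le> off (e9 v) div 2 ^ l" if "u \<in> V'" "v \<in> V'" "pos u \<le> pos v" for u v
        using o9 V'_V that by (auto intro: div_le_mono)
      show "?h (e9 u) \<le> 2 ^ (4 * L)" if "u \<in> V" for u using o9[OF that] Y_le[of u] by simp
    qed
    moreover have "(\<Sum>u | u \<in> V \<and> pth u = pth v \<and> off (e9 u) div 2 ^ l = off (e9 v) div 2 ^ l. ?h (e9 u)) =
      (\<Sum>u\<in>blk l v. if thr l (pos v div 2 ^ l) \<le> pos u then Yf u else 0)"
      using o9 v by (intro sum.cong) (auto simp: blk_def)
    moreover have "\<dots> = (\<Sum>u | u \<in> blk l v \<and> thr l (pos v div 2 ^ l) \<le> pos u. Yf u)"
      using finite_sub[OF blk_sub(1)] by (simp add: sum.inter_filter)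
    ultimately show ?thesis by (simp only:)
  qed
  have none: "lq (e6 a) = 0" if "a \<in> V'" "\<nexists>a' b. active l st a a' b" for a
    by (rule s6(3)[OF _ _ _ _ _ V'_V[OF that(1)] that(2)])
  have act: "lq (e6 a) = Suc (opt b) \<and> lb (e6 a) = bsum b \<and> lc (e6 a) = cf b" if "a \<in> V" "active l st a a' b" for a a' b
    by (rule s6(4)[OF _ _ _ _ _ that])
  show ?thesis
    unfolding run level_post_def
  proof (intro conjI ballI allI impI)
    fix v assume v: "v \<in> V"
    show "core (e10 v) = core (st v)" "kl (e10 v) = kl (st v)" "kr (e10 v) = kr (st v)"
      unfolding e10[OF v] e9_def e8'[OF v] by (simp_all add: core_def)
    show "rk (e10 v) = 2 * rk (st v) + (if opt v \<le> pos v then 1 else 0)"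
      unfolding e10[OF v] e9_def e8'[OF v] using baseD(2)[OF pre_base v] by simp
  next
    fix u v assume "J st u = J st v"
    then show "opt u = opt v" by (rule J_cong)
  next
    fix v assume "v \<in> V'"
    then show "\<exists>q\<in>J st v. pos q = opt v \<and>
        (\<forall>b\<in>J st v. cm q + 2 * (\<Sum>u\<in>below b. Xf l st u) \<le> cm b + 2 * (\<Sum>u\<in>below q. Xf l st u))"
      by (rule opt_spec)
  next
    fix a assume a: "a \<in> V'" "\<nexists>a' b. active l st a a' b"
    show "best (e10 a) = best (st a)" "gam (e10 a) = gam (st a)"
      unfolding e10[OF V'_V[OF a(1)]] e9_def e8'[OF V'_V[OF a(1)]] using none[OF a] by simp_all
  next
    fix a a' b q assume a: "a \<in> V'" and ac: "active l st a a' b" and q: "q \<in> J st b" "pos q = opt b"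
    note aV = V'_V[OF a]
    have b: "b \<in> V'" using ac mtD(4) by (auto simp: active_def)
    have Y: "Yf x = (\<Sum>u | u \<in> V \<and> mt st x u \<and> pos q \<le> pos u. wt x u)" if "x \<in> blk l a" for x
      using act[OF blkD(1)[OF that] active_blk[OF ac that]] q(2) by (simp add: Yf_def)
    have Y1: "(\<Sum>x\<in>bsuf l a. Yf x) = (\<Sum>x\<in>bsuf l a. \<Sum>u | u \<in> V \<and> mt st x u \<and> pos q \<le> pos u. wt x u)"
      using Y by (intro sum.cong) (auto simp: bsuf_def)
    have Y2: "(\<Sum>u | u \<in> blk l a \<and> thr l (pos a div 2 ^ l) \<le> pos u. Yf u) =
       (\<Sum>x | x \<in> blk l a \<and> thr l (pos a div 2 ^ l) \<le> pos x. \<Sum>u | u \<in> V \<and> mt st x u \<and> pos q \<le> pos u. wt x u)"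
      using Y by (intro sum.cong) auto
    have B: "bsum b = (\<Sum>u | u \<in> J st b \<and> pos q \<le> pos u. Bf l st u)" unfolding bsum_def q(2) ..
    note A = act[OF aV ac]
    have cm: "cutm (st a) = cm a" using pre_ready a by (simp add: ready_def)
    have c: "cf b = cm q" by (rule cfq[OF b q])
    show "best (e10 a) = min (best (st a)) (cm a + cm q - 2 *
          ((\<Sum>x\<in>bsuf l a. \<Sum>u | u \<in> V \<and> mt st x u \<and> pos q \<le> pos u. wt x u) +
           (\<Sum>u | u \<in> J st b \<and> pos q \<le> pos u. Bf l st u) + gam (st a)))"
      unfolding e10[OF aV] e9_def e8'[OF aV] Y1[symmetric] B[symmetric] using A cm c by simp
    show "gam (e10 a) = (if pos a < thr l (pos a div 2 ^ l) then
          (\<Sum>x | x \<in> blk l a \<and> thr l (pos a div 2 ^ l) \<le> pos x. \<Sum>u | u \<in> V \<and> mt st x u \<and> pos q \<le> pos u. wt x u) +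
           (\<Sum>u | u \<in> J st b \<and> pos q \<le> pos u. Bf l st u) + gam (st a) else gam (st a))"
      unfolding e10[OF aV] e9_def e8'[OF aV] Y2[symmetric] B[symmetric]
      using A baseD(2)[OF pre_base aV] by simp
  qed
qed

end

end

text \<open>For \<open>a\<close> and \<open>b\<close> on different paths, \<open>W a b\<close> is the weight between the suffixes starting at \<open>a\<close>
  and \<open>b\<close>, so the cost matrix has the Monge property. The node \<open>q\<close> is optimal for the row at position
  \<open>thr l k\<close>; it then dominates everything in its rectangle except the upper left and the lower right
  part, and these too unless they contain an edge.\<close>

context star_prog begin

section \<open>Domination in the cost matrix and the invariant of the levels\<close>

definition cost :: "node \<Rightarrow> node \<Rightarrow> nat" where
  "cost a b = cm a + cm b - 2 * W a b"

lemma W_le_cube: "W a b \<le> 2 ^ (3 * L)"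
proof -
  have "(\<Sum>y\<in>below b. wt x y) \<le> 2 ^ (2 * L)" for x using below_sub by (intro wt_sum_le) auto
  then have "W a b \<le> 2 ^ L * 2 ^ (2 * L)" unfolding W_def using below_sub by (intro sum_le) auto
  then show ?thesis by (simp flip: power_add)
qed

lemma W_le_cm:
  assumes "a \<in> V'" "b \<in> V'" "pth a \<noteq> pth b" shows "W a b \<le> cm a" "W a b \<le> cm b"
proof -
  have big: "W a b \<le> big_cut L" using W_le_cube[of a b] by (simp add: big_cut_def)
  show "W a b \<le> cm a" using W_le[OF assms] big by (simp add: cm_def)
  show "W a b \<le> cm b" using W_le[OF assms(2,1)] assms(3) big by (simp add: cm_def W_commute)
qed

lemma smc_le_cost:
  assumes "a \<in> V'" "b \<in> V'" "pth a \<noteq> pth b" shows "smc \<le> cost a b"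
proof (cases "elig a \<and> elig b")
  case True
  then have "c1 a + c1 b - 2 * W a b \<in> cands" using assms unfolding cands_def by blast
  then show ?thesis using smc_le True by (simp add: cost_def cm_def)
next
  case False
  have "c1 a \<in> cands" using assms by (simp add: cands_def)
  then have "smc \<le> 2 ^ (3 * L)" using smc_le c1_le[of a] by (meson order_trans)
  moreover have "big_cut L \<le> cm a + cm b" using False by (auto simp: cm_def)
  ultimately show ?thesis unfolding cost_def using W_le_cube[of a b] by (simp add: big_cut_def power_add)
qed

definition rect :: "nat \<Rightarrow> (node \<Rightarrow> nst) \<Rightarrow> node \<Rightarrow> node \<Rightarrow> bool" where
  "rect l st a b \<longleftrightarrow> (\<exists>a'\<in>blk l a. \<exists>b'\<in>J st b. {a', b'} \<in> E)"

text \<open>Paths without a common edge have \<open>W = 0\<close>, so their pairs cannot beat the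
  single cuts. For the others the initial rectangle, made of the two entire paths, contains an
  edge.\<close>

definition linked :: "node \<Rightarrow> node \<Rightarrow> bool" where
  "linked a b \<longleftrightarrow> (\<exists>a'\<in>V'. \<exists>b'\<in>V'. pth a' = pth a \<and> pth b' = pth b \<and> {a', b'} \<in> E)"

definition rows :: "node \<Rightarrow> nat \<Rightarrow> node set" where
  "rows a t = {x \<in> V'. pth x = pth a \<and> t \<le> pos x}"

definition cols :: "node \<Rightarrow> nat \<Rightarrow> nat \<Rightarrow> node set" where
  "cols b s e = {u \<in> V'. pth u = pth b \<and> s \<le> pos u \<and> pos u < e}"

text \<open>The columns that follow the interval of \<open>b\<close>: a larger \<open>rk\<close>
  means farther from the root.\<close>

definition above :: "(node \<Rightarrow> nst) \<Rightarrow> node \<Rightarrow> node set" where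
  "above st b = {u \<in> V'. pth u = pth b \<and> rk (st b) < rk (st u)}"

definition mass :: "node set \<Rightarrow> node set \<Rightarrow> nat" where
  "mass A B = (\<Sum>x\<in>A. \<Sum>u\<in>B. wt x u)"

lemma finite_rc [simp]: "finite (rows a t)" "finite (cols b s e)" "finite (above st b)"
  by (simp_all add: rows_def cols_def above_def)

lemma mass_Un1: "finite A \<Longrightarrow> finite A' \<Longrightarrow> A \<inter> A' = {} \<Longrightarrow> mass (A \<union> A') B = mass A B + mass A' B"
  by (simp add: mass_def sum.union_disjoint)

lemma mass_Un2: "finite B \<Longrightarrow> finite B' \<Longrightarrow> B \<inter> B' = {} \<Longrightarrow> mass A (B \<union> B') = mass A B + mass A B'"
  by (simp add: mass_def sum.union_disjoint sum.distrib)

lemma mass_mono: "finite A' \<Longrightarrow> A \<subseteq> A' \<Longrightarrow> mass A B \<le> mass A' B"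
  by (simp add: mass_def sum_mono2)

lemma mass_0: "(\<And>x u. x \<in> A \<Longrightarrow> u \<in> B \<Longrightarrow> {x, u} \<notin> E) \<Longrightarrow> mass A B = 0"
  by (simp add: mass_def wt_def)

lemma W_mass: "W a b = mass (below a) (below b)"
  by (simp add: W_def mass_def)

text \<open>A pair is either settled, its row having recorded a value no larger than its cost, or it
  still lies in a rectangle with an edge. \<open>gam\<close> is specified for the latter only, since
  a block that no edge reaches receives nothing and cannot update it.\<close>

definition slot_inv :: "nat \<Rightarrow> (node \<Rightarrow> nst) \<Rightarrow> bool" where
  "slot_inv l st \<longleftrightarrow> level_pre l st \<and>
     (\<forall>a b. mt st a b \<longrightarrow> linked a b \<longrightarrow> best (st a) \<le> cost a b \<or> rk (st b) = pos a div 2 ^ l \<and> rect l st a b) \<and>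
     (\<forall>a b. mt st a b \<longrightarrow> rk (st b) = pos a div 2 ^ l \<longrightarrow> rect l st a b \<longrightarrow>
        gam (st a) = mass (rows a (Suc (pos a div 2 ^ l) * 2 ^ l)) (above st b)) \<and>
     (\<forall>a\<in>V'. smc \<le> best (st a))"

lemma div_le_iff: "Suc k * 2 ^ l \<le> x \<longleftrightarrow> k < x div 2 ^ (l::nat)"
  by (metis Suc_le_eq less_eq_div_iff_mult_less_eq zero_less_numeral zero_less_power)

context
  fixes l st qf st'
  assumes inv: "slot_inv l st" and lL: "l \<le> L" and post: "level_post l st qf st'"
begin

lemma inv_pre: "level_pre l st"
  using inv by (simp add: slot_inv_def)

lemma post_frame:
  assumes "v \<in> V"
  shows "core (st' v) = core (st v)" "kl (st' v) = kl (st v)" "kr (st' v) = kr (st v)"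
    "rk (st' v) = 2 * rk (st v) + (if qf v \<le> pos v then 1 else 0)"
  using post assms unfolding level_post_def by blast+

lemma uniform:
  assumes "u \<in> V'" "v \<in> V'" "pth u = pth v"
  shows "kl (st u) = kl (st v)" "kr (st u) = kr (st v)" "pos u \<le> pos v \<Longrightarrow> rk (st u) \<le> rk (st v)"
proof -
  have "\<forall>u\<in>V'. \<forall>v\<in>V'. pth u = pth v \<longrightarrow> kl (st u) = kl (st v) \<and> kr (st u) = kr (st v)"
    "\<forall>u\<in>V'. \<forall>v\<in>V'. pth u = pth v \<longrightarrow> pos u \<le> pos v \<longrightarrow> rk (st u) \<le> rk (st v)"
    using inv_pre unfolding level_pre_def by blast+
  then show "kl (st u) = kl (st v)" "kr (st u) = kr (st v)" "pos u \<le> pos v \<Longrightarrow> rk (st u) \<le> rk (st v)"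
    using assms by blast+
qed

lemma mt_cong: "mt st' a b \<longleftrightarrow> mt st a b"
  using post_frame V'_V unfolding mt_def by metis

lemma mt_transfer:
  assumes "mt st a b" "x \<in> V'" "pth x = pth a"
  shows "mt st x u \<longleftrightarrow> u \<in> V' \<and> pth u = pth b"
proof -
  have a: "a \<in> V'" "b \<in> V'" "pth a \<noteq> pth b" "kl (st a) = pth b" "kr (st b) = pth a" using assms(1) by (auto simp: mt_def)
  have "kl (st x) = pth b" using uniform(1)[OF assms(2) a(1) assms(3)] a(4) by simp
  moreover have "kr (st u) = pth a" if "u \<in> V'" "pth u = pth b"
    using uniform(2)[OF that(1) a(2) that(2)] a(5) by simp
  ultimately show ?thesis using assms(2,3) a(3) unfolding mt_def by metis
qed

lemma mt_transfer':
  assumes "mt st a b" "u \<in> V'" "pth u = pth b"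
  shows "mt st x u \<longleftrightarrow> x \<in> V' \<and> pth x = pth a"
proof
  assume "mt st x u"
  then have "x \<in> V'" "kr (st u) = pth x" by (auto simp: mt_def)
  moreover have "kr (st u) = kr (st b)" using uniform(2)[OF assms(2) _ assms(3)] assms(1) by (simp add: mt_def)
  ultimately show "x \<in> V' \<and> pth x = pth a" using assms(1) by (simp add: mt_def)
next
  assume "x \<in> V' \<and> pth x = pth a"
  then show "mt st x u" using mt_transfer[OF assms(1), of x u] assms(2,3) by simp
qed

lemma rk_less_pos:
  assumes "u \<in> V'" "v \<in> V'" "pth u = pth v" "rk (st u) < rk (st v)" shows "pos u < pos v"
  using uniform(3)[OF assms(2,1)] assms(3,4) by (metis leD not_le)

lemma J_iff: "b \<in> V' \<Longrightarrow> u \<in> J st b \<longleftrightarrow> u \<in> V' \<and> pth u = pth b \<and> rk (st u) = rk (st b)"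
  using pth_pos[of b] by (auto simp: J_def V'_pth)

lemma qf_J: "b \<in> V' \<Longrightarrow> u \<in> J st b \<Longrightarrow> qf u = qf b"
proof -
  assume "b \<in> V'" "u \<in> J st b"
  then have "J st u = J st b" "u \<in> V" "b \<in> V" using V'_V by (auto simp: J_def)
  then show ?thesis using post unfolding level_post_def by blast
qed

lemma best_le: "a \<in> V' \<Longrightarrow> best (st' a) \<le> best (st a)"
proof (cases "\<exists>a' b. active l st a a' b")
  case True
  assume a: "a \<in> V'"
  from True obtain a' b where ab: "active l st a a' b" by blast
  then have "b \<in> V'" by (auto simp: active_def mt_def)
  then obtain q where "q \<in> J st b" "pos q = qf b" using post unfolding level_post_def by blast
  with post a ab obtain y where "best (st' a) = min (best (st a)) y" unfolding level_post_def by blast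
  then show ?thesis by simp
next
  case False
  assume "a \<in> V'"
  then have "best (st' a) = best (st a)" using post False unfolding level_post_def by blast
  then show ?thesis by simp
qed

context
  fixes a b q
  assumes ab: "mt st a b" and rkb: "rk (st b) = pos a div 2 ^ l" and re: "rect l st a b"
    and q: "q \<in> J st b" "pos q = qf b"
begin

abbreviation "k \<equiv> pos a div 2 ^ l"
abbreviation "p \<equiv> thr l k"

lemma aV: "a \<in> V'" and bV: "b \<in> V'" and qV: "q \<in> V'" "pth q = pth b" "rk (st q) = k"
  using ab q(1) J_iff[of b q] rkb by (auto simp: mt_def)

lemma active_ex: "\<exists>a' b'. active l st a a' b' \<and> J st b' = J st b \<and> b' \<in> V'"
proof -
  obtain a' b' where h: "a' \<in> blk l a" "b' \<in> J st b" "{a', b'} \<in> E" using re by (auto simp: rect_def)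
  have a': "a' \<in> V'" "pth a' = pth a" using h(1) pth_pos[OF aV] by (auto simp: blk_def V'_pth)
  have b': "b' \<in> V'" "pth b' = pth b" "rk (st b') = rk (st b)" using h(2) J_iff[OF bV] by auto
  have "mt st a' b'" using mt_transfer[OF ab a', of b'] b' by simp
  then have "active l st a a' b'" using h b' rkb by (simp add: active_def)
  moreover have "J st b' = J st b" using b' by (auto simp: J_def)
  ultimately show ?thesis using b' by blast
qed

lemma below_q: "below q = {u \<in> J st b. pos q \<le> pos u} \<union> above st b"
  "{u \<in> J st b. pos q \<le> pos u} \<inter> above st b = {}"
proof -
  show "below q = {u \<in> J st b. pos q \<le> pos u} \<union> above st b"
  proof (rule set_eqI)
    fix u
    show "u \<in> below q \<longleftrightarrow> u \<in> {u \<in> J st b. pos q \<le> pos u} \<union> above st b"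
    proof (cases "u \<in> V' \<and> pth u = pth b")
      case True
      have 1: "rk (st b) \<le> rk (st u)" if "pos q \<le> pos u"
        using uniform(3)[OF qV(1), of u] True that qV rkb by simp
      have 2: "pos q \<le> pos u" if "rk (st b) < rk (st u)"
        using rk_less_pos[OF qV(1), of u] True that qV rkb by simp
      show ?thesis using True 1 2 qV(2) J_iff[OF bV, of u] by (auto simp: below_def above_def)
    next
      case False
      then show ?thesis using qV(2) J_iff[OF bV, of u] by (auto simp: below_def above_def)
    qed
  qed
  show "{u \<in> J st b. pos q \<le> pos u} \<inter> above st b = {}" using J_iff[OF bV] by (auto simp: above_def)
qed

lemma Yq: "x \<in> V' \<Longrightarrow> pth x = pth a \<Longrightarrow> {u. u \<in> V \<and> mt st x u \<and> pos q \<le> pos u} = below q"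
  using mt_transfer[OF ab, of x] qV(2) V'_V by (auto simp: below_def)

lemma Bq: "(\<Sum>u | u \<in> J st b \<and> pos q \<le> pos u. Bf l st u) = mass (rows a (Suc k * 2 ^ l)) {u \<in> J st b. pos q \<le> pos u}"
proof -
  have "Bf l st u = (\<Sum>x\<in>rows a (Suc k * 2 ^ l). wt x u)" if u: "u \<in> J st b" for u
  proof -
    have uV: "u \<in> V'" "pth u = pth b" "rk (st u) = k" using u J_iff[OF bV] rkb by auto
    have "{x. x \<in> V \<and> mt st x u \<and> Suc (rk (st u)) * 2 ^ l \<le> pos x} = rows a (Suc k * 2 ^ l)"
      using mt_transfer'[OF ab uV(1,2)] uV(3) V'_V by (auto simp: rows_def)
    then show ?thesis unfolding Bf_def by (simp add: wt_sym)
  qed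
  then show ?thesis unfolding mass_def by (subst sum.swap) (intro sum.cong, auto)
qed

lemma gam_eq: "gam (st a) = mass (rows a (Suc k * 2 ^ l)) (above st b)"
  using inv ab rkb re unfolding slot_inv_def by blast

lemma finite_Jq: "finite {u \<in> J st b. pos q \<le> pos u}"
  using finite_V by (simp add: J_def)

lemma rest: "(\<Sum>u | u \<in> J st b \<and> pos q \<le> pos u. Bf l st u) + gam (st a) = mass (rows a (Suc k * 2 ^ l)) (below q)"
  unfolding Bq gam_eq below_q(1) using mass_Un2[OF finite_Jq _ below_q(2)] by simp

lemma post_active:
  "best (st' a) = min (best (st a)) (cm a + cm q - 2 *
      ((\<Sum>x\<in>bsuf l a. \<Sum>u | u \<in> V \<and> mt st x u \<and> pos q \<le> pos u. wt x u) +
        (\<Sum>u | u \<in> J st b \<and> pos q \<le> pos u. Bf l st u) + gam (st a)))"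
  "gam (st' a) = (if pos a < p then
      (\<Sum>x | x \<in> blk l a \<and> p \<le> pos x. \<Sum>u | u \<in> V \<and> mt st x u \<and> pos q \<le> pos u. wt x u) +
        (\<Sum>u | u \<in> J st b \<and> pos q \<le> pos u. Bf l st u) + gam (st a) else gam (st a))"
proof -
  obtain a' b' where act: "active l st a a' b'" "J st b' = J st b" "b' \<in> V'" using active_ex by blast
  have "b' \<in> J st b'" using V'_V[OF act(3)] by (simp add: J_def)
  then have "qf b' = qf b" using qf_J[OF bV] act(2) by simp
  then have "q \<in> J st b'" "pos q = qf b'" using q act(2) by auto
  with act(1) aV post have "best (st' a) = min (best (st a)) (cm a + cm q - 2 *
      ((\<Sum>x\<in>bsuf l a. \<Sum>u | u \<in> V \<and> mt st x u \<and> pos q \<le> pos u. wt x u) +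
        (\<Sum>u | u \<in> J st b' \<and> pos q \<le> pos u. Bf l st u) + gam (st a))) \<and>
    gam (st' a) = (if pos a < p then
      (\<Sum>x | x \<in> blk l a \<and> p \<le> pos x. \<Sum>u | u \<in> V \<and> mt st x u \<and> pos q \<le> pos u. wt x u) +
        (\<Sum>u | u \<in> J st b' \<and> pos q \<le> pos u. Bf l st u) + gam (st a) else gam (st a))"
    unfolding level_post_def by blast
  then show "best (st' a) = min (best (st a)) (cm a + cm q - 2 *
      ((\<Sum>x\<in>bsuf l a. \<Sum>u | u \<in> V \<and> mt st x u \<and> pos q \<le> pos u. wt x u) +
        (\<Sum>u | u \<in> J st b \<and> pos q \<le> pos u. Bf l st u) + gam (st a)))"
  "gam (st' a) = (if pos a < p then
      (\<Sum>x | x \<in> blk l a \<and> p \<le> pos x. \<Sum>u | u \<in> V \<and> mt st x u \<and> pos q \<le> pos u. wt x u) +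
        (\<Sum>u | u \<in> J st b \<and> pos q \<le> pos u. Bf l st u) + gam (st a) else gam (st a))"
    unfolding act(2) by blast+
qed

lemma blk_V': "x \<in> blk l a \<Longrightarrow> x \<in> V' \<and> pth x = pth a"
  using pth_pos[OF aV] by (auto simp: blk_def V'_pth)

lemma Y_mass:
  assumes "A \<subseteq> blk l a"
  shows "(\<Sum>x\<in>A. \<Sum>u | u \<in> V \<and> mt st x u \<and> pos q \<le> pos u. wt x u) = mass A (below q)"
  unfolding mass_def using assms blk_V' Yq by (intro sum.cong refl) (metis subsetD)

text \<open>\<open>below a\<close> is the rest of its block together with the rows beyond the block.
  The level has computed the weight of both parts against \<open>below q\<close>.\<close>

lemma best_eq: "best (st' a) = min (best (st a)) (cost a q)"
proof -
  have sub: "bsuf l a \<subseteq> blk l a" by (auto simp: bsuf_def)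
  have "below a = bsuf l a \<union> rows a (Suc k * 2 ^ l)"
  proof (rule set_eqI)
    fix x
    have "pos a \<le> pos x \<longleftrightarrow> (pos x div 2 ^ l = k \<and> pos a \<le> pos x) \<or> k < pos x div 2 ^ l"
      using div_le_mono[of "pos a" "pos x" "2 ^ l"] div_le_mono[of "pos x" "pos a" "2 ^ l"] by linarith
    then show "x \<in> below a \<longleftrightarrow> x \<in> bsuf l a \<union> rows a (Suc k * 2 ^ l)"
      unfolding rows_def below_def bsuf_def blk_def div_le_iff using pth_pos[OF aV] by (auto simp: V'_pth)
  qed
  moreover have "bsuf l a \<inter> rows a (Suc k * 2 ^ l) = {}"
    unfolding rows_def bsuf_def blk_def div_le_iff by auto
  moreover have "finite (bsuf l a)" using finite_sub[OF blk_sub(2)] .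
  ultimately have "W a q = mass (bsuf l a) (below q) + mass (rows a (Suc k * 2 ^ l)) (below q)"
    unfolding W_mass by (simp add: mass_Un1)
  then show ?thesis unfolding post_active(1) cost_def Y_mass[OF sub] using rest by (simp add: add.assoc)
qed

text \<open>For a row in the upper half, the next block ends at the middle row \<open>p\<close> and
  the next interval ends before \<open>q\<close>. What lies beyond both is the rows from
  \<open>p\<close> on against the columns from \<open>q\<close> on.\<close>

lemma gam_low:
  assumes "pos a < p" shows "gam (st' a) = mass (rows a p) (below q)"
proof -
  let ?A = "{x \<in> blk l a. p \<le> pos x}"
  have pk: "p \<le> Suc k * 2 ^ l" unfolding thr_def by simp
  have kp: "k * 2 ^ l \<le> p" unfolding thr_def by simp
  have "rows a p = ?A \<union> rows a (Suc k * 2 ^ l)"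
  proof (rule set_eqI)
    fix x
    have "k \<le> pos x div 2 ^ l" if "p \<le> pos x"
      using div_le_mono[of "k * 2 ^ l" "pos x" "2 ^ l"] kp that by simp
    then have "p \<le> pos x \<longleftrightarrow> (pos x div 2 ^ l = k \<and> p \<le> pos x) \<or> Suc k * 2 ^ l \<le> pos x"
      using pk div_le_iff[of k l "pos x"] by linarith
    then show "x \<in> rows a p \<longleftrightarrow> x \<in> ?A \<union> rows a (Suc k * 2 ^ l)"
      unfolding rows_def blk_def using pth_pos[OF aV] by (auto simp: V'_pth)
  qed
  moreover have "?A \<inter> rows a (Suc k * 2 ^ l) = {}" unfolding rows_def blk_def div_le_iff by auto
  moreover have "finite ?A" using finite_sub[OF blk_sub(1)] by simp
  ultimately have "mass (rows a p) (below q) = mass ?A (below q) + mass (rows a (Suc k * 2 ^ l)) (below q)"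
    by (simp add: mass_Un1)
  then show ?thesis using post_active(2) assms Y_mass[of ?A] rest by (simp add: add.assoc)
qed

lemma Xq:
  assumes "s \<le> e" "\<And>u. u \<in> cols b s e \<Longrightarrow> u \<in> J st b"
  shows "(\<Sum>u\<in>cols b s e. Xf l st u) = mass (rows a p) (cols b s e)"
proof -
  have "Xf l st u = (\<Sum>x\<in>rows a p. wt x u)" if u: "u \<in> cols b s e" for u
  proof -
    have uV: "u \<in> V'" "pth u = pth b" "rk (st u) = k" using assms(2)[OF u] J_iff[OF bV] rkb by auto
    have "{x. x \<in> V \<and> mt st x u \<and> thr l (rk (st u)) \<le> pos x} = rows a p"
      using mt_transfer'[OF ab uV(1,2)] uV(3) V'_V by (auto simp: rows_def)
    then show ?thesis unfolding Xf_def by (simp add: wt_sym)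
  qed
  then show ?thesis unfolding mass_def by (subst sum.swap) (intro sum.cong, auto)
qed

lemma below_cols:
  assumes "u \<in> V'" "v \<in> V'" "pth u = pth b" "pth v = pth b" "pos u \<le> pos v"
  shows "below u = cols b (pos u) (pos v) \<union> below v" "cols b (pos u) (pos v) \<inter> below v = {}"
  using assms by (auto simp: below_def cols_def)

lemma cols_J:
  assumes "u \<in> J st b" "v \<in> J st b" "x \<in> cols b (pos u) (pos v)" shows "x \<in> J st b"
proof -
  have u: "u \<in> V'" "pth u = pth b" "rk (st u) = rk (st b)" and v: "v \<in> V'" "pth v = pth b" "rk (st v) = rk (st b)"
    using assms J_iff[OF bV] by auto
  have x: "x \<in> V'" "pth x = pth b" "pos u \<le> pos x" "pos x < pos v" using assms(3) by (auto simp: cols_def)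
  have "rk (st u) \<le> rk (st x)" "rk (st x) \<le> rk (st v)"
    using uniform(3)[OF u(1) x(1)] uniform(3)[OF x(1) v(1)] u v x by auto
  then show ?thesis using J_iff[OF bV] u v x by simp
qed

text \<open>The level compares suffix sums over the entire right path, whose terms beyond the
  interval refer to other middle rows. Those terms are common to all columns of the interval and
  cancel, while the columns in between all refer to \<open>p\<close>.\<close>

lemma optimal:
  assumes "b' \<in> J st b"
  shows "pos q \<le> pos b' \<Longrightarrow> cm q \<le> cm b' + 2 * mass (rows a p) (cols b (pos q) (pos b'))"
    "pos b' \<le> pos q \<Longrightarrow> cm q + 2 * mass (rows a p) (cols b (pos b') (pos q)) \<le> cm b'"
proof -
  obtain q' where q': "q' \<in> J st b" "pos q' = qf b"
    "\<forall>c\<in>J st b. cm q' + 2 * (\<Sum>u\<in>below c. Xf l st u) \<le> cm c + 2 * (\<Sum>u\<in>below q'. Xf l st u)"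
    using post bV unfolding level_post_def by blast
  have "q' = q" using V'_eqI[of q' q] q' q J_iff[OF bV] by simp
  with q' assms have o: "cm q + 2 * (\<Sum>u\<in>below b'. Xf l st u) \<le> cm b' + 2 * (\<Sum>u\<in>below q. Xf l st u)" by blast
  have b': "b' \<in> V'" "pth b' = pth b" using assms J_iff[OF bV] by auto
  {
    assume h: "pos q \<le> pos b'"
    note bc = below_cols[OF qV(1) b'(1) qV(2) b'(2) h]
    have "(\<Sum>u\<in>below q. Xf l st u) = (\<Sum>u\<in>cols b (pos q) (pos b'). Xf l st u) + (\<Sum>u\<in>below b'. Xf l st u)"
      unfolding bc(1) using bc(2) by (intro sum.union_disjoint) auto
    then show "cm q \<le> cm b' + 2 * mass (rows a p) (cols b (pos q) (pos b'))"
      using o Xq[OF h] cols_J[OF q(1) assms] by simp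
  }
  {
    assume h: "pos b' \<le> pos q"
    note bc = below_cols[OF b'(1) qV(1) b'(2) qV(2) h]
    have "(\<Sum>u\<in>below b'. Xf l st u) = (\<Sum>u\<in>cols b (pos b') (pos q). Xf l st u) + (\<Sum>u\<in>below q. Xf l st u)"
      unfolding bc(1) using bc(2) by (intro sum.union_disjoint) auto
    then show "cm q + 2 * mass (rows a p) (cols b (pos b') (pos q)) \<le> cm b'"
      using o Xq[OF h] cols_J[OF assms q(1)] by simp
  }
qed

lemma below_rows: "below a = rows a (pos a)"
  by (simp add: below_def rows_def)

text \<open>The Monge property in use: going from column \<open>b\<close> to \<open>q\<close>
  changes \<open>W\<close> by the weight of the columns between them, counted over the rows of the
  suffix. As \<open>q\<close> is optimal for the rows from \<open>p\<close> on, it stays at least as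
  good for the rows from \<open>pos a\<close> on if that weight shifts in its favour.\<close>

lemma cost_q_le:
  assumes h: "pos q \<le> pos b \<and> mass (rows a p) (cols b (pos q) (pos b)) \<le> mass (rows a (pos a)) (cols b (pos q) (pos b)) \<or>
    pos b < pos q \<and> mass (rows a (pos a)) (cols b (pos b) (pos q)) \<le> mass (rows a p) (cols b (pos b) (pos q))"
  shows "cost a q \<le> cost a b"
proof -
  have bJ: "b \<in> J st b" using V'_V[OF bV] by (simp add: J_def)
  have ne: "pth a \<noteq> pth b" using ab by (simp add: mt_def)
  have Wb: "W a b \<le> cm a" "W a b \<le> cm b" using W_le_cm[OF aV bV ne] .
  from h show ?thesis
  proof (elim disjE conjE)
    assume h: "pos q \<le> pos b" "mass (rows a p) (cols b (pos q) (pos b)) \<le> mass (rows a (pos a)) (cols b (pos q) (pos b))"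
    have "W a q = mass (rows a (pos a)) (cols b (pos q) (pos b)) + W a b"
      unfolding W_mass below_rows below_cols(1)[OF qV(1) bV qV(2) refl h(1)]
      using below_cols(2)[OF qV(1) bV qV(2) refl h(1)] by (intro mass_Un2) auto
    then show ?thesis using optimal(1)[OF bJ h(1)] h(2) Wb unfolding cost_def by linarith
  next
    assume h: "pos b < pos q" "mass (rows a (pos a)) (cols b (pos b) (pos q)) \<le> mass (rows a p) (cols b (pos b) (pos q))"
    have "W a b = mass (rows a (pos a)) (cols b (pos b) (pos q)) + W a q"
      unfolding W_mass below_rows below_cols(1)[OF bV qV(1) refl qV(2) less_imp_le[OF h(1)]]
      using below_cols(2)[OF bV qV(1) refl qV(2) less_imp_le[OF h(1)]] by (intro mass_Un2) auto
    then show ?thesis using optimal(2)[OF bJ less_imp_le[OF h(1)]] h(2) Wb unfolding cost_def by linarith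
  qed
qed

lemma rk'_b: "rk (st' b) = 2 * k + (if pos q \<le> pos b then 1 else 0)"
  using post_frame(4)[OF V'_V[OF bV]] rkb q(2) by simp

lemma level_cover:
  "best (st' a) \<le> cost a b \<or> 0 < l \<and> rk (st' b) = pos a div 2 ^ (l - 1) \<and> rect (l - 1) st' a b"
proof (rule ccontr)
  assume neg: "\<not> ?thesis"
  then have nc: "\<not> cost a q \<le> cost a b" using best_eq by auto
  have half: "pos a div 2 ^ (l - 1) = 2 * k + (if p \<le> pos a then 1 else 0)" if lp: "0 < l"
  proof -
    obtain m where m: "l = Suc m" using lp by (cases l) auto
    have "pos a div 2 ^ m div 2 = k" unfolding m by (simp add: div_mult2_eq[symmetric] mult.commute)
    then have e: "pos a div 2 ^ m = 2 * k \<or> pos a div 2 ^ m = Suc (2 * k)" by linarith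
    have "p = Suc (2 * k) * 2 ^ m" unfolding thr_def m by simp
    then have "p \<le> pos a \<longleftrightarrow> 2 * k < pos a div 2 ^ m" using div_le_iff[of "2 * k" m "pos a"] by simp
    then show ?thesis using e m by auto
  qed
  have JJ: "u \<in> J st' b" if "u \<in> J st b" "(pos q \<le> pos u) = (pos q \<le> pos b)" for u
  proof -
    have u: "u \<in> V'" "pth u = pth b" "rk (st u) = k" using that(1) J_iff[OF bV] rkb by auto
    have "rk (st' u) = rk (st' b)"
      using post_frame(4)[OF V'_V[OF u(1)]] u(3) qf_J[OF bV that(1)] q(2) that(2) rk'_b by simp
    then show ?thesis using u V'_V by (simp add: J_def)
  qed
  have BB: "x \<in> blk (l - 1) a" if "0 < l" "x \<in> rows a (k * 2 ^ l)" "pos x < Suc k * 2 ^ l" "(p \<le> pos x) = (p \<le> pos a)" for x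
  proof -
    from that(1) obtain m where m: "l = Suc m" by (cases l) auto
    have x: "x \<in> V'" "pth x = pth a" "k * 2 ^ l \<le> pos x" using that(2) by (auto simp: rows_def)
    have "\<not> k < pos x div 2 ^ l" using div_le_iff[of k l "pos x"] that(3) by simp
    moreover have "k \<le> pos x div 2 ^ l" using div_le_mono[OF x(3), of "2 ^ l"] by simp
    ultimately have "pos x div 2 ^ l = k" by simp
    then have "pos x div 2 ^ m div 2 = k" unfolding m by (simp add: div_mult2_eq[symmetric] mult.commute)
    then have e: "pos x div 2 ^ m = 2 * k \<or> pos x div 2 ^ m = Suc (2 * k)" by linarith
    have "p = Suc (2 * k) * 2 ^ m" unfolding thr_def m by simp
    then have "p \<le> pos x \<longleftrightarrow> 2 * k < pos x div 2 ^ m" using div_le_iff[of "2 * k" m "pos x"] by simp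
    then have "pos x div 2 ^ m = pos a div 2 ^ m" using e half[OF that(1)] that(4) m by auto
    then show ?thesis using x V'_V m by (simp add: blk_def)
  qed
  have l0: "0 < l" if "pos a < p"
  proof (rule ccontr)
    assume "\<not> 0 < l"
    then show False using that by (simp add: thr_def)
  qed
  have ka: "k * 2 ^ l \<le> pos a" "pos a < Suc k * 2 ^ l"
    using div_times_less_eq_dividend[of "pos a" "2 ^ l"] div_le_iff[of k l "pos a"] by auto
  have pk: "p \<le> Suc k * 2 ^ l" "k * 2 ^ l \<le> p" by (simp_all add: thr_def)
  have mono: "mass (rows a t) B \<le> mass (rows a t') B" if "t' \<le> t" for t t' B
    using that by (intro mass_mono) (auto simp: rows_def)
  have split: "mass (rows a t') B = mass {x \<in> rows a t'. pos x < t} B + mass (rows a t) B" if "t' \<le> t" for t t' B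
  proof -
    have "rows a t' = {x \<in> rows a t'. pos x < t} \<union> rows a t" using that by (auto simp: rows_def)
    then have "mass (rows a t') B = mass ({x \<in> rows a t'. pos x < t} \<union> rows a t) B" by (rule arg_cong)
    also have "\<dots> = mass {x \<in> rows a t'. pos x < t} B + mass (rows a t) B"
      by (rule mass_Un1) (simp, simp, auto simp: rows_def)
    finally show ?thesis .
  qed
  have bJ: "b \<in> J st b" using V'_V[OF bV] by (simp add: J_def)
  show False
  proof (cases "pos a < p")
    case ap: True
    show False
    proof (cases "pos q \<le> pos b")
      case True
      \<comment> \<open>A suffix that starts above \<open>p\<close> can only gain weight on the
        columns from \<open>q\<close> to \<open>b\<close>, and this favours the column nearer to the
        root, which is \<open>q\<close>.\<close>
      then show False using nc cost_q_le mono[of "pos a" p] ap by simp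
    next
      case bq: False
      have "rk (st' b) = pos a div 2 ^ (l - 1)" using rk'_b half[OF l0[OF ap]] ap bq by simp
      then have nr: "\<not> rect (l - 1) st' a b" using neg l0[OF ap] by blast
      \<comment> \<open>This strip lies in a quarter that is passed on. With an edge in that quarter
        the pair would still be live, contrary to \<open>neg\<close>; so the strip has no weight and
        the rows from \<open>pos a\<close> and from \<open>p\<close> on see these columns
        alike.\<close>
      have "mass {x \<in> rows a (pos a). pos x < p} (cols b (pos b) (pos q)) = 0"
      proof (rule mass_0)
        fix x u assume x: "x \<in> {x \<in> rows a (pos a). pos x < p}" and u: "u \<in> cols b (pos b) (pos q)"
        have "x \<in> blk (l - 1) a"
          by (rule BB[OF l0[OF ap]]) (use x pk ap in \<open>auto simp: rows_def intro: order_trans[OF ka(1)]\<close>)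
        moreover have "u \<in> J st' b"
          by (rule JJ[OF cols_J[OF bJ q(1) u]]) (use u bq in \<open>auto simp: cols_def\<close>)
        ultimately show "{x, u} \<notin> E" using nr by (auto simp: rect_def)
      qed
      then have "mass (rows a (pos a)) (cols b (pos b) (pos q)) = mass (rows a p) (cols b (pos b) (pos q))"
        using split[of "pos a" p] ap by simp
      then show False using nc cost_q_le bq by simp
    qed
  next
    case ap: False
    show False
    proof (cases "pos q \<le> pos b")
      case bq: False
      then show False using nc cost_q_le mono[of p "pos a"] ap by simp
    next
      case bq: True
      have "mass {x \<in> rows a p. pos x < pos a} (cols b (pos q) (pos b)) = 0"
      \<comment> \<open>At level 0 the row of \<open>a\<close> is the middle row itself and the
        strip is empty.\<close>
      proof (cases "0 < l")
        case False
        then have "p = pos a" by (simp add: thr_def)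
        then show ?thesis by (intro mass_0) (auto simp: rows_def)
      next
        case l0: True
        have "rk (st' b) = pos a div 2 ^ (l - 1)" using rk'_b half[OF l0] ap bq by simp
        then have nr: "\<not> rect (l - 1) st' a b" using neg l0 by blast
        show ?thesis
        proof (rule mass_0)
          fix x u assume x: "x \<in> {x \<in> rows a p. pos x < pos a}" and u: "u \<in> cols b (pos q) (pos b)"
          have "x \<in> blk (l - 1) a"
            by (rule BB[OF l0]) (use x pk ap ka(2) in \<open>auto simp: rows_def intro: order_trans[OF pk(2)]\<close>)
          moreover have "u \<in> J st' b"
            by (rule JJ[OF cols_J[OF q(1) bJ u]]) (use u bq in \<open>auto simp: cols_def\<close>)
          ultimately show "{x, u} \<notin> E" using nr by (auto simp: rect_def)
        qed
      qed
      then have "mass (rows a p) (cols b (pos q) (pos b)) = mass (rows a (pos a)) (cols b (pos q) (pos b))"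
        using split[of p "pos a"] ap by simp
      then show False using nc cost_q_le bq by simp
    qed
  qed
qed

end

lemma q_ex: "b \<in> V' \<Longrightarrow> \<exists>q\<in>J st b. pos q = qf b"
  using post unfolding level_post_def by blast

lemma cover_step:
  assumes "mt st a b" "linked a b"
  shows "best (st' a) \<le> cost a b \<or> 0 < l \<and> rk (st' b) = pos a div 2 ^ (l - 1) \<and> rect (l - 1) st' a b"
proof -
  have V: "a \<in> V'" "b \<in> V'" using assms(1) by (auto simp: mt_def)
  have "best (st a) \<le> cost a b \<or> rk (st b) = pos a div 2 ^ l \<and> rect l st a b"
    using inv assms unfolding slot_inv_def by blast
  then show ?thesis
  proof
    assume "best (st a) \<le> cost a b"
    then show ?thesis using best_le[OF V(1)] by linarith
  next
    assume h: "rk (st b) = pos a div 2 ^ l \<and> rect l st a b"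
    obtain q where "q \<in> J st b" "pos q = qf b" using q_ex[OF V(2)] by blast
    with h show ?thesis using level_cover[OF assms(1)] by blast
  qed
qed

lemma valid_step: "a \<in> V' \<Longrightarrow> smc \<le> best (st' a)"
proof -
  assume a: "a \<in> V'"
  have s: "smc \<le> best (st a)" using inv a unfolding slot_inv_def by blast
  show ?thesis
  proof (cases "\<exists>a' b. active l st a a' b")
    case True
    then obtain a' b where act: "active l st a a' b" by blast
    then have b: "a' \<in> blk l a" "mt st a' b" "{a', b} \<in> E" "rk (st b) = pos a div 2 ^ l" by (auto simp: active_def)
    have bV: "b \<in> V'" using b(2) by (simp add: mt_def)
    have "pth a' = pth a" using b(1) by (simp add: blk_def)
    then have ab: "mt st a b" using mt_transfer[OF b(2) a, of b] bV by simp
    have "rect l st a b" unfolding rect_def using b V'_V[OF bV] by (auto simp: J_def)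
    moreover obtain q where q: "q \<in> J st b" "pos q = qf b" using q_ex[OF bV] by blast
    ultimately have "best (st' a) = min (best (st a)) (cost a q)" using best_eq[OF ab b(4)] by blast
    moreover have "smc \<le> cost a q"
      using q(1) J_iff[OF bV] ab a by (intro smc_le_cost) (auto simp: mt_def)
    ultimately show ?thesis using s by simp
  next
    case False
    then have "best (st' a) = best (st a)" using post a unfolding level_post_def by blast
    then show ?thesis using s by simp
  qed
qed

lemma pre_step:
  assumes "0 < l" shows "level_pre (l - 1) st'"
proof -
  have pre: "ready st" "\<And>v. v \<in> V \<Longrightarrow> kl (st v) \<le> 2 ^ Suc L \<and> kr (st v) \<le> 2 ^ Suc L \<and> rk (st v) < 2 ^ (L - l)"
    using inv_pre unfolding level_pre_def by blast+
  have "ready st'" by (rule ready_cong[OF pre(1)]) (rule post_frame(1))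
  moreover have "rk (st' v) < 2 ^ (L - (l - 1))" if "v \<in> V" for v
  proof -
    have "L - (l - 1) = Suc (L - l)" using assms lL by simp
    moreover have "rk (st v) < 2 ^ (L - l)" using pre(2)[OF that] by blast
    ultimately show ?thesis using post_frame(4)[OF that] by simp
  qed
  \<comment> \<open>Nodes of one interval share \<open>qf\<close>, so the appended bit is monotone;
    between intervals, doubling leaves room for it.\<close>
  moreover have "rk (st' u) \<le> rk (st' v)" if uv: "u \<in> V'" "v \<in> V'" "pth u = pth v" "pos u \<le> pos v" for u v
  proof (cases "rk (st u) = rk (st v)")
    case True
    then have "qf u = qf v" using qf_J[OF uv(2), of u] J_iff[OF uv(2), of u] uv by simp
    then show ?thesis using True post_frame(4)[OF V'_V[OF uv(1)]] post_frame(4)[OF V'_V[OF uv(2)]] uv(4) by simp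
  next
    case False
    then show ?thesis using uniform(3)[OF uv(1-4)] post_frame(4)[OF V'_V[OF uv(1)]] post_frame(4)[OF V'_V[OF uv(2)]] by simp
  qed
  moreover have "kl (st' v) \<le> 2 ^ Suc L \<and> kr (st' v) \<le> 2 ^ Suc L" if "v \<in> V" for v
    using post_frame(2,3)[OF that] pre(2)[OF that] by simp
  moreover have "kl (st' u) = kl (st' v) \<and> kr (st' u) = kr (st' v)" if uv: "u \<in> V'" "v \<in> V'" "pth u = pth v" for u v
    using uniform(1,2)[OF uv] post_frame(2,3)[OF V'_V[OF uv(1)]] post_frame(2,3)[OF V'_V[OF uv(2)]] by simp
  ultimately show ?thesis unfolding level_pre_def by blast
qed

text \<open>A live rectangle descends from a live one, so its old \<open>gam\<close> was correct. In
  the upper half \<open>gam_low\<close> applies; in the lower half block and interval keep their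
  ends, so the value carries over.\<close>

lemma gam_step:
  assumes l0: "0 < l" and ab: "mt st a b" and rkb: "rk (st' b) = pos a div 2 ^ (l - 1)" and re: "rect (l - 1) st' a b"
  shows "gam (st' a) = mass (rows a (Suc (pos a div 2 ^ (l - 1)) * 2 ^ (l - 1))) (above st' b)"
proof -
  have V: "a \<in> V'" "b \<in> V'" using ab by (auto simp: mt_def)
  from l0 obtain m where m: "l = Suc m" by (cases l) auto
  let ?k = "pos a div 2 ^ l"
  have half: "pos x div 2 ^ m div 2 = pos x div 2 ^ l" for x unfolding m by (simp add: div_mult2_eq[symmetric] mult.commute)
  have r': "rk (st' v) div 2 = rk (st v)" if "v \<in> V" for v using post_frame(4)[OF that] by simp
  have rkb0: "rk (st b) = ?k" using r'[OF V'_V[OF V(2)]] rkb half[of a] m by simp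
  have re0: "rect l st a b"
  proof -
    obtain a' b' where h: "a' \<in> blk (l - 1) a" "b' \<in> J st' b" "{a', b'} \<in> E" using re by (auto simp: rect_def)
    have "a' \<in> blk l a" using h(1) half[of a] half[of a'] m by (simp add: blk_def)
    moreover have "b' \<in> J st b" using h(2) r'[of b'] r'[OF V'_V[OF V(2)]] by (auto simp: J_def)
    ultimately show ?thesis using h(3) by (auto simp: rect_def)
  qed
  obtain q where q: "q \<in> J st b" "pos q = qf b" using q_ex[OF V(2)] by blast
  note C = ab rkb0 re0 q
  have rkb': "rk (st' b) = 2 * ?k + (if pos q \<le> pos b then 1 else 0)" by (rule rk'_b[OF C])
  have p: "thr l ?k = Suc (2 * ?k) * 2 ^ m" unfolding thr_def m by simp
  have pa: "thr l ?k \<le> pos a \<longleftrightarrow> 2 * ?k < pos a div 2 ^ m" unfolding p using div_le_iff[of "2 * ?k" m "pos a"] by simp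
  have e: "pos a div 2 ^ m = 2 * ?k \<or> pos a div 2 ^ m = Suc (2 * ?k)" using half[of a] by linarith
  have qu: "rk (st' u) = 2 * rk (st u) + (if pos q \<le> pos u then 1 else 0)" if "u \<in> J st b" for u
    using post_frame(4)[of u] qf_J[OF V(2) that] q(2) that V'_V J_iff[OF V(2)] by simp
  have r2: "2 * rk (st u) \<le> rk (st' u)" "rk (st' u) \<le> 2 * rk (st u) + 1" if "u \<in> V'" for u
    using post_frame(4)[OF V'_V[OF that]] by auto
  show ?thesis
  proof (cases "pos a < thr l ?k")
    case True
    then have k: "pos a div 2 ^ m = 2 * ?k" using e pa by auto
    have "above st' b = below q"
    proof -
      have ab: "rk (st' b) = 2 * ?k" using rkb k m by simp
      have "u \<in> above st' b \<longleftrightarrow> u \<in> {u \<in> J st b. pos q \<le> pos u} \<union> above st b" for u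
      proof (cases "u \<in> V' \<and> pth u = pth b")
        case True
        then show ?thesis
          using ab r2[of u] qu[of u] rkb0 J_iff[OF V(2), of u] unfolding above_def
          by (cases "rk (st u) = ?k") auto
      next
        case False
        then show ?thesis using J_iff[OF V(2), of u] by (auto simp: above_def)
      qed
      then show ?thesis unfolding below_q(1)[OF C] by blast
    qed
    then show ?thesis using gam_low[OF C True] k m p by simp
  next
    case False
    then have k: "pos a div 2 ^ m = Suc (2 * ?k)" using e pa by auto
    have "above st' b = above st b"
    proof -
      have ab: "rk (st' b) = Suc (2 * ?k)" using rkb k m by simp
      show ?thesis unfolding above_def using ab rkb0 r2 by (auto; fastforce)
    qed
    moreover have "Suc (pos a div 2 ^ m) * 2 ^ m = Suc ?k * 2 ^ l" unfolding k m by simp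
    ultimately show ?thesis using post_active(2)[OF C] gam_eq[OF C] False m by simp
  qed
qed

lemma slot_step:
  assumes "0 < l" shows "slot_inv (l - 1) st'"
  unfolding slot_inv_def
proof (intro conjI allI impI ballI)
  show "level_pre (l - 1) st'" by (rule pre_step[OF assms])
next
  fix a b assume "mt st' a b" "linked a b"
  then show "best (st' a) \<le> cost a b \<or> rk (st' b) = pos a div 2 ^ (l - 1) \<and> rect (l - 1) st' a b"
    using cover_step unfolding mt_cong by blast
next
  fix a b assume "mt st' a b" "rk (st' b) = pos a div 2 ^ (l - 1)" "rect (l - 1) st' a b"
  then show "gam (st' a) = mass (rows a (Suc (pos a div 2 ^ (l - 1)) * 2 ^ (l - 1))) (above st' b)"
    using gam_step[OF assms] unfolding mt_cong by blast
next
  fix a assume "a \<in> V'"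
  then show "smc \<le> best (st' a)" by (rule valid_step)
qed

end

end

section \<open>The algorithm\<close>

text \<open>On path nodes the search stays within the clamp by \<open>quantile_le\<close>. At the
  root, where its outcome is not specified, the clamp guarantees that broadcasts fit their
  fields.\<close>

definition slot :: "nat \<Rightarrow> (nat \<times> nat) \<times> nat \<times> nat \<Rightarrow> nst step list" where
  "slot L = (\<lambda>((s, m), (s', m')). find_partner L s m @ local_step (\<lambda>st. st\<lparr>kl := min (kap st) (2 ^ Suc L)\<rparr>) #
     find_partner L s' m' @ local_step (\<lambda>st. st\<lparr>kr := min (kap st) (2 ^ Suc L), rk := 0, gam := 0\<rparr>) #
     concat (map (level L) (rev [0..<Suc L])))"

text \<open>Scales up to \<open>3 * L\<close> suffice because \<open>D\<close> is at most
  \<open>2 ^ (3 * L)\<close>. The two paths of a pair may find each other at different scales and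
  quantiles, hence all pairs of indices.\<close>

definition slots :: "nat \<Rightarrow> ((nat \<times> nat) \<times> nat \<times> nat) list" where
  "slots L = (let I = List.product [0..<Suc (3 * L)] [1..<5] in List.product I I)"

text \<open>Only maxima are available, so the minimum is taken by complementing with respect to
  \<open>2 * big_cut L\<close>. The root owns no tree edge and contributes the neutral value
  0.\<close>

definition finish :: "nat \<Rightarrow> nst step" where
  "finish L = \<lparr> bcast = \<lambda>_. vl [], reply = \<lambda>_ _ _ _. vl [], join = \<lambda>_ _. True,
     share = \<lambda>st _. vl [0, 0, if pid st = 0 then 0 else 2 * big_cut L - min (best st) (cut st)],
     update = \<lambda>st _ S. st\<lparr>best := 2 * big_cut L - S 2\<rparr> \<rparr>"

definition main_prog :: "bool \<Rightarrow> nat \<Rightarrow> nst step list" where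
  "main_prog link L = ids @ positions L @ cuts link L @ concat (map (slot L) (slots L)) @ [finish L]"

definition init_state :: "node \<Rightarrow> nst" where
  "init_state v = \<lparr> ident = v, pid = 0, seg = 0, off = 0, mk = 0, xin = 0, acc = 0, cut = 0,
     cutm = 0, dn = 0, dd = 0, tot = 0, kap = 0, kl = 0, kr = 0, rk = 0, qs = 0, bet = 0, bs = 0,
     cq = 0, lq = 0, lb = 0, lc = 0, gam = 0, best = 0 \<rparr>"

context star_prog begin

lemma levels_run:
  assumes "slot_inv l st" "l \<le> L"
  defines "st' \<equiv> run N L (concat (map (level L) (rev [0..<Suc l]))) st"
  shows "ready st'" "\<And>a. a \<in> V' \<Longrightarrow> smc \<le> best (st' a) \<and> best (st' a) \<le> best (st a)"
    "\<And>a b. mt st a b \<Longrightarrow> linked a b \<Longrightarrow> best (st' a) \<le> cost a b"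
proof -
  have "ready (run N L (concat (map (level L) (rev [0..<Suc l]))) st) \<and>
    (\<forall>a\<in>V'. smc \<le> best (run N L (concat (map (level L) (rev [0..<Suc l]))) st a) \<and>
      best (run N L (concat (map (level L) (rev [0..<Suc l]))) st a) \<le> best (st a)) \<and>
    (\<forall>a b. mt st a b \<longrightarrow> linked a b \<longrightarrow> best (run N L (concat (map (level L) (rev [0..<Suc l]))) st a) \<le> cost a b)"
    using assms(1,2)
  proof (induction l arbitrary: st)
    case 0
    let ?e = "run N L (level L 0) st"
    have pre: "level_pre 0 st" using 0 by (simp add: slot_inv_def)
    note post = level_run[OF pre 0(2)]
    have "ready st" using pre by (simp add: level_pre_def)
    then have "ready ?e" by (rule ready_cong) (rule post_frame(1)[OF 0 post])
    then show ?case
      using best_le[OF 0 post] valid_step[OF 0 post] cover_step[OF 0 post] by auto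
  next
    case (Suc l)
    let ?e = "run N L (level L (Suc l)) st"
    have pre: "level_pre (Suc l) st" using Suc by (simp add: slot_inv_def)
    note post = level_run[OF pre Suc.prems(2)]
    have inv: "slot_inv l ?e" using slot_step[OF Suc.prems post] by simp
    have l: "l \<le> L" using Suc.prems by simp
    have run: "run N L (concat (map (level L) (rev [0..<Suc (Suc l)]))) st =
      run N L (concat (map (level L) (rev [0..<Suc l]))) ?e" by (simp add: run_append)
    note IH = Suc.IH[OF inv l]
    show ?case unfolding run
    proof (intro conjI ballI allI impI)
      fix a assume a: "a \<in> V'"
      have b: "best (?e a) \<le> best (st a)" by (rule best_le[OF Suc.prems post a])
      show "smc \<le> best (run N L (concat (map (level L) (rev [0..<Suc l]))) ?e a)" using IH a by blast
      have "best (run N L (concat (map (level L) (rev [0..<Suc l]))) ?e a) \<le> best (?e a)" using IH a by blast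
      then show "best (run N L (concat (map (level L) (rev [0..<Suc l]))) ?e a) \<le> best (st a)"
        using b by (rule order_trans)
    next
      fix a b assume "mt st a b" "linked a b"
      moreover then have "mt ?e a b" using mt_cong[OF Suc.prems post] by blast
      ultimately show "best (run N L (concat (map (level L) (rev [0..<Suc l]))) ?e a) \<le> cost a b"
        using IH by blast
    qed (use IH in blast)
  qed
  then show "ready st'" "\<And>a. a \<in> V' \<Longrightarrow> smc \<le> best (st' a) \<and> best (st' a) \<le> best (st a)"
    "\<And>a b. mt st a b \<Longrightarrow> linked a b \<Longrightarrow> best (st' a) \<le> cost a b"
    unfolding st'_def by blast+
qed

lemma slot_run:
  fixes s m s' m' :: nat
  assumes R: "ready st" and val: "\<And>a. a \<in> V' \<Longrightarrow> smc \<le> best (st a)"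
  defines "st' \<equiv> run N L (slot L ((s, m), (s', m'))) st"
  shows "ready st'" "\<And>a. a \<in> V' \<Longrightarrow> smc \<le> best (st' a) \<and> best (st' a) \<le> best (st a)"
    "\<And>a b. a \<in> V' \<Longrightarrow> b \<in> V' \<Longrightarrow> pth a \<noteq> pth b \<Longrightarrow> quantile s m (pth a) = pth b \<Longrightarrow>
      quantile s' m' (pth b) = pth a \<Longrightarrow> linked a b \<Longrightarrow> best (st' a) \<le> cost a b"
proof -
  define s1 where "s1 = run N L (find_partner L s m) st"
  define s2 where "s2 = (\<lambda>v. (s1 v)\<lparr>kl := min (kap (s1 v)) (2 ^ Suc L)\<rparr>)"
  define s3 where "s3 = run N L (find_partner L s' m') s2"
  define s4 where "s4 = (\<lambda>v. (s3 v)\<lparr>kr := min (kap (s3 v)) (2 ^ Suc L), rk := 0, gam := 0\<rparr>)"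
  have loc: "exec N L (local_step g) x = (\<lambda>v. g (x v))" for g x by (rule ext) simp
  have run: "st' = run N L (concat (map (level L) (rev [0..<Suc L]))) s4"
    unfolding st'_def slot_def s4_def s3_def s2_def s1_def by (simp only: prod.case run_append run_Cons loc)
  have s1: "s1 v = (st v)\<lparr>tot := tot (s1 v), xin := xin (s1 v), kap := kap (s1 v)\<rparr>" if "v \<in> V" for v
    unfolding s1_def by (rule find_partner_run(1)[OF R that])
  have c2: "core (s2 v) = core (st v)" "best (s2 v) = best (st v)" if "v \<in> V" for v
    unfolding s2_def by (subst s1[OF that], simp add: core_def)+
  have R2: "ready s2" by (rule ready_cong[OF R]) (rule c2(1))
  have s3: "s3 v = (s2 v)\<lparr>tot := tot (s3 v), xin := xin (s3 v), kap := kap (s3 v)\<rparr>" if "v \<in> V" for v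
    unfolding s3_def by (rule find_partner_run(1)[OF R2 that])
  have c4: "core (s4 v) = core (s2 v)" "best (s4 v) = best (s2 v)" "kl (s4 v) = kl (s2 v)" if "v \<in> V" for v
    unfolding s4_def by (subst s3[OF that], simp add: core_def)+
  have R4: "ready s4" by (rule ready_cong[OF R2]) (rule c4(1))
  have kl: "kl (s4 v) = quantile s m (pth v)" and kr: "kr (s4 v) = quantile s' m' (pth v)" if v: "v \<in> V'" for v
  proof -
    have "kap (s1 v) = quantile s m (pth v)" unfolding s1_def by (rule find_partner_run(2)[OF R V'_V[OF v] v])
    then show "kl (s4 v) = quantile s m (pth v)"
      using c4(3)[OF V'_V[OF v]] quantile_le[of s m "pth v"] by (simp add: s2_def)
    have "kap (s3 v) = quantile s' m' (pth v)" unfolding s3_def by (rule find_partner_run(2)[OF R2 V'_V[OF v] v])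
    then show "kr (s4 v) = quantile s' m' (pth v)"
      using quantile_le[of s' m' "pth v"] by (simp add: s4_def)
  qed
  have b4: "best (s4 v) = best (st v)" if "v \<in> V" for v using c4(2)[OF that] c2(2)[OF that] by simp
  have pre: "level_pre L s4" unfolding level_pre_def
  proof (intro conjI ballI impI)
    show "ready s4" by (rule R4)
    show "kl (s4 v) \<le> 2 ^ Suc L" if "v \<in> V" for v using c4(3)[OF that] by (simp add: s2_def)
    show "kl (s4 u) = kl (s4 v)" "kr (s4 u) = kr (s4 v)" if "u \<in> V'" "v \<in> V'" "pth u = pth v" for u v
      using kl kr that by simp_all
  qed (simp_all add: s4_def)
  have D0: "pos a div 2 ^ L = 0" if "a \<in> V" for a using pos_less[OF that] by simp
  have inv: "slot_inv L s4" unfolding slot_inv_def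
  proof (intro conjI allI impI ballI)
    show "level_pre L s4" by (rule pre)
  next
    fix a b assume ab: "mt s4 a b" and li: "linked a b"
    have V: "a \<in> V'" "b \<in> V'" using ab by (auto simp: mt_def)
    have "rk (s4 b) = pos a div 2 ^ L" using D0[OF V'_V[OF V(1)]] by (simp add: s4_def)
    moreover have "rect L s4 a b"
      using li D0 V'_V V unfolding rect_def linked_def blk_def J_def by (fastforce simp: s4_def)
    ultimately show "best (s4 a) \<le> cost a b \<or> rk (s4 b) = pos a div 2 ^ L \<and> rect L s4 a b" by blast
  next
    fix a b assume ab: "mt s4 a b"
    \<comment> \<open>Initially the block is the entire path, so nothing lies beyond it and
      \<open>gam = 0\<close> is correct.\<close>
    have "rows a (Suc (pos a div 2 ^ L) * 2 ^ L) = {}" using pos_less V'_V by (fastforce simp: rows_def)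
    then show "gam (s4 a) = mass (rows a (Suc (pos a div 2 ^ L) * 2 ^ L)) (above s4 b)"
      by (simp add: s4_def mass_def)
  next
    fix a assume a: "a \<in> V'"
    then show "smc \<le> best (s4 a)" using val b4[OF V'_V[OF a]] by simp
  qed
  note F = levels_run[OF inv order_refl, folded run]
  show "ready st'" by (rule F(1))
  show "smc \<le> best (st' a) \<and> best (st' a) \<le> best (st a)" if "a \<in> V'" for a
    using F(2)[OF that] b4[OF V'_V[OF that]] by simp
  show "best (st' a) \<le> cost a b" if "a \<in> V'" "b \<in> V'" "pth a \<noteq> pth b" "quantile s m (pth a) = pth b"
      "quantile s' m' (pth b) = pth a" "linked a b" for a b
    by (rule F(3)[OF _ that(6)]) (use that kl kr in \<open>simp add: mt_def\<close>)
qed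

lemma slots_run:
  assumes "ready st" "\<And>a. a \<in> V' \<Longrightarrow> smc \<le> best (st a)"
  shows "ready (run N L (concat (map (slot L) ts)) st) \<and>
    (\<forall>a\<in>V'. smc \<le> best (run N L (concat (map (slot L) ts)) st a) \<and>
      best (run N L (concat (map (slot L) ts)) st a) \<le> best (st a)) \<and>
    (\<forall>s m s' m' a b. ((s, m), (s', m')) \<in> set ts \<longrightarrow> a \<in> V' \<longrightarrow> b \<in> V' \<longrightarrow> pth a \<noteq> pth b \<longrightarrow>
      quantile s m (pth a) = pth b \<longrightarrow> quantile s' m' (pth b) = pth a \<longrightarrow> linked a b \<longrightarrow>
      best (run N L (concat (map (slot L) ts)) st a) \<le> cost a b)"
  using assms
proof (induction ts arbitrary: st)
  case Nil
  then show ?case by simp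
next
  case (Cons t ts)
  obtain s m s' m' where t: "t = ((s, m), (s', m'))" by (metis prod.exhaust)
  note F = slot_run[where s = s and m = m and s' = s' and m' = m', OF Cons.prems, folded t]
  let ?e = "run N L (slot L t) st"
  have R: "ready ?e" by (rule F(1))
  have val: "smc \<le> best (?e a)" if "a \<in> V'" for a using F(2)[OF _ that] by blast
  note IH = Cons.IH[OF R val]
  have run: "run N L (concat (map (slot L) (t # ts))) st = run N L (concat (map (slot L) ts)) ?e"
    by (simp add: run_append)
  show ?case unfolding run
  proof (intro conjI ballI allI impI)
    show "ready (run N L (concat (map (slot L) ts)) ?e)" using IH by blast
  next
    fix a assume a: "a \<in> V'"
    show "smc \<le> best (run N L (concat (map (slot L) ts)) ?e a)" using IH a by blast
    have "best (run N L (concat (map (slot L) ts)) ?e a) \<le> best (?e a)" using IH a by blast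
    also have "\<dots> \<le> best (st a)" using F(2)[OF _ a] by blast
    finally show "best (run N L (concat (map (slot L) ts)) ?e a) \<le> best (st a)" .
  next
    fix s1 m1 s2 m2 a b
    assume h: "((s1, m1), (s2, m2)) \<in> set (t # ts)" "a \<in> V'" "b \<in> V'" "pth a \<noteq> pth b"
      "quantile s1 m1 (pth a) = pth b" "quantile s2 m2 (pth b) = pth a" "linked a b"
    show "best (run N L (concat (map (slot L) ts)) ?e a) \<le> cost a b"
    proof (cases "((s1, m1), (s2, m2)) = t")
      case True
      then have "best (?e a) \<le> cost a b" using F(3)[OF _ h(2-4)] h(5-7) t by blast
      moreover have "best (run N L (concat (map (slot L) ts)) ?e a) \<le> best (?e a)" using IH h(2) by blast
      ultimately show ?thesis by (rule order_trans[rotated])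
    next
      case False
      then have "((s1, m1), (s2, m2)) \<in> set ts" using h(1) by auto
      then show ?thesis using IH h by blast
    qed
  qed
qed

lemma smc_le_cube: "smc \<le> 2 ^ (3 * L)"
proof -
  obtain v where "v \<in> V'" using V'_nonempty by blast
  then have "smc \<le> c1 v" by (intro smc_le) (simp add: cands_def)
  then show ?thesis using c1_le[of v] by (rule order_trans)
qed

lemma W_pos_linked: "0 < W a b \<Longrightarrow> linked a b"
proof (rule ccontr)
  assume "0 < W a b" "\<not> linked a b"
  then have "mass (below a) (below b) = 0" by (intro mass_0) (auto simp: linked_def below_def)
  then show False using \<open>0 < W a b\<close> by (simp add: W_mass)
qed

lemma supernode_finish: "v \<in> V \<Longrightarrow> supernode (joined N L (finish L) st) v = V"
proof -
  assume v: "v \<in> V"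
  have J: "joined N L (finish L) st = T" unfolding joined_def child_iff by (simp add: finish_def T_eq)
  have "u \<in> V" if "(v, u) \<in> (adj T)\<^sup>*" for u using that
  proof (induction rule: rtrancl_induct)
    case (step y z)
    then have "{y, z} \<in> E" using T_sub by (auto simp: adj_def)
    then show ?case using edge_in by blast
  qed (rule v)
  moreover have "(v, u) \<in> (adj T)\<^sup>*" if "u \<in> V" for u using T_conn v that by (simp add: connected_graph_def)
  ultimately show ?thesis unfolding J supernode_def by blast
qed

lemma main_run:
  assumes v: "v \<in> V"
  shows "best (run N L (main_prog link L) init_state v) = smc"
proof -
  define s1 where "s1 = run N L ids init_state"
  define s2 where "s2 = run N L (positions L) s1"
  define s3 where "s3 = run N L (cuts link L) s2"
  define s4 where "s4 = run N L (concat (map (slot L) (slots L))) s3"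
  have run: "run N L (main_prog link L) init_state = exec N L (finish L) s4"
    unfolding main_prog_def s4_def s3_def s2_def s1_def by (simp only: run_append run_Cons run_Nil)
  have s1: "s1 u = (init_state u)\<lparr>pid := pth u, seg := Suc u, off := 0\<rparr>" if "u \<in> V" for u
    unfolding s1_def by (rule ids_run[OF _ that]) (simp add: init_state_def)
  have "base s2" unfolding s2_def
    by (rule positions_run) (simp add: s1 init_state_def)
  note C = cuts_run[OF this, folded s3_def]
  have val: "smc \<le> best (s3 a)" if "a \<in> V'" for a
    using C(2)[OF V'_V[OF that]] smc_le_cube by (simp add: big_cut_def power_add)
  note S = slots_run[OF C(1) val, of "slots L", folded s4_def]
  have R: "ready s4" using S by blast
  let ?g = "\<lambda>a. min (best (s4 a)) (cut (s4 a))"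
  have cut: "cut (s4 a) = c1 a" if "a \<in> V'" for a using R that by (simp add: ready_def)
  have lower: "smc \<le> ?g a" if "a \<in> V'" for a
  proof -
    have "smc \<le> c1 a" using that by (intro smc_le) (simp add: cands_def)
    moreover have "smc \<le> best (s4 a)" using S that by blast
    ultimately show ?thesis using cut[OF that] by simp
  qed
  have "\<exists>a\<in>V'. ?g a \<le> smc"
  proof -
    from smc_in consider (one) a where "a \<in> V'" "smc = c1 a"
      | (two) a b where "smc = c1 a + c1 b - 2 * W a b" "elig a" "elig b" "pth a \<noteq> pth b"
      unfolding cands_def by blast
    then show ?thesis
    proof cases
      case one
      then show ?thesis using cut by (intro bexI[of _ a]) auto
    next
      case two
      have V: "a \<in> V'" "b \<in> V'" using two by (auto simp: elig_def)
      show ?thesis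
      proof (cases "c1 a \<le> smc \<or> c1 b \<le> smc")
        case True
        then show ?thesis using V cut by (metis min.coboundedI2)
      next
        case False
        \<comment> \<open>These bounds make the truncated subtraction in \<open>smc\<close> exact.
          Since the pair beats both single cuts, each of the two paths then finds the other, and
          their indices form one of the slots.\<close>
        have W: "W a b \<le> c1 a" "W b a \<le> c1 b" using W_le V two(4) by auto
        then have "c1 a < 2 * W a b" "c1 b < 2 * W b a" using False two(1) W_commute[of a b] by linarith+
        then obtain s m s' m' where q: "s \<le> 3 * L" "m \<in> {1..4}" "quantile s m (pth a) = pth b"
          "s' \<le> 3 * L" "m' \<in> {1..4}" "quantile s' m' (pth b) = pth a"
          using interested[OF V two(4)] interested[OF V(2,1)] two(4) by metis
        have "((s, m), (s', m')) \<in> set (slots L)" using q by (auto simp: slots_def Let_def)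
        moreover have "linked a b" using \<open>c1 a < 2 * W a b\<close> by (intro W_pos_linked) simp
        ultimately have "best (s4 a) \<le> cost a b" using S V two(4) q by blast
        also have "cost a b = smc" using two by (simp add: cost_def cm_def)
        finally show ?thesis using V by (intro bexI[of _ a]) auto
      qed
    qed
  qed
  then obtain a where a: "a \<in> V'" "?g a = smc" using lower by (metis order_antisym)
  let ?f = "\<lambda>u. share (finish L) (s4 u) (nbr_agg N L (finish L) s4 u)"
  have f: "?f u 2 = (if u \<in> V' then 2 * big_cut L - ?g u else 0)" if "u \<in> V" for u
    using R that by (auto simp: finish_def ready_def base_def V'_pth)
  have "vagg n ?f V 2 = 2 * big_cut L - smc"
  proof (rule vagg_max_eqI)
    show "finite V" by (rule finite_V)
    show "?f u 2 \<le> 2 * big_cut L - smc" if "u \<in> V" for u using f[OF that] lower[of u] by auto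
    have "2 * big_cut L - smc \<le> 2 ^ (3 * L + 3)" by (simp add: big_cut_def power_add)
    then show "2 * big_cut L - smc < 2 ^ n" by (rule pow_width[rotated 2]) simp_all
    show "2 * big_cut L - smc = 0 \<or> (\<exists>u\<in>V. ?f u 2 = 2 * big_cut L - smc)"
      using f[OF V'_V[OF a(1)]] a V'_V by (intro disjI2 bexI[of _ a]) auto
  qed auto
  moreover have "update (finish L) x G S = x\<lparr>best := 2 * big_cut L - S 2\<rparr>" for x G S by (simp add: finish_def)
  ultimately have "best (run N L (main_prog link L) init_state v) = 2 * big_cut L - (2 * big_cut L - smc)"
    unfolding run exec_def supernode_finish[OF v] by simp
  then show ?thesis using smc_le_cube by (simp add: big_cut_def power_add)
qed

end

text \<open>At most \<open>144 * (L + 1) ^ 2\<close> slots of at most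
  \<open>18 * (L + 1) ^ 2\<close> steps account for 2592; the rest of the program is quadratic in
  \<open>L\<close>, and 3000 is rounded up.\<close>

lemma length_main_prog: "length (main_prog link L) \<le> 3000 * (L + 1) ^ 4"
proof -
  have suf: "length (suffix c) = Suc c" for c by (simp add: suffix_def)
  have st: "length (positions L) = L * (2 * L + 5)"
    by (simp add: positions_def stage_def length_concat sum_list_replicate algebra_simps)
  have fi: "length (find_partner L s m) = 2 * L + 3" for s m
  proof -
    have "length \<circ> find_step s m = (\<lambda>_. 2)" by (simp add: fun_eq_iff find_step_def)
    then show ?thesis by (simp add: find_partner_def length_concat sum_list_triv del: upt_Suc)
  qed
  have le: "length (level L l) \<le> 2 * L + 10" if "l \<le> L" for l using that by (simp add: level_def suf)
  have "sum_list (map (\<lambda>l. length (level L l)) (rev [0..<Suc L])) \<le> sum_list (map (\<lambda>_. 2 * L + 10) (rev [0..<Suc L]))"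
    by (rule sum_list_mono) (use le in auto)
  also have "\<dots> = (L + 1) * (2 * L + 10)" by (simp add: sum_list_triv)
  finally have lv: "length (concat (map (level L) (rev [0..<Suc L]))) \<le> (L + 1) * (2 * L + 10)"
    by (simp add: length_concat comp_def)
  have sl: "length (slot L t) \<le> 18 * (L + 1) ^ 2" for t
  proof -
    obtain s m s' m' where t: "t = ((s, m), (s', m'))" by (metis prod.exhaust)
    have "length (slot L t) = 4 * L + 8 + length (concat (map (level L) (rev [0..<Suc L])))"
      unfolding t slot_def by (simp add: fi)
    also have "\<dots> \<le> 4 * L + 8 + (L + 1) * (2 * L + 10)" using lv by simp
    also have "\<dots> \<le> 18 * (L + 1) ^ 2" by (simp add: power2_eq_square algebra_simps)
    finally show ?thesis .
  qed
  have "sum_list (map (\<lambda>t. length (slot L t)) (slots L)) \<le> sum_list (map (\<lambda>_. 18 * (L + 1) ^ 2) (slots L))"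
    by (rule sum_list_mono) (rule sl)
  also have "\<dots> = length (slots L) * (18 * (L + 1) ^ 2)" by (simp add: sum_list_triv)
  also have "length (slots L) = (4 * (3 * L + 1)) ^ 2" by (simp add: slots_def Let_def power2_eq_square)
  also have "(4 * (3 * L + 1)) ^ 2 * (18 * (L + 1) ^ 2) \<le> (12 * (L + 1)) ^ 2 * (18 * (L + 1) ^ 2)"
    by (intro mult_le_mono1 power_mono) auto
  also have "\<dots> = 2592 * (L + 1) ^ 4" by (simp add: power2_eq_square power4_eq_xxxx algebra_simps)
  finally have s: "length (concat (map (slot L) (slots L))) \<le> 2592 * (L + 1) ^ 4"
    by (simp add: length_concat comp_def)
  have cu: "length (cuts link L) = 3 * L + 9" by (simp add: cuts_def suf)
  have "length (main_prog link L) \<le> 2 + L * (2 * L + 5) + (3 * L + 9) + 2592 * (L + 1) ^ 4 + 1"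
    unfolding main_prog_def using s st cu by (simp add: ids_def)
  also have "2 + L * (2 * L + 5) + (3 * L + 9) + 1 \<le> 12 * (L + 1) ^ 2"
    by (simp add: power2_eq_square algebra_simps)
  then have "2 + L * (2 * L + 5) + (3 * L + 9) + 2592 * (L + 1) ^ 4 + 1 \<le> 12 * (L + 1) ^ 2 + 2592 * (L + 1) ^ 4"
    by simp
  also have "(L + 1) ^ 2 \<le> (L + 1) ^ 4" by (rule power_increasing) auto
  then have "12 * (L + 1) ^ 2 + 2592 * (L + 1) ^ 4 \<le> 3000 * (L + 1) ^ 4" by simp
  finally show ?thesis .
qed

section \<open>Growth bounds\<close>

lemma eventually_ln_ge_1: "eventually (\<lambda>n::nat. 1 \<le> ln (real n)) at_top"
proof -
  have "filterlim (\<lambda>n::nat. ln (real n)) at_top at_top"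
    by (rule filterlim_compose[OF ln_at_top filterlim_real_sequentially])
  then show ?thesis by (simp add: filterlim_at_top)
qed

lemma ln_power_bigo: "k \<le> m \<Longrightarrow> (\<lambda>n::nat. ln (real n) ^ k) \<in> O(\<lambda>n. ln (real n) ^ m)"
  by (rule landau_o.big_mono, rule eventually_mono[OF eventually_ln_ge_1])
    (auto simp: abs_of_nonneg intro!: power_increasing)

lemma soft_O_1_const: "soft_O_1 (\<lambda>_. c)"
  unfolding soft_O_1_def by (rule exI[of _ 0]) simp

lemma soft_O_1_add:
  assumes "soft_O_1 f" "soft_O_1 g" shows "soft_O_1 (\<lambda>n. f n + g n)"
proof -
  obtain k m where k: "(\<lambda>n. real (f n)) \<in> O(\<lambda>n. ln (real n) ^ k)" and m: "(\<lambda>n. real (g n)) \<in> O(\<lambda>n. ln (real n) ^ m)"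
    using assms by (auto simp: soft_O_1_def)
  have "(\<lambda>n. real (f n)) \<in> O(\<lambda>n. ln (real n) ^ max k m)" "(\<lambda>n. real (g n)) \<in> O(\<lambda>n. ln (real n) ^ max k m)"
    using landau_o.big_trans[OF k ln_power_bigo] landau_o.big_trans[OF m ln_power_bigo] by auto
  then have "(\<lambda>n. real (f n) + real (g n)) \<in> O(\<lambda>n. ln (real n) ^ max k m)" by (rule sum_in_bigo)
  then show ?thesis unfolding soft_O_1_def by (intro exI[of _ "max k m"]) simp
qed

lemma soft_O_1_mult:
  assumes "soft_O_1 f" "soft_O_1 g" shows "soft_O_1 (\<lambda>n. f n * g n)"
proof -
  obtain k m where k: "(\<lambda>n. real (f n)) \<in> O(\<lambda>n. ln (real n) ^ k)" and m: "(\<lambda>n. real (g n)) \<in> O(\<lambda>n. ln (real n) ^ m)"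
    using assms by (auto simp: soft_O_1_def)
  from landau_o.big_mult[OF k m] show ?thesis
    unfolding soft_O_1_def by (intro exI[of _ "k + m"]) (simp add: power_add)
qed

lemma soft_O_1_power: "soft_O_1 f \<Longrightarrow> soft_O_1 (\<lambda>n. f n ^ k)"
  by (induction k) (auto intro: soft_O_1_const soft_O_1_mult)

text \<open>If the bit length is \<open>Suc j\<close>, then \<open>2 ^ j\<close> is at most the
  number, and taking logarithms of a polynomial bound gives a multiple of
  \<open>ln n\<close>.\<close>

lemma soft_O_1_bitlen:
  assumes "poly_bounded f" shows "soft_O_1 (\<lambda>n. bitlen (f n))"
proof -
  obtain k where "(\<lambda>n. real (f n)) \<in> O(\<lambda>n. real n ^ k)" using assms by (auto simp: poly_bounded_def)
  then obtain c where c: "c > 0" "eventually (\<lambda>n. norm (real (f n)) \<le> c * norm (real n ^ k)) at_top"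
    by (auto elim: landau_o.bigE)
  \<comment> \<open>The summand 1 pays for the last bit, using \<open>1 \<le> ln n\<close>; the
    fraction bounds the binary logarithm of \<open>c * n ^ k\<close> in units of
    \<open>ln n\<close>.\<close>
  define C where "C = 1 + (\<bar>ln c\<bar> + real k) / ln 2"
  have "eventually (\<lambda>n. norm (real (bitlen (f n))) \<le> C * norm (ln (real n) ^ 1)) at_top"
    using c(2) eventually_ln_ge_1 eventually_gt_at_top[of 0]
  proof eventually_elim
    case (elim n)
    have l2: "0 < ln (2::real)" by simp
    have "real (bitlen (f n)) \<le> C * ln (real n)"
    proof (cases "bitlen (f n)")
      case 0
      have "0 \<le> C" unfolding C_def using l2 by simp
      then show ?thesis using 0 elim(2) by simp
    next
      case (Suc j)
      have "\<not> f n < 2 ^ j" using bitlen_le[of "f n" j] Suc by auto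
      then have "(2::nat) ^ j \<le> f n" by simp
      then have "(2::real) ^ j \<le> real (f n)" by (metis of_nat_le_iff of_nat_numeral of_nat_power)
      also have "\<dots> \<le> c * real n ^ k" using elim(1) by simp
      finally have "ln ((2::real) ^ j) \<le> ln (c * real n ^ k)" using c(1) elim(3) by (subst ln_le_cancel_iff) auto
      then have "real j * ln 2 \<le> ln c + real k * ln (real n)"
        using c(1) elim(3) by (simp add: ln_realpow ln_mult)
      also have "\<dots> \<le> (\<bar>ln c\<bar> + real k) * ln (real n)"
      proof -
        have "ln c \<le> \<bar>ln c\<bar> * ln (real n)" using elim(2) mult_left_mono[of 1 "ln (real n)" "\<bar>ln c\<bar>"] by linarith
        then show ?thesis by (simp add: distrib_right)
      qed
      finally have "real j \<le> (\<bar>ln c\<bar> + real k) * ln (real n) / ln 2" using l2 by (simp add: field_simps)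
      then show ?thesis using elim(2) Suc unfolding C_def by (simp add: distrib_right)
    qed
    then show ?case using elim(2) by simp
  qed
  then have "(\<lambda>n. real (bitlen (f n))) \<in> O(\<lambda>n. ln (real n) ^ 1)" by (rule bigoI)
  then show ?thesis unfolding soft_O_1_def by blast
qed

theorem theorem7p2:
  fixes id_bits max_weight :: "nat \<Rightarrow> nat" and link :: bool
  assumes "soft_O_1 id_bits" and "poly_bounded max_weight"
  shows "\<exists>(A :: algorithm) (B :: nat \<Rightarrow> nat) (R :: nat \<Rightarrow> nat).
           soft_O_1 B \<and> soft_O_1 R \<and>
           (\<forall>(N :: network) (Ps :: node list list).
              valid_network id_bits max_weight N \<and> star_instance N Ps \<longrightarrow>
              computes A N (B (size_of N)) (R (size_of N)) (star_min_cut link N Ps))"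
proof -
  \<comment> \<open>The sum exceeds neither class of growth and dominates both exponents, so one bit
    length covers identifiers and weights.\<close>
  define K where "K n = id_bits n + bitlen (max_weight n)" for n
  define B where "B n = 128 * (K n + 1)" for n
  define R where "R n = 2 + 2 * (3000 * (K n + 1) ^ 4)" for n
  have K: "soft_O_1 (\<lambda>n. K n + 1)"
    unfolding K_def by (intro soft_O_1_add assms(1) soft_O_1_bitlen[OF assms(2)] soft_O_1_const)
  have "soft_O_1 B" unfolding B_def by (intro soft_O_1_mult soft_O_1_const K)
  moreover have "soft_O_1 R"
    unfolding R_def by (intro soft_O_1_add soft_O_1_mult soft_O_1_power soft_O_1_const K)
  moreover have "computes (compile (main_prog link) init_state best) N (B (size_of N)) (R (size_of N)) (star_min_cut link N Ps)"
    if valid: "valid_network id_bits max_weight N" and star: "star_instance N Ps" for N Ps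
  proof -
    interpret star_net N Ps link
      using valid star by unfold_locales (auto simp: valid_network_def)
    let ?K = "K (size_of N)"
    have pow: "(2::nat) ^ a \<le> 2 ^ ?K" if "a \<le> ?K" for a using that by (rule power_increasing) simp
    show ?thesis
    proof (rule computes_compile[OF ugraph connected oriented])
      show "\<forall>v\<in>nodes N. v < 2 ^ ?K"
        using valid pow[of "id_bits (size_of N)"] unfolding valid_network_def K_def by (meson le_add1 less_le_trans)
      show "\<forall>e\<in>edges N. weight N e < 2 ^ ?K"
      proof
        fix e assume "e \<in> edges N"
        then have "weight N e \<le> max_weight (size_of N)" using valid by (simp add: valid_network_def)
        also have "\<dots> < 2 ^ bitlen (max_weight (size_of N))" by (rule less_two_power_bitlen)
        also have "\<dots> \<le> 2 ^ ?K" by (rule pow) (simp add: K_def)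
        finally show "weight N e < 2 ^ ?K" .
      qed
      show "best (run N L (main_prog link L) init_state v) = star_min_cut link N Ps"
        if "\<forall>v\<in>nodes N. v < 2 ^ L" "\<forall>e\<in>edges N. weight N e < 2 ^ L" "v \<in> nodes N" for L v
      proof -
        interpret star_prog N Ps link L using that by unfold_locales auto
        show ?thesis using main_run[OF that(3)] by (simp add: smc_def)
      qed
      show "128 * (?K + 1) \<le> B (size_of N)" by (simp add: B_def)
      show "2 + 2 * length (main_prog link L) \<le> R (size_of N)" if "L \<le> ?K" for L
      proof -
        have "length (main_prog link L) \<le> 3000 * (L + 1) ^ 4" by (rule length_main_prog)
        also have "\<dots> \<le> 3000 * (?K + 1) ^ 4" using that by (intro mult_le_mono2 power_mono) auto
        finally show ?thesis by (simp add: R_def)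
      qed
    qed
  qed
  ultimately show ?thesis by blast
qed

end
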